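(* Let $W_h\subset W_{\mathrm{per}}(Y;\mathbb{R}^n)$, $U_h\subset H^1_{\mathrm{per}}(Y)$ and $M_h\subset U_h\cap M$ be closed linear subspaces and $X_h:=W_h\times U_h\subset X$. Then there exists a unique $(m_h,(w_h,u_h))\in M_h\times X_h$ solving the discrete mixed formulation $$a\big((w_h,u_h),(w_h',u_h')\big)+b\big(m_h,(w_h',u_h')\big)=0\quad\forall (w_h',u_h')\in X_h,\qquad b\big(m_h',(w_h,u_h)\big)=0\quad\forall m_h'\in M_h.$$ Further, if $(m,(w,u))\in M\times X$ denotes the (unique) solution of the continuous mixed formulation $$a\big((w,u),(w',u')\big)+b\big(m,(w',u')\big)=0\quad\forall (w',u')\in X,\qquad b\big(m',(w,u)\big)=0\quad\forall m'\in M,$$ then $$|\!|\!|(w-w_h,u-u_h)|\!|\!|_{\lambda}\le C_e\inf_{(w_h',u_h')\in X_h}|\!|\!|(w-w_h',u-u_h')|\!|\!|_{\lambda},\qquad C_e:=2\,\frac{C_L}{C_M}\left(1+\frac{C_b}{c_b}\right),$$ where $$C_M:=\tfrac14\big(1-\sqrt{1-\delta}\big),\qquad C_L:=2+\sqrt2\sqrt{1-\delta}+\sigma_1+\tilde\sigma_2\Big(\tfrac12+\tfrac{n}{\pi^2}\lambda\Big),$$ $$C_b:=\lambda^{-1/2}\Big(\tfrac12+\tfrac{n}{\pi^2}\lambda\Big)^{1/2},\qquad c_b:=\lambda^{-1/2}\Big(2+\tfrac{n}{\pi^2}\lambda\Big)^{-1/2}.$$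
   Context: Let $n\in\{2,3\}$, $Y:=(0,1)^n$, $\Lambda$ a compact metric space, $\mathcal{S}^{n\times n}$ the real symmetric $n\times n$ matrices. Let $A=(a_{ij}):\mathbb{R}^n\times\Lambda\to\mathcal{S}^{n\times n}$, $b=(b_i):\mathbb{R}^n\times\Lambda\to\mathbb{R}^n$, $c,f:\mathbb{R}^n\times\Lambda\to\mathbb{R}$ be $Y$-periodic in $y\in\mathbb{R}^n$ and uniformly continuous on $\mathbb{R}^n\times\Lambda$; write $A^\alpha:=A(\cdot,\alpha)$, and similarly $b^\alpha,c^\alpha,f^\alpha$. Assume $\inf_{\mathbb{R}^n\times\Lambda}c>0$; that there are $\zeta_1,\zeta_2>0$ with $\zeta_1|\xi|^2\le A(y,\alpha)\xi\cdot\xi\le\zeta_2|\xi|^2$ for all $y,\xi\in\mathbb{R}^n$, $\alpha\in\Lambda$; and the Cordes condition: for some constants $\lambda>0$, $\delta\in(0,1)$, $$|A|^2+\frac{|b|^2}{2\lambda}+\frac{c^2}{\lambda^2}\le\frac{1}{n+\delta}\Big(\mathrm{tr}(A)+\frac{c}{\lambda}\Big)^2\quad\text{in }\mathbb{R}^n\times\Lambda,$$ with $|A|$ the Frobenius norm. Define $\gamma:=\big(|A|^2+\frac{|b|^2}{2\lambda}+\frac{c^2}{\lambda^2}\big)^{-1}\big(\mathrm{tr}(A)+\frac{c}{\lambda}\big)$, $\gamma^\alpha:=\gamma(\cdot,\alpha)$. $H^k_{\mathrm{per}}(Y)$ denotes the Sobolev space of $Y$-periodic functions. $W_{\mathrm{per}}(Y):=\{v\in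 H^1_{\mathrm{per}}(Y):\int_Y v=0\}$, $W_{\mathrm{per}}(Y;\mathbb{R}^n):=(W_{\mathrm{per}}(Y))^n$, $X:=W_{\mathrm{per}}(Y;\mathbb{R}^n)\times H^1_{\mathrm{per}}(Y)$, and $M\subset W_{\mathrm{per}}(Y)$ is a fixed closed linear subspace. $Dw$ is the Jacobian of $w$, $\mathrm{rot}(w):=\partial_2w_1-\partial_1w_2$ if $n=2$, and $\mathrm{rot}(w):=(\partial_2w_3-\partial_3w_2,\partial_3w_1-\partial_1w_3,\partial_1w_2-\partial_2w_1)$ if $n=3$. For $(w,u)\in X$: $$F_\gamma[(w,u)]:=\sup_{\alpha\in\Lambda}\{\gamma^\alpha(-A^\alpha:Dw-b^\alpha\cdot\nabla u+c^\alpha u-f^\alpha)\},\qquad L_\lambda(w,u):=-\nabla\cdot w+\lambda u,$$ $$|\!|\!|(w,u)|\!|\!|_\lambda^2:=\|Dw\|_{L^2(Y)}^2+2\lambda\|\nabla u\|_{L^2(Y)}^2+\lambda^2\|u\|_{L^2(Y)}^2.$$ Constants: $\sigma_1:=1-\frac12\sqrt{1-\delta}$, $\tilde\sigma_2:=\frac{1-\sqrt{1-\delta}}{2}+\frac{1}{4(1-\sqrt{1-\delta})}$, $\sigma_2:=\lambda\tilde\sigma_2$. The form $a:X\times X\to\mathbb{R}$ (nonlinear in the first, linear in the second argument) and the bilinear form $b:M\times X\to\mathbb{R}$ (not to be confused with the coefficient $b^\alpha$) are $$a((w,u),(w',u')):=\int_Y F_\gamma[(w,u)]\,L_\lambda(w',u')+\sigma_1\int_Y\mathrm{rot}(w)\cdot\mathrm{rot}(w')+\sigma_2\int_Y(\nabla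 u-w)\cdot(\nabla u'-w'),$$ $$b(m,(w,u)):=\int_Y\nabla m\cdot(\nabla u-w).$$ *)

theory Defs
  imports "HOL-Analysis.Analysis"
begin

text \<open>
  Functions on the unit cell \<open>Y = (0,1)^n\<close>, \<open>n = CARD('n)\<close>, are represented by functions on
  \<open>real ^ 'n\<close> of which only the values on \<open>Y\<close> matter, up to Lebesgue null sets; elements of
  Lebesgue and Sobolev spaces are thus identified when they agree almost everywhere on \<open>Y\<close>.
\<close>

abbreviation cell :: "(real ^ 'n) set" where
  "cell \<equiv> box 0 1"

abbreviation cellM :: "(real ^ 'n) measure" where
  "cellM \<equiv> lebesgue_on cell"

definition Y_periodic :: "(real ^ 'n \<Rightarrow> 'b) \<Rightarrow> bool" where
  "Y_periodic f \<longleftrightarrow> (\<forall>y k. (\<forall>i. k $ i \<in> \<int>) \<longrightarrow> f (y + k) = f y)"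

definition L2 :: "(real ^ 'n \<Rightarrow> 'b::euclidean_space) set" where
  "L2 = {f \<in> borel_measurable cellM. integrable cellM (\<lambda>y. (norm (f y))\<^sup>2)}"

definition L2norm :: "(real ^ 'n \<Rightarrow> 'b::euclidean_space) \<Rightarrow> real" where
  "L2norm f = sqrt (\<integral>y. (norm (f y))\<^sup>2 \<partial>cellM)"


section \<open>Periodic Sobolev spaces\<close>

definition partial_deriv :: "'n \<Rightarrow> (real ^ 'n \<Rightarrow> real) \<Rightarrow> real ^ 'n \<Rightarrow> real" where
  "partial_deriv i \<phi> y = frechet_derivative \<phi> (at y) (axis i 1)"

primrec Ck :: "nat \<Rightarrow> (real ^ 'n \<Rightarrow> real) \<Rightarrow> bool" where
  "Ck 0 \<phi> \<longleftrightarrow> continuous_on UNIV \<phi>"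
| "Ck (Suc k) \<phi> \<longleftrightarrow> (\<forall>y. \<phi> differentiable (at y)) \<and> (\<forall>i. Ck k (partial_deriv i \<phi>))"

definition smooth :: "(real ^ 'n \<Rightarrow> real) \<Rightarrow> bool" where
  "smooth \<phi> \<longleftrightarrow> (\<forall>k. Ck k \<phi>)"

definition test_function :: "(real ^ 'n \<Rightarrow> real) \<Rightarrow> bool" where
  "test_function \<phi> \<longleftrightarrow> smooth \<phi> \<and> (\<exists>K. compact K \<and> K \<subseteq> cell \<and> (\<forall>y. y \<notin> K \<longrightarrow> \<phi> y = 0))"

definition has_weak_gradient :: "(real ^ 'n \<Rightarrow> real) \<Rightarrow> (real ^ 'n \<Rightarrow> real ^ 'n) \<Rightarrow> bool" where
  "has_weak_gradient v g \<longleftrightarrow> g \<in> L2 \<and>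
     (\<forall>\<phi>. test_function \<phi> \<longrightarrow> (\<forall>i.
        (\<integral>y. v y * partial_deriv i \<phi> y \<partial>cellM) = - (\<integral>y. g y $ i * \<phi> y \<partial>cellM)))"

text \<open>The weak gradient is only determined almost everywhere; a representative is chosen.\<close>

definition wgrad :: "(real ^ 'n \<Rightarrow> real) \<Rightarrow> real ^ 'n \<Rightarrow> real ^ 'n" where
  "wgrad v = (SOME g. has_weak_gradient v g)"

definition H1 :: "(real ^ 'n \<Rightarrow> real) set" where
  "H1 = {v \<in> L2. \<exists>g. has_weak_gradient v g}"

definition H1norm :: "(real ^ 'n \<Rightarrow> real) \<Rightarrow> real" where
  "H1norm v = sqrt ((L2norm v)\<^sup>2 + (L2norm (wgrad v))\<^sup>2)"

text \<open>\<open>H\<^sup>1\<^sub>p\<^sub>e\<^sub>r(Y)\<close> is the closure of the smooth \<open>Y\<close>-periodic functions in \<open>H\<^sup>1(Y)\<close>.\<close>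

definition H1_per :: "(real ^ 'n \<Rightarrow> real) set" where
  "H1_per = {v \<in> H1. \<exists>\<phi>. (\<forall>k::nat. smooth (\<phi> k) \<and> Y_periodic (\<phi> k)) \<and>
                          (\<lambda>k. H1norm (\<lambda>y. \<phi> k y - v y)) \<longlonglongrightarrow> 0}"

definition W_per :: "(real ^ 'n \<Rightarrow> real) set" where
  "W_per = {v \<in> H1_per. (\<integral>y. v y \<partial>cellM) = 0}"

definition W_per_vec :: "(real ^ 'n \<Rightarrow> real ^ 'n) set" where
  "W_per_vec = {w. \<forall>i. (\<lambda>y. w y $ i) \<in> W_per}"

definition H1norm_vec :: "(real ^ 'n \<Rightarrow> real ^ 'n) \<Rightarrow> real" where
  "H1norm_vec w = sqrt (\<Sum>i\<in>UNIV. (H1norm (\<lambda>y. w y $ i))\<^sup>2)"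

text \<open>
  \<open>S\<close> is a linear subspace of the function space \<open>V\<close>, closed in \<open>V\<close> for the (semi)norm \<open>N\<close>.
  Closedness entails that \<open>S\<close> contains every member of \<open>V\<close> at distance 0 from one of its elements,
  i.e. \<open>S\<close> is a union of almost-everywhere classes.
\<close>

definition closed_linear_subspace ::
    "((real ^ 'n \<Rightarrow> 'b::real_vector) \<Rightarrow> real) \<Rightarrow> (real ^ 'n \<Rightarrow> 'b) set \<Rightarrow> (real ^ 'n \<Rightarrow> 'b) set \<Rightarrow> bool"
  where
  "closed_linear_subspace N V S \<longleftrightarrow>
     S \<subseteq> V \<and> (\<lambda>y. 0) \<in> S \<and>
     (\<forall>v\<in>S. \<forall>v'\<in>S. (\<lambda>y. v y + v' y) \<in> S) \<and>
     (\<forall>t. \<forall>v\<in>S. (\<lambda>y. t *\<^sub>R v y) \<in> S) \<and>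
     (\<forall>s v. (\<forall>k::nat. s k \<in> S) \<longrightarrow> v \<in> V \<longrightarrow> (\<lambda>k. N (\<lambda>y. s k y - v y)) \<longlonglongrightarrow> 0 \<longrightarrow> v \<in> S)"


section \<open>Differential operators\<close>

definition Jac :: "(real ^ 'n \<Rightarrow> real ^ 'n) \<Rightarrow> real ^ 'n \<Rightarrow> real ^ 'n ^ 'n" where
  "Jac w y = (\<chi> i. wgrad (\<lambda>z. w z $ i) y)"

definition divergence :: "(real ^ 'n \<Rightarrow> real ^ 'n) \<Rightarrow> real ^ 'n \<Rightarrow> real" where
  "divergence w y = (\<Sum>i\<in>UNIV. Jac w y $ i $ i)"

text \<open>
  The index type is required to be a finite commutative ring (as are the numeral types \<open>2\<close> and \<open>3\<close>)
  solely in order to name the coordinates \<open>1, 2, 3\<close>. If it has two elements then \<open>1 \<noteq> 2 = 0\<close>, and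
  if it has three elements then \<open>1\<close>, \<open>2\<close> and \<open>3 = 0\<close> are distinct, so these numerals enumerate it.
\<close>

definition rot2 :: "(real ^ 'n::{finite,comm_ring_1} \<Rightarrow> real ^ 'n::{finite,comm_ring_1}) \<Rightarrow> real ^ 'n::{finite,comm_ring_1} \<Rightarrow> real" where
  "rot2 w y = Jac w y $ 1 $ 2 - Jac w y $ 2 $ 1"

definition rot3 :: "(real ^ 'n::{finite,comm_ring_1} \<Rightarrow> real ^ 'n::{finite,comm_ring_1}) \<Rightarrow> real ^ 'n::{finite,comm_ring_1} \<Rightarrow> real ^ 3" where
  "rot3 w y = vector [Jac w y $ 3 $ 2 - Jac w y $ 2 $ 3,
                      Jac w y $ 1 $ 3 - Jac w y $ 3 $ 1,
                      Jac w y $ 2 $ 1 - Jac w y $ 1 $ 2]"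

definition rot_dot ::
    "(real ^ 'n::{finite,comm_ring_1} \<Rightarrow> real ^ 'n::{finite,comm_ring_1}) \<Rightarrow> (real ^ 'n::{finite,comm_ring_1} \<Rightarrow> real ^ 'n::{finite,comm_ring_1}) \<Rightarrow> real ^ 'n::{finite,comm_ring_1} \<Rightarrow> real"
  where
  "rot_dot w w' y = (if CARD('n) = 2 then rot2 w y * rot2 w' y else rot3 w y \<bullet> rot3 w' y)"


section \<open>The mixed formulation\<close>

text \<open>
  The norm and inner product of \<open>real ^ 'n ^ 'n\<close> are the Frobenius norm and the Frobenius product
  \<open>A : B\<close>.
\<close>

definition gamma_coeff ::
    "real \<Rightarrow> (real ^ 'n \<Rightarrow> 'l \<Rightarrow> real ^ 'n ^ 'n) \<Rightarrow> (real ^ 'n \<Rightarrow> 'l \<Rightarrow> real ^ 'n) \<Rightarrow>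
     (real ^ 'n \<Rightarrow> 'l \<Rightarrow> real) \<Rightarrow> real ^ 'n \<Rightarrow> 'l \<Rightarrow> real" where
  "gamma_coeff lam A b c y \<alpha> =
     inverse ((norm (A y \<alpha>))\<^sup>2 + (norm (b y \<alpha>))\<^sup>2 / (2 * lam) + (c y \<alpha>)\<^sup>2 / lam\<^sup>2) *
     (trace (A y \<alpha>) + c y \<alpha> / lam)"

definition F_gamma ::
    "real \<Rightarrow> (real ^ 'n \<Rightarrow> 'l \<Rightarrow> real ^ 'n ^ 'n) \<Rightarrow> (real ^ 'n \<Rightarrow> 'l \<Rightarrow> real ^ 'n) \<Rightarrow>
     (real ^ 'n \<Rightarrow> 'l \<Rightarrow> real) \<Rightarrow> (real ^ 'n \<Rightarrow> 'l \<Rightarrow> real) \<Rightarrow>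
     (real ^ 'n \<Rightarrow> real ^ 'n) \<times> (real ^ 'n \<Rightarrow> real) \<Rightarrow> real ^ 'n \<Rightarrow> real" where
  "F_gamma lam A b c f = (\<lambda>(w, u) y. SUP \<alpha>. gamma_coeff lam A b c y \<alpha> *
     (- (A y \<alpha> \<bullet> Jac w y) - b y \<alpha> \<bullet> wgrad u y + c y \<alpha> * u y - f y \<alpha>))"

definition L_op ::
    "real \<Rightarrow> (real ^ 'n \<Rightarrow> real ^ 'n) \<times> (real ^ 'n \<Rightarrow> real) \<Rightarrow> real ^ 'n \<Rightarrow> real" where
  "L_op lam = (\<lambda>(w, u) y. - divergence w y + lam * u y)"

definition triple_norm ::
    "real \<Rightarrow> (real ^ 'n \<Rightarrow> real ^ 'n) \<times> (real ^ 'n \<Rightarrow> real) \<Rightarrow> real" where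
  "triple_norm lam = (\<lambda>(w, u).
     sqrt ((L2norm (Jac w))\<^sup>2 + 2 * lam * (L2norm (wgrad u))\<^sup>2 + lam\<^sup>2 * (L2norm u)\<^sup>2))"

definition sigma1 :: "real \<Rightarrow> real" where
  "sigma1 \<delta> = 1 - 1 / 2 * sqrt (1 - \<delta>)"

definition sigma2_tilde :: "real \<Rightarrow> real" where
  "sigma2_tilde \<delta> = (1 - sqrt (1 - \<delta>)) / 2 + 1 / (4 * (1 - sqrt (1 - \<delta>)))"

definition sigma2 :: "real \<Rightarrow> real \<Rightarrow> real" where
  "sigma2 lam \<delta> = lam * sigma2_tilde \<delta>"

definition form_a ::
    "real \<Rightarrow> real \<Rightarrow> (real ^ 'n::{finite,comm_ring_1} \<Rightarrow> 'l \<Rightarrow> real ^ 'n::{finite,comm_ring_1} ^ 'n::{finite,comm_ring_1}) \<Rightarrow> (real ^ 'n::{finite,comm_ring_1} \<Rightarrow> 'l \<Rightarrow> real ^ 'n::{finite,comm_ring_1}) \<Rightarrow>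
     (real ^ 'n::{finite,comm_ring_1} \<Rightarrow> 'l \<Rightarrow> real) \<Rightarrow> (real ^ 'n::{finite,comm_ring_1} \<Rightarrow> 'l \<Rightarrow> real) \<Rightarrow>
     (real ^ 'n::{finite,comm_ring_1} \<Rightarrow> real ^ 'n::{finite,comm_ring_1}) \<times> (real ^ 'n::{finite,comm_ring_1} \<Rightarrow> real) \<Rightarrow>
     (real ^ 'n::{finite,comm_ring_1} \<Rightarrow> real ^ 'n::{finite,comm_ring_1}) \<times> (real ^ 'n::{finite,comm_ring_1} \<Rightarrow> real) \<Rightarrow> real" where
  "form_a lam \<delta> A b c f = (\<lambda>(w, u) (w', u').
     (\<integral>y. F_gamma lam A b c f (w, u) y * L_op lam (w', u') y \<partial>cellM) +
     sigma1 \<delta> * (\<integral>y. rot_dot w w' y \<partial>cellM) +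
     sigma2 lam \<delta> * (\<integral>y. (wgrad u y - w y) \<bullet> (wgrad u' y - w' y) \<partial>cellM))"

definition form_b ::
    "(real ^ 'n \<Rightarrow> real) \<Rightarrow> (real ^ 'n \<Rightarrow> real ^ 'n) \<times> (real ^ 'n \<Rightarrow> real) \<Rightarrow> real" where
  "form_b m = (\<lambda>(w, u). \<integral>y. wgrad m y \<bullet> (wgrad u y - w y) \<partial>cellM)"

text \<open>The mixed formulation posed on \<open>M \<times> X\<close>, for both the continuous and the discrete spaces.\<close>

definition mixed_solution ::
    "real \<Rightarrow> real \<Rightarrow> (real ^ 'n::{finite,comm_ring_1} \<Rightarrow> 'l \<Rightarrow> real ^ 'n::{finite,comm_ring_1} ^ 'n::{finite,comm_ring_1}) \<Rightarrow> (real ^ 'n::{finite,comm_ring_1} \<Rightarrow> 'l \<Rightarrow> real ^ 'n::{finite,comm_ring_1}) \<Rightarrow>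
     (real ^ 'n::{finite,comm_ring_1} \<Rightarrow> 'l \<Rightarrow> real) \<Rightarrow> (real ^ 'n::{finite,comm_ring_1} \<Rightarrow> 'l \<Rightarrow> real) \<Rightarrow>
     (real ^ 'n::{finite,comm_ring_1} \<Rightarrow> real) set \<Rightarrow>
     ((real ^ 'n::{finite,comm_ring_1} \<Rightarrow> real ^ 'n::{finite,comm_ring_1}) \<times> (real ^ 'n::{finite,comm_ring_1} \<Rightarrow> real)) set \<Rightarrow>
     (real ^ 'n::{finite,comm_ring_1} \<Rightarrow> real) \<Rightarrow> (real ^ 'n::{finite,comm_ring_1} \<Rightarrow> real ^ 'n::{finite,comm_ring_1}) \<times> (real ^ 'n::{finite,comm_ring_1} \<Rightarrow> real) \<Rightarrow> bool" where
  "mixed_solution lam \<delta> A b c f M X m x \<longleftrightarrow>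
     m \<in> M \<and> x \<in> X \<and>
     (\<forall>x'\<in>X. form_a lam \<delta> A b c f x x' + form_b m x' = 0) \<and>
     (\<forall>m'\<in>M. form_b m' x = 0)"


section \<open>Constants; \<open>n\<close> is the space dimension\<close>

definition C_M :: "real \<Rightarrow> real" where
  "C_M \<delta> = 1 / 4 * (1 - sqrt (1 - \<delta>))"

definition C_L :: "nat \<Rightarrow> real \<Rightarrow> real \<Rightarrow> real" where
  "C_L n lam \<delta> = 2 + sqrt 2 * sqrt (1 - \<delta>) + sigma1 \<delta> + sigma2_tilde \<delta> * (1 / 2 + real n / pi\<^sup>2 * lam)"

definition C_b :: "nat \<Rightarrow> real \<Rightarrow> real" where
  "C_b n lam = lam powr (- 1 / 2) * (1 / 2 + real n / pi\<^sup>2 * lam) powr (1 / 2)"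

definition c_b :: "nat \<Rightarrow> real \<Rightarrow> real" where
  "c_b n lam = lam powr (- 1 / 2) * (2 + real n / pi\<^sup>2 * lam) powr (- 1 / 2)"

definition C_e :: "nat \<Rightarrow> real \<Rightarrow> real \<Rightarrow> real" where
  "C_e n lam \<delta> = 2 * (C_L n lam \<delta> / C_M \<delta>) * (1 + C_b n lam / c_b n lam)"

end

theory Submission
  imports Defs "HOL-Computational_Algebra.Polynomial"
begin

text \<open>
  Because \<open>\<parallel>Dw\<parallel>\<^sup>2 = \<parallel>div w\<parallel>\<^sup>2 + \<parallel>rot w\<parallel>\<^sup>2\<close> for periodic \<open>w\<close>, and because the Cordes condition says that \<open>F\<close> differs
  from \<open>L\<close> by a Lipschitz perturbation with constant \<open>sqrt (1 - \<delta>)\<close>, the form \<open>a\<close> is strongly monotone and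
  Lipschitz continuous. A discrete solution is first found on the kernel of the constraint. As
  \<open>(0, m) \<in> X\<^sub>h\<close> for every multiplier \<open>m\<close>, each element of \<open>X\<^sub>h\<close> is the sum of such a pair and of an element
  of the kernel, which yields the multiplier. For the continuous solution \<open>F\<close> is orthogonal to
  \<open>- \<Delta>\<phi> + \<lambda>\<phi>\<close> for all trigonometric \<open>\<phi>\<close>, hence \<open>F = 0\<close>, then \<open>rot w = 0\<close> and \<open>w = \<nabla>u\<close>; so the multiplier
  does not enter the error estimate, which is Cea's lemma on the kernel. The Poincare inequality is
  needed with constant \<open>n / \<pi>\<^sup>2\<close>; on the torus it holds with \<open>n / 16\<close>.
\<close>

section \<open>Closed subspaces of Hilbert spaces\<close>

text \<open>The gradient \<open>wgrad\<close> is a choice among functions that agree almost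
  everywhere, so it is linear only up to null sets. The estimates therefore take place in Hilbert
  spaces of classes, where a pair is stored together with its derivatives, and the closure of the
  smooth periodic graphs stands for the Sobolev space: an identity that is continuous in function
  and gradient has to be checked for smooth functions only. For these, integration by parts is done
  with difference quotients, which reduces it to the invariance of integrals under translation.
  \<open>F\<close> merely lies in L2. That it vanishes is obtained without solving an elliptic
  equation: each wave is an eigenfunction of \<open>- \<Delta> + \<lambda>\<close> with positive
  eigenvalue, so orthogonality to the range of this operator is orthogonality to the waves, and
  these are total by Stone-Weierstrass. The gap between the sharp Poincare constant
  \<open>1 / (4 * pi\<^sup>2)\<close> of the torus and the required one leaves room for an
  elementary argument that averages over shifts instead of using Fourier series;
  \<open>pi < 4\<close> closes it.\<close>

lemma closed_subspace_projection_exists: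
  fixes S :: "'h::{real_inner, complete_space} set"
  assumes S: "subspace S" "closed S"
  shows "\<exists>p\<in>S. \<forall>k\<in>S. (x - p) \<bullet> k = 0"
proof -
  define d where "d = (INF s\<in>S. norm (x - s))"
  have 0: "0 \<in> S" using S(1) by (rule subspace_0)
  have bdd: "bdd_below ((\<lambda>s. norm (x - s)) ` S)"
    by (rule bdd_belowI[of _ 0]) auto
  have dle: "d \<le> norm (x - s)" if "s \<in> S" for s
    unfolding d_def using bdd that by (rule cINF_lower)
  have d0: "0 \<le> d" unfolding d_def using 0 by (intro cINF_greatest) auto
  have "\<exists>s\<in>S. norm (x - s) < d + inverse (real (Suc n))" for n
  proof (rule ccontr)
    assume "\<not> ?thesis"
    then have "d + inverse (real (Suc n)) \<le> d"
      unfolding d_def using 0 by (intro cINF_greatest) (auto simp: not_less)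
    then show False by simp
  qed
  then obtain s where s: "\<And>n. s n \<in> S" "\<And>n. norm (x - s n) < d + inverse (real (Suc n))"
    by metis
  have sq: "(norm (x - s n))\<^sup>2 \<le> d\<^sup>2 + (2 * d + 1) * inverse (real (Suc n))" for n
  proof -
    let ?e = "inverse (real (Suc n))"
    have e: "0 \<le> ?e" "?e \<le> 1" by (auto simp: field_simps)
    have "(norm (x - s n))\<^sup>2 \<le> (d + ?e)\<^sup>2"
      using s(2)[of n] by (intro power_mono) auto
    also have "\<dots> = d\<^sup>2 + 2 * d * ?e + ?e * ?e" by (simp add: power2_eq_square algebra_simps)
    also have "?e * ?e \<le> 1 * ?e" using e by (intro mult_right_mono) auto
    finally show ?thesis by (simp add: algebra_simps)
  qed
  have par: "(norm (s m - s n))\<^sup>2 \<le> 4 * (2 * d + 1) * inverse (real (Suc N))"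
    if "N \<le> m" "N \<le> n" for m n N
  proof -
    \<comment> \<open>The midpoint stays in \<open>S\<close>, so its distance to \<open>x\<close> is
      at least \<open>d\<close>. By the parallelogram law two near-minimisers are then close to each
      other.\<close>
    have "(1/2) *\<^sub>R (s m + s n) \<in> S" using s(1) S(1) by (intro subspace_scale subspace_add)
    then have "d \<le> norm (x - (1/2) *\<^sub>R (s m + s n))" by (rule dle)
    then have "d\<^sup>2 \<le> (norm (x - (1/2) *\<^sub>R (s m + s n)))\<^sup>2" using d0 by (intro power_mono) auto
    moreover have "(norm (s m - s n))\<^sup>2 = 2 * (norm (x - s m))\<^sup>2 + 2 * (norm (x - s n))\<^sup>2
        - 4 * (norm (x - (1/2) *\<^sub>R (s m + s n)))\<^sup>2"
      by (simp add: power2_norm_eq_inner algebra_simps inner_commute)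
    ultimately have "(norm (s m - s n))\<^sup>2 \<le> 2 * ((2*d+1) * inverse (real (Suc m))) + 2 * ((2*d+1) * inverse (real (Suc n)))"
      using sq[of m] sq[of n] by linarith
    also have "\<dots> \<le> 2 * ((2*d+1) * inverse (real (Suc N))) + 2 * ((2*d+1) * inverse (real (Suc N)))"
      using that d0 by (intro add_mono mult_left_mono le_imp_inverse_le) auto
    finally show ?thesis by (simp add: algebra_simps)
  qed
  have "Cauchy s"
  proof (rule metric_CauchyI)
    fix e :: real assume e: "0 < e"
    have "(\<lambda>N. 4 * (2 * d + 1) * inverse (real (Suc N))) \<longlonglongrightarrow> 4 * (2 * d + 1) * 0"
      by (intro tendsto_mult tendsto_const LIMSEQ_inverse_real_of_nat)
    then have "eventually (\<lambda>N. 4 * (2 * d + 1) * inverse (real (Suc N)) < e\<^sup>2) sequentially"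
      using e by (intro order_tendstoD(2)) auto
    then obtain N where N: "4 * (2 * d + 1) * inverse (real (Suc N)) < e\<^sup>2"
      by (auto simp: eventually_sequentially)
    show "\<exists>N. \<forall>m\<ge>N. \<forall>n\<ge>N. dist (s m) (s n) < e"
    proof (intro exI allI impI)
      fix m n assume "N \<le> m" "N \<le> n"
      then have "(norm (s m - s n))\<^sup>2 < e\<^sup>2" using par N by (meson le_less_trans)
      then show "dist (s m) (s n) < e"
        using e by (simp add: dist_norm power_less_imp_less_base)
    qed
  qed
  then obtain p where p: "s \<longlonglongrightarrow> p" using Cauchy_convergent convergent_def by blast
  have pS: "p \<in> S" using S(2) s(1) p closed_sequentially by blast
  have "(\<lambda>n. norm (x - s n)) \<longlonglongrightarrow> norm (x - p)" by (intro tendsto_intros p)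
  moreover have "(\<lambda>n. d + inverse (real (Suc n))) \<longlonglongrightarrow> d + 0"
    by (intro tendsto_add tendsto_const LIMSEQ_inverse_real_of_nat)
  ultimately have "norm (x - p) \<le> d"
    using s(2) by (intro LIMSEQ_le[of "\<lambda>n. norm (x - s n)" _ "\<lambda>n. d + inverse (real (Suc n))"]) (auto intro: less_imp_le)
  have "(x - p) \<bullet> k = 0" if k: "k \<in> S" for k
  proof (cases "k = 0")
    case False
    \<comment> \<open>This \<open>t\<close> minimises the squared distance from \<open>x\<close> to
      \<open>p + t *\<^sub>R k\<close>. As \<open>p\<close> is already optimal, nothing can be
      gained, which forces the inner product to vanish.\<close>
    define t where "t = ((x - p) \<bullet> k) / (k \<bullet> k)"
    have kk: "k \<bullet> k > 0" using False by simp
    have "p + t *\<^sub>R k \<in> S" using pS k S(1) by (intro subspace_scale subspace_add)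
    then have "norm (x - p) \<le> norm (x - (p + t *\<^sub>R k))" using dle \<open>norm (x - p) \<le> d\<close> by force
    then have "(norm (x - p))\<^sup>2 \<le> (norm ((x - p) - t *\<^sub>R k))\<^sup>2" by (intro power_mono) (auto simp: algebra_simps)
    also have "\<dots> = (norm (x - p))\<^sup>2 - 2 * t * ((x - p) \<bullet> k) + t * t * (k \<bullet> k)"
      by (simp add: power2_norm_eq_inner algebra_simps inner_commute)
    also have "t * t * (k \<bullet> k) = t * ((x - p) \<bullet> k)" using kk by (simp add: t_def)
    finally have "t * ((x - p) \<bullet> k) \<le> 0" by simp
    then have "((x - p) \<bullet> k) * ((x - p) \<bullet> k) \<le> 0" using kk by (simp add: t_def divide_le_0_iff)
    then show ?thesis
      by (smt (verit) mult_eq_0_iff zero_le_square)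
  qed simp
  with pS show ?thesis by blast
qed

text \<open>Zarantonello's argument for an operator that need not be linear: for a small step
  \<open>\<rho>\<close> the map \<open>x - \<rho> *\<^sub>R P (T x)\<close> is a contraction of
  \<open>S\<close>, and at its fixed point the projection of \<open>T x\<close> onto
  \<open>S\<close> is zero.\<close>

lemma strongly_monotone_variational_solution:
  fixes S :: "'h::{real_inner, complete_space} set" and T :: "'h \<Rightarrow> 'h"
  assumes S: "subspace S" "closed S"
    and L: "0 \<le> L" "\<And>x y k. x \<in> S \<Longrightarrow> y \<in> S \<Longrightarrow> k \<in> S \<Longrightarrow> \<bar>(T x - T y) \<bullet> k\<bar> \<le> L * norm (x - y) * norm k"
    and c: "0 < c" "\<And>x y. x \<in> S \<Longrightarrow> y \<in> S \<Longrightarrow> c * (norm (x - y))\<^sup>2 \<le> (T x - T y) \<bullet> (x - y)"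
  shows "\<exists>x\<in>S. \<forall>k\<in>S. T x \<bullet> k = 0"
proof -
  \<comment> \<open>\<open>T\<close> is controlled only when tested against \<open>S\<close>, and
    \<open>T x\<close> may lie outside \<open>S\<close>. The projection discards what is not
    controlled and keeps the iteration in \<open>S\<close>.\<close>
  define P where "P x = (SOME p. p \<in> S \<and> (\<forall>k\<in>S. (x - p) \<bullet> k = 0))" for x
  have P: "P x \<in> S" "\<And>k. k \<in> S \<Longrightarrow> (x - P x) \<bullet> k = 0" for x
    using someI_ex[OF closed_subspace_projection_exists[OF S, of x, unfolded Bex_def]]
    unfolding P_def by auto
  \<comment> \<open>The step \<open>c / L\<^sup>2\<close> would minimise
    \<open>1 - 2 * \<rho> * c + \<rho>\<^sup>2 * L\<^sup>2\<close>. The additional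
    \<open>c\<^sup>2\<close> in the denominator covers \<open>L = 0\<close> and keeps the resulting
    bound \<open>q\<close> nonnegative.\<close>
  define \<rho> where "\<rho> = c / (L\<^sup>2 + c\<^sup>2)"
  have LC: "0 < L\<^sup>2 + c\<^sup>2" using c(1) by (simp add: add_nonneg_pos)
  have \<rho>: "0 < \<rho>" using c(1) LC by (simp add: \<rho>_def)
  define q where "q = 1 - c\<^sup>2 / (L\<^sup>2 + c\<^sup>2)"
  have q: "0 \<le> q" "q < 1" using LC c(1) by (auto simp: q_def field_simps)
  have contr: "dist (x - \<rho> *\<^sub>R P (T x)) (y - \<rho> *\<^sub>R P (T y)) \<le> sqrt q * dist x y"
    if "x \<in> S" "y \<in> S" for x y
  proof -
    define s where "s = P (T x) - P (T y)"
    have s: "s \<in> S" unfolding s_def using P(1) S(1) by (intro subspace_diff)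
    have orth: "s \<bullet> k = (T x - T y) \<bullet> k" if "k \<in> S" for k
      using P(2)[OF that, of "T x"] P(2)[OF that, of "T y"] by (simp add: s_def inner_diff_left)
    have "norm s * norm s \<le> L * norm (x - y) * norm s"
      using orth[OF s] L(2)[OF that s] by (simp add: power2_norm_eq_inner[symmetric] power2_eq_square)
    then have "norm s \<le> L * norm (x - y)"
      using L(1) by (cases "s = 0") (auto simp: mult_le_cancel_right)
    then have "(norm s)\<^sup>2 \<le> (L * norm (x - y))\<^sup>2" by (rule power_mono) simp
    then have sL: "\<rho>\<^sup>2 * (norm s)\<^sup>2 \<le> \<rho>\<^sup>2 * (L\<^sup>2 * (norm (x - y))\<^sup>2)"
      by (intro mult_left_mono) (auto simp: power_mult_distrib)
    have "c * (norm (x - y))\<^sup>2 \<le> s \<bullet> (x - y)"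
      using c(2)[OF that] orth[OF subspace_diff[OF S(1) that]] by simp
    then have cs: "2 * \<rho> * (c * (norm (x - y))\<^sup>2) \<le> 2 * \<rho> * (s \<bullet> (x - y))"
      using \<rho> by (intro mult_left_mono) auto
    have "(norm ((x - y) - \<rho> *\<^sub>R s))\<^sup>2 = (norm (x - y))\<^sup>2 - 2 * \<rho> * (s \<bullet> (x - y)) + \<rho>\<^sup>2 * (norm s)\<^sup>2"
      unfolding power2_norm_eq_inner
      by (simp only: inner_diff_left inner_diff_right inner_scaleR_left inner_scaleR_right inner_commute)
         (simp add: power2_eq_square algebra_simps inner_commute)
    also have "\<dots> \<le> (norm (x - y))\<^sup>2 - 2 * \<rho> * (c * (norm (x - y))\<^sup>2) + \<rho>\<^sup>2 * (L\<^sup>2 * (norm (x - y))\<^sup>2)"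
      using sL cs by linarith
    also have "\<dots> = (1 - 2 * \<rho> * c + \<rho>\<^sup>2 * L\<^sup>2) * (norm (x - y))\<^sup>2" by (simp add: algebra_simps)
    also have "\<dots> \<le> q * (norm (x - y))\<^sup>2"
    proof -
      have "\<rho>\<^sup>2 * L\<^sup>2 \<le> \<rho>\<^sup>2 * (L\<^sup>2 + c\<^sup>2)" by (intro mult_left_mono) auto
      also have "\<dots> = \<rho> * c" using LC by (simp add: \<rho>_def power2_eq_square)
      finally have "1 - 2 * \<rho> * c + \<rho>\<^sup>2 * L\<^sup>2 \<le> 1 - \<rho> * c" by simp
      also have "\<dots> = q" by (simp add: q_def \<rho>_def power2_eq_square)
      finally show ?thesis by (intro mult_right_mono) auto
    qed
    finally have "sqrt ((norm ((x - y) - \<rho> *\<^sub>R s))\<^sup>2) \<le> sqrt (q * (norm (x - y))\<^sup>2)"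
      by (rule real_sqrt_le_mono)
    then have "norm ((x - y) - \<rho> *\<^sub>R s) \<le> sqrt q * norm (x - y)"
      by (simp add: real_sqrt_mult)
    moreover have "(x - \<rho> *\<^sub>R P (T x)) - (y - \<rho> *\<^sub>R P (T y)) = (x - y) - \<rho> *\<^sub>R s"
      by (simp add: s_def algebra_simps)
    ultimately show ?thesis unfolding dist_norm by (simp only:)
  qed
  have "\<exists>!x\<in>S. x - \<rho> *\<^sub>R P (T x) = x"
  proof (rule Banach_fix[where c = "sqrt q"])
    show "complete S" using S(2) by (simp add: complete_eq_closed)
    show "S \<noteq> {}" using S(1) subspace_0 by blast
    show "(\<lambda>x. x - \<rho> *\<^sub>R P (T x)) ` S \<subseteq> S"
      using P(1) S(1) by (auto intro: subspace_diff subspace_scale)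
  qed (use q contr in auto)
  then obtain x where x: "x \<in> S" "P (T x) = 0" using \<rho> by auto
  have "T x \<bullet> k = 0" if "k \<in> S" for k using P(2)[OF that, of "T x"] x(2) by simp
  with x(1) show ?thesis by blast
qed


section \<open>The Hilbert space of square integrable functions on the cell\<close>

lemma finite_measure_cellM: "finite_measure (cellM :: (real ^ 'n) measure)"
  by (rule finite_measureI) (simp add: emeasure_restrict_space emeasure_lborel_box_eq)

lemma one_inner_Basis: "b \<in> Basis \<Longrightarrow> 1 \<bullet> b = 1" for b :: "real ^ 'n"
  by (auto simp: Basis_vec_def inner_axis)

lemma measure_cell: "measure lebesgue (cell :: (real ^ 'n) set) = 1"
  by (simp add: measure_lborel_box_eq one_inner_Basis)

lemma measure_cellM [simp]: "measure (cellM :: (real ^ 'n) measure) cell = 1"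
  by (simp add: measure_restrict_space measure_cell)

lemma integrable_cellM_const [simp]: "integrable (cellM :: (real ^ 'n) measure) (\<lambda>y. c :: 'b :: euclidean_space)"
  by (rule finite_measure.integrable_const[OF finite_measure_cellM])

lemma integral_cellM_const [simp]: "(\<integral>y. c \<partial>(cellM :: (real ^ 'n) measure)) = (c :: 'b :: euclidean_space)"
  by (subst lebesgue_integral_const) (simp add: measure_restrict_space measure_cell)

section \<open>Closure properties of the set of square integrable functions\<close>

lemma L2_measurable: "f \<in> L2 \<Longrightarrow> f \<in> borel_measurable cellM"
  and L2_norm_integrable: "f \<in> L2 \<Longrightarrow> integrable cellM (\<lambda>y. (norm (f y))\<^sup>2)"
  by (auto simp: L2_def)

lemma L2_bound:
  assumes g: "integrable cellM g" and f: "f \<in> borel_measurable cellM"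
    and le: "AE y in cellM. (norm (f y))\<^sup>2 \<le> g y"
  shows "f \<in> L2"
proof -
  have "integrable cellM (\<lambda>y. (norm (f y))\<^sup>2)"
    using g
  proof (rule Bochner_Integration.integrable_bound)
    show "(\<lambda>y. (norm (f y))\<^sup>2) \<in> borel_measurable cellM" using f by measurable
    show "AE y in cellM. norm ((norm (f y))\<^sup>2) \<le> norm (g y)" using le by eventually_elim auto
  qed
  with f show ?thesis by (simp add: L2_def)
qed

lemma L2_zero [simp]: "(\<lambda>y. 0) \<in> L2"
  by (simp add: L2_def)

lemma L2_inner_integrable:
  assumes "f \<in> L2" "g \<in> L2"
  shows "integrable cellM (\<lambda>y. f y \<bullet> g y)"
proof (rule Bochner_Integration.integrable_bound)
  show "integrable cellM (\<lambda>y. (norm (f y))\<^sup>2 + (norm (g y))\<^sup>2)"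
    using assms by (auto simp: L2_def)
  show "(\<lambda>y. f y \<bullet> g y) \<in> borel_measurable cellM"
    using assms by (auto simp: L2_def)
  have "norm (f y \<bullet> g y) \<le> norm ((norm (f y))\<^sup>2 + (norm (g y))\<^sup>2)" for y
  proof -
    have "\<bar>f y \<bullet> g y\<bar> \<le> norm (f y) * norm (g y)" by (rule Cauchy_Schwarz_ineq2)
    also have "\<dots> \<le> (norm (f y))\<^sup>2 + (norm (g y))\<^sup>2"
      using sum_squares_bound[of "norm (f y)" "norm (g y)"] mult_nonneg_nonneg[OF norm_ge_zero norm_ge_zero, of "f y" "g y"] by linarith
    finally show ?thesis by simp
  qed
  then show "AE y in cellM. norm (f y \<bullet> g y) \<le> norm ((norm (f y))\<^sup>2 + (norm (g y))\<^sup>2)" by simp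
qed

lemma L2_mult_integrable:
  fixes f g :: "real ^ 'n \<Rightarrow> real"
  assumes "f \<in> L2" "g \<in> L2"
  shows "integrable cellM (\<lambda>y. f y * g y)"
  using L2_inner_integrable[OF assms] by simp

lemma L2_add:
  assumes "f \<in> L2" "g \<in> L2"
  shows "(\<lambda>y. f y + g y) \<in> L2"
proof (rule L2_bound)
  show "integrable cellM (\<lambda>y. (norm (f y))\<^sup>2 + 2 * (f y \<bullet> g y) + (norm (g y))\<^sup>2)"
    using assms L2_inner_integrable[OF assms] by (auto simp: L2_def)
  show "(\<lambda>y. f y + g y) \<in> borel_measurable cellM" using assms by (auto simp: L2_def)
qed (simp add: power2_norm_eq_inner inner_add_left inner_add_right inner_commute)

lemma L2_scaleR:
  assumes "f \<in> L2"
  shows "(\<lambda>y. c *\<^sub>R f y) \<in> L2"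
proof (rule L2_bound)
  show "integrable cellM (\<lambda>y. c\<^sup>2 * (norm (f y))\<^sup>2)" using assms by (auto simp: L2_def)
  show "(\<lambda>y. c *\<^sub>R f y) \<in> borel_measurable cellM" using assms by (auto simp: L2_def)
qed (simp add: power_mult_distrib)

lemma L2_minus: "f \<in> L2 \<Longrightarrow> (\<lambda>y. - f y) \<in> L2"
  using L2_scaleR[of f "-1"] by simp

lemma L2_diff: "f \<in> L2 \<Longrightarrow> g \<in> L2 \<Longrightarrow> (\<lambda>y. f y - g y) \<in> L2"
  using L2_add[of f "\<lambda>y. - g y"] L2_minus[of g] by simp

lemma L2_AE_cong:
  assumes "f \<in> L2" "g \<in> borel_measurable cellM" "AE y in cellM. f y = g y"
  shows "g \<in> L2"
proof (rule L2_bound)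
  show "integrable cellM (\<lambda>y. (norm (f y))\<^sup>2)" using assms by (simp add: L2_def)
  show "AE y in cellM. (norm (g y))\<^sup>2 \<le> (norm (f y))\<^sup>2" using assms(3) by eventually_elim simp
qed fact

lemma L2_integrable:
  assumes "f \<in> L2"
  shows "integrable cellM f"
proof (rule Bochner_Integration.integrable_bound)
  show "integrable cellM (\<lambda>y. 1 + (norm (f y))\<^sup>2 :: real)"
    using assms integrable_cellM_const[of "1::real"] by (auto simp: L2_def)
  show "f \<in> borel_measurable cellM" using assms by (rule L2_measurable)
  have "norm (f y) \<le> norm (1 + (norm (f y))\<^sup>2)" for y
    using sum_squares_bound[of 1 "norm (f y)"] by (simp add: power2_eq_square)
       (smt (verit) mult_nonneg_nonneg norm_ge_zero)
  then show "AE y in cellM. norm (f y) \<le> norm (1 + (norm (f y))\<^sup>2 :: real)" by simp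
qed

text \<open>A partial equivalence: a function outside \<open>L2\<close> is related to nothing, so
  the quotient consists exactly of the classes of square integrable functions and can be made an
  instance of the Hilbert space classes.\<close>

definition l2_rel :: "(real ^ 'n \<Rightarrow> 'b::euclidean_space) \<Rightarrow> (real ^ 'n \<Rightarrow> 'b) \<Rightarrow> bool" where
  "l2_rel f g \<longleftrightarrow> f \<in> L2 \<and> g \<in> L2 \<and> (AE y in cellM. f y = g y)"

quotient_type (overloaded) ('n, 'b) l2 = "real ^ 'n::finite \<Rightarrow> 'b::euclidean_space" / partial: l2_rel
  morphisms rep_l2 l2_of
proof (rule part_equivpI)
  show "\<exists>f :: real ^ 'n \<Rightarrow> 'b. l2_rel f f" by (intro exI[of _ "\<lambda>y. 0"]) (simp add: l2_rel_def)
  show "symp (l2_rel :: (real ^ 'n \<Rightarrow> 'b) \<Rightarrow> _)" by (rule sympI) (auto simp: l2_rel_def elim: eventually_mono)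
  show "transp (l2_rel :: (real ^ 'n \<Rightarrow> 'b) \<Rightarrow> _)"
  proof (rule transpI)
    fix f g h :: "real ^ 'n \<Rightarrow> 'b"
    assume fg: "l2_rel f g" and gh: "l2_rel g h"
    have "AE y in cellM. f y = g y" "AE y in cellM. g y = h y" using fg gh by (auto simp: l2_rel_def)
    then have "AE y in cellM. f y = h y" by eventually_elim simp
    with fg gh show "l2_rel f h" by (simp add: l2_rel_def)
  qed
qed

instantiation l2 :: (finite, euclidean_space) real_vector
begin

lift_definition zero_l2 :: "('a, 'b) l2" is "\<lambda>y. 0" by (simp add: l2_rel_def)

lift_definition plus_l2 :: "('a, 'b) l2 \<Rightarrow> ('a, 'b) l2 \<Rightarrow> ('a, 'b) l2" is "\<lambda>f g y. f y + g y"
  unfolding l2_rel_def by (auto intro: L2_add elim: eventually_elim2)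

lift_definition uminus_l2 :: "('a, 'b) l2 \<Rightarrow> ('a, 'b) l2" is "\<lambda>f y. - f y"
  unfolding l2_rel_def by (auto intro: L2_minus elim: eventually_mono)

lift_definition minus_l2 :: "('a, 'b) l2 \<Rightarrow> ('a, 'b) l2 \<Rightarrow> ('a, 'b) l2" is "\<lambda>f g y. f y - g y"
  unfolding l2_rel_def by (auto intro: L2_diff elim: eventually_elim2)

lift_definition scaleR_l2 :: "real \<Rightarrow> ('a, 'b) l2 \<Rightarrow> ('a, 'b) l2" is "\<lambda>c f y. c *\<^sub>R f y"
  unfolding l2_rel_def by (auto intro: L2_scaleR elim: eventually_mono)

instance
proof
  fix x y z :: "('a, 'b) l2" and a b :: real
  show "x + y + z = x + (y + z)" by transfer (auto simp: l2_rel_def algebra_simps intro!: L2_add)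
  show "x + y = y + x" by transfer (auto simp: l2_rel_def algebra_simps intro!: L2_add)
  show "0 + x = x" by transfer (auto simp: l2_rel_def)
  show "- x + x = 0" by transfer (auto simp: l2_rel_def)
  show "x - y = x + - y" by transfer (auto simp: l2_rel_def intro!: L2_diff)
  show "a *\<^sub>R (x + y) = a *\<^sub>R x + a *\<^sub>R y"
    by transfer (auto simp: l2_rel_def algebra_simps intro!: L2_add L2_scaleR)
  show "(a + b) *\<^sub>R x = a *\<^sub>R x + b *\<^sub>R x"
    by transfer (auto simp: l2_rel_def algebra_simps intro!: L2_add L2_scaleR)
  show "a *\<^sub>R b *\<^sub>R x = (a * b) *\<^sub>R x" by transfer (auto simp: l2_rel_def intro!: L2_scaleR)
  show "1 *\<^sub>R x = x" by transfer (auto simp: l2_rel_def)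
qed

end

instantiation l2 :: (finite, euclidean_space) real_inner
begin

lift_definition inner_l2 :: "('a, 'b) l2 \<Rightarrow> ('a, 'b) l2 \<Rightarrow> real" is "\<lambda>f g. \<integral>y. f y \<bullet> g y \<partial>cellM"
proof -
  fix f1 f2 g1 g2 :: "real ^ 'a \<Rightarrow> 'b"
  assume *: "l2_rel f1 f2" "l2_rel g1 g2"
  then have "AE y in cellM. f1 y = f2 y" "AE y in cellM. g1 y = g2 y" by (auto simp: l2_rel_def)
  then have "AE y in cellM. f1 y \<bullet> g1 y = f2 y \<bullet> g2 y" by eventually_elim simp
  with * show "(\<integral>y. f1 y \<bullet> g1 y \<partial>cellM) = (\<integral>y. f2 y \<bullet> g2 y \<partial>cellM)"
    by (intro integral_cong_AE) (auto simp: l2_rel_def L2_def)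
qed

definition norm_l2 :: "('a, 'b) l2 \<Rightarrow> real" where "norm_l2 h = sqrt (h \<bullet> h)"
definition sgn_l2 :: "('a, 'b) l2 \<Rightarrow> ('a, 'b) l2" where "sgn_l2 h = h /\<^sub>R norm h"
definition dist_l2 :: "('a, 'b) l2 \<Rightarrow> ('a, 'b) l2 \<Rightarrow> real" where "dist_l2 h k = norm (h - k)"
definition uniformity_l2 :: "(('a, 'b) l2 \<times> ('a, 'b) l2) filter" where
  "uniformity_l2 = (INF e\<in>{0 <..}. principal {(x, y). dist x y < e})"
definition open_l2 :: "('a, 'b) l2 set \<Rightarrow> bool" where
  "open_l2 U \<longleftrightarrow> (\<forall>x\<in>U. eventually (\<lambda>(x', y). x' = x \<longrightarrow> y \<in> U) uniformity)"

instance
proof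
  fix x y z :: "('a, 'b) l2" and r :: real and U :: "('a, 'b) l2 set"
  show "dist x y = norm (x - y)" by (rule dist_l2_def)
  show "sgn x = x /\<^sub>R norm x" by (rule sgn_l2_def)
  show "uniformity = (INF e\<in>{0 <..}. principal {(x :: ('a, 'b) l2, y). dist x y < e})" by (rule uniformity_l2_def)
  show "open U = (\<forall>x\<in>U. \<forall>\<^sub>F (x', y) in uniformity. x' = x \<longrightarrow> y \<in> U)" by (rule open_l2_def)
  show "x \<bullet> y = y \<bullet> x" by transfer (simp add: inner_commute)
  show "(x + y) \<bullet> z = x \<bullet> z + y \<bullet> z"
    by transfer (simp add: l2_rel_def inner_add_left L2_inner_integrable)
  show "(r *\<^sub>R x) \<bullet> y = r * (x \<bullet> y)"
    by transfer simp
  show "0 \<le> x \<bullet> x" by transfer (simp add: integral_nonneg_AE)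
  show "(x \<bullet> x = 0) = (x = 0)"
  proof transfer
    fix f :: "real ^ 'a \<Rightarrow> 'b" assume "l2_rel f f"
    then have f: "f \<in> L2" by (simp add: l2_rel_def)
    have "(\<integral>y. f y \<bullet> f y \<partial>cellM) = 0 \<longleftrightarrow> (AE y in cellM. f y \<bullet> f y = 0)"
      using f by (intro integral_nonneg_eq_0_iff_AE L2_inner_integrable) auto
    with f show "((\<integral>y. f y \<bullet> f y \<partial>cellM) = 0) = l2_rel f (\<lambda>y. 0)"
      by (simp add: l2_rel_def)
  qed
  show "norm x = sqrt (x \<bullet> x)" by (rule norm_l2_def)
qed

end

lemma rep_l2_mem: "rep_l2 h \<in> L2"
  using Quotient3_rep_reflp[OF Quotient3_l2, of h] by (simp add: l2_rel_def)

lemma l2_of_rep [simp]: "l2_of (rep_l2 h) = h"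
  using Quotient3_abs_rep[OF Quotient3_l2] .

lemma l2_of_eq_iff: "f \<in> L2 \<Longrightarrow> g \<in> L2 \<Longrightarrow> l2_of f = l2_of g \<longleftrightarrow> (AE y in cellM. f y = g y)"
  using Quotient3_rel[OF Quotient3_l2, of f g] by (simp add: l2_rel_def)

lemma rep_l2_of: "f \<in> L2 \<Longrightarrow> AE y in cellM. rep_l2 (l2_of f) y = f y"
  using l2_of_eq_iff[of "rep_l2 (l2_of f)" f] by (simp add: rep_l2_mem)

lemma l2_of_zero: "l2_of (\<lambda>y. 0) = 0"
  by (simp add: zero_l2.abs_eq)

lemma l2_of_add: "f \<in> L2 \<Longrightarrow> g \<in> L2 \<Longrightarrow> l2_of (\<lambda>y. f y + g y) = l2_of f + l2_of g"
  by (simp add: plus_l2.abs_eq l2_rel_def)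

lemma l2_of_diff: "f \<in> L2 \<Longrightarrow> g \<in> L2 \<Longrightarrow> l2_of (\<lambda>y. f y - g y) = l2_of f - l2_of g"
  by (simp add: minus_l2.abs_eq l2_rel_def)

lemma l2_of_scaleR: "f \<in> L2 \<Longrightarrow> l2_of (\<lambda>y. c *\<^sub>R f y) = c *\<^sub>R l2_of f"
  by (simp add: scaleR_l2.abs_eq l2_rel_def)

lemma inner_l2_of: "f \<in> L2 \<Longrightarrow> g \<in> L2 \<Longrightarrow> l2_of f \<bullet> l2_of g = (\<integral>y. f y \<bullet> g y \<partial>cellM)"
  by (simp add: inner_l2.abs_eq l2_rel_def)

lemma norm_l2_of: "f \<in> L2 \<Longrightarrow> norm (l2_of f) = L2norm f"
  by (simp add: norm_eq_sqrt_inner inner_l2_of L2norm_def power2_norm_eq_inner)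

lemma L2norm_square: "(L2norm f)\<^sup>2 = (\<integral>y. (norm (f y))\<^sup>2 \<partial>cellM)"
  unfolding L2norm_def by (rule real_sqrt_pow2) (simp add: integral_nonneg_AE)

lemma L2norm_nonneg [simp]: "0 \<le> L2norm f"
  unfolding L2norm_def by (simp add: integral_nonneg_AE)

lemma L2norm_cong_AE:
  assumes "f \<in> borel_measurable cellM" "g \<in> borel_measurable cellM" "AE y in cellM. f y = g y"
  shows "L2norm f = L2norm g"
proof -
  have "(\<integral>y. (norm (f y))\<^sup>2 \<partial>cellM) = (\<integral>y. (norm (g y))\<^sup>2 \<partial>cellM)"
    using assms by (intro integral_cong_AE) (auto elim: eventually_mono)
  then show ?thesis by (simp add: L2norm_def)
qed

lemma L2norm_scaleR: "f \<in> L2 \<Longrightarrow> L2norm (\<lambda>y. c *\<^sub>R f y) = \<bar>c\<bar> * L2norm f"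
  using norm_scaleR[of c "l2_of f"] by (simp add: norm_l2_of L2_scaleR flip: l2_of_scaleR)

lemma L2_Cauchy_Schwarz:
  "f \<in> L2 \<Longrightarrow> g \<in> L2 \<Longrightarrow> \<bar>\<integral>y. f y \<bullet> g y \<partial>cellM\<bar> \<le> L2norm f * L2norm g"
  using Cauchy_Schwarz_ineq2[of "l2_of f" "l2_of g"] by (simp add: norm_l2_of inner_l2_of)

lemma L2norm_mono:
  assumes "f \<in> L2" "g \<in> L2" "AE y in cellM. norm (f y) \<le> norm (g y)"
  shows "L2norm f \<le> L2norm g"
proof -
  have "(\<integral>y. (norm (f y))\<^sup>2 \<partial>cellM) \<le> (\<integral>y. (norm (g y))\<^sup>2 \<partial>cellM)"
    using assms by (intro integral_mono_AE L2_norm_integrable) (auto elim: eventually_mono intro: power_mono)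
  then show ?thesis by (simp add: L2norm_def)
qed

lemma L2_norm: "f \<in> L2 \<Longrightarrow> (\<lambda>y. norm (f y)) \<in> L2"
  and L2norm_norm [simp]: "L2norm (\<lambda>y. norm (f y)) = L2norm f"
  by (auto simp: L2_def L2norm_def)

lemma L2_const [simp]: "(\<lambda>y. c) \<in> (L2 :: (real ^ 'n \<Rightarrow> 'b::euclidean_space) set)"
  by (simp add: L2_def)

lemma L2norm_const [simp]: "L2norm (\<lambda>y::real ^ 'n. c :: 'b::euclidean_space) = norm c"
  by (simp add: L2norm_def)

lemma integral_norm_le_L2norm:
  fixes f :: "real ^ 'n \<Rightarrow> 'b::euclidean_space"
  assumes "f \<in> L2"
  shows "(\<integral>y. norm (f y) \<partial>cellM) \<le> L2norm f"
  using L2_Cauchy_Schwarz[of "\<lambda>y. norm (f y)" "\<lambda>y. 1::real", OF L2_norm[OF assms]]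
  by simp

text \<open>Riesz-Fischer: along a subsequence with distances below \<open>(1/2)^k\<close> the
  increments are summable almost everywhere, which gives a pointwise limit. Fatou's lemma shows that
  it is also the limit in norm.\<close>

instance l2 :: (finite, euclidean_space) complete_space
proof
  fix X :: "nat \<Rightarrow> ('a, 'b) l2" assume X: "Cauchy X"
  have "\<exists>N. \<forall>m\<ge>N. \<forall>n\<ge>N. dist (X m) (X n) < (1/2)^k" for k :: nat
    using X by (rule metric_CauchyD) simp
  then obtain N where N: "\<And>k m n. N k \<le> m \<Longrightarrow> N k \<le> n \<Longrightarrow> dist (X m) (X n) < (1/2)^k" by metis
  \<comment> \<open>A partial sum of \<open>N\<close> dominates each of its terms, so
    \<open>r\<close> is an admissible choice of indices for all earlier accuracies at once.\<close>
  define r where "r k = (\<Sum>i\<le>k. N i)" for k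
  have rN: "N k \<le> r j" if "k \<le> j" for k j
    unfolding r_def using that by (intro member_le_sum) auto
  define F where "F k = rep_l2 (X (r k))" for k
  have F: "F k \<in> L2" for k by (simp add: F_def rep_l2_mem)
  have Fm [measurable]: "F k \<in> borel_measurable cellM" for k using F by (rule L2_measurable)
  have FX: "l2_of (F k) = X (r k)" for k by (simp add: F_def)
  have Fdist: "L2norm (\<lambda>y. F j y - F k y) < (1/2)^k" if "k \<le> j" for j k
    using N[of k "r j" "r k"] rN[OF that] rN[of k k] F
    by (simp add: norm_l2_of[symmetric] L2_diff l2_of_diff FX dist_norm)
  let ?G = "\<lambda>k y. norm (F (Suc k) y - F k y)"
  have "(\<integral>\<^sup>+ y. (\<Sum>k. ennreal (?G k y)) \<partial>cellM) = (\<Sum>k. \<integral>\<^sup>+ y. ennreal (?G k y) \<partial>cellM)"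
    by (rule nn_integral_suminf) measurable
  also have "\<dots> = (\<Sum>k. ennreal (\<integral>y. ?G k y \<partial>cellM))"
    using F by (intro suminf_cong nn_integral_eq_integral integrable_norm L2_integrable L2_diff) auto
  also have "\<dots> \<le> (\<Sum>k. ennreal ((1/2)^k))"
  proof (rule suminf_le)
    fix k
    have "(\<integral>y. ?G k y \<partial>cellM) \<le> L2norm (\<lambda>y. F (Suc k) y - F k y)"
      by (rule integral_norm_le_L2norm[OF L2_diff[OF F F]])
    also have "\<dots> \<le> (1/2)^k" using Fdist[of k "Suc k"] by simp
    finally show "ennreal (\<integral>y. ?G k y \<partial>cellM) \<le> ennreal ((1/2)^k)" by (rule ennreal_leI)
  qed auto
  also have "\<dots> = ennreal (\<Sum>k. (1/2)^k)"
    by (rule suminf_ennreal2) (auto intro: summable_geometric)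
  also have "\<dots> < \<infinity>" by simp
  finally have fin: "(\<integral>\<^sup>+ y. (\<Sum>k. ennreal (?G k y)) \<partial>cellM) \<noteq> \<infinity>" by simp
  have "AE y in cellM. (\<Sum>k. ennreal (?G k y)) \<noteq> \<infinity>"
    by (rule nn_integral_PInf_AE[OF _ fin]) measurable
  then have conv: "AE y in cellM. convergent (\<lambda>k. F k y)"
  proof eventually_elim
    case (elim y)
    have "summable (\<lambda>k. ?G k y)" using elim by (intro summable_suminf_not_top) auto
    then have "summable (\<lambda>k. F (Suc k) y - F k y)" by (rule summable_norm_cancel)
    then have "convergent (\<lambda>n. \<Sum>k<n. F (Suc k) y - F k y)" by (simp add: summable_iff_convergent)
    moreover have "(\<Sum>k<n. F (Suc k) y - F k y) = F n y - F 0 y" for n by (rule sum_lessThan_telescope)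
    ultimately have "convergent (\<lambda>n. F n y - F 0 y)" by (simp only:)
    then show ?case by (simp add: convergent_diff_const_right_iff)
  qed
  define f where "f y = lim (\<lambda>k. F k y)" for y
  have fm [measurable]: "f \<in> borel_measurable cellM" unfolding f_def
    by (rule borel_measurable_lim_metric) measurable
  have nnF: "(\<integral>\<^sup>+ y. ennreal ((norm (F j y - F k y))\<^sup>2) \<partial>cellM) = ennreal ((L2norm (\<lambda>y. F j y - F k y))\<^sup>2)" for j k
    unfolding L2norm_square using F by (intro nn_integral_eq_integral L2_norm_integrable L2_diff) auto
  \<comment> \<open>Fatou's lemma in \<open>j\<close>: the bound on the distance of
    \<open>F j\<close> to \<open>F k\<close>, valid from \<open>j = k\<close> on, is inherited by
    the pointwise limit.\<close>
  have nn: "(\<integral>\<^sup>+ y. ennreal ((norm (f y - F k y))\<^sup>2) \<partial>cellM) \<le> ennreal (((1/2)^k)\<^sup>2)" for k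
  proof -
    have "(\<integral>\<^sup>+ y. ennreal ((norm (f y - F k y))\<^sup>2) \<partial>cellM)
      = (\<integral>\<^sup>+ y. liminf (\<lambda>j. ennreal ((norm (F j y - F k y))\<^sup>2)) \<partial>cellM)"
    proof (rule nn_integral_cong_AE)
      show "AE y in cellM. ennreal ((norm (f y - F k y))\<^sup>2) = liminf (\<lambda>j. ennreal ((norm (F j y - F k y))\<^sup>2))"
        using conv
      proof eventually_elim
        case (elim y)
        then have "(\<lambda>j. F j y) \<longlonglongrightarrow> f y" by (simp add: f_def convergent_LIMSEQ_iff)
        then have "(\<lambda>j. ennreal ((norm (F j y - F k y))\<^sup>2)) \<longlonglongrightarrow> ennreal ((norm (f y - F k y))\<^sup>2)"
          by (intro tendsto_ennrealI tendsto_intros)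
        then show ?case by (metis lim_imp_Liminf trivial_limit_sequentially)
      qed
    qed
    also have "\<dots> \<le> liminf (\<lambda>j. \<integral>\<^sup>+ y. ennreal ((norm (F j y - F k y))\<^sup>2) \<partial>cellM)"
      by (rule nn_integral_liminf) measurable
    also have "\<dots> \<le> ennreal (((1/2)^k)\<^sup>2)"
      unfolding nnF
    proof (rule Liminf_le)
      show "\<forall>\<^sub>F j in sequentially. ennreal ((L2norm (\<lambda>y. F j y - F k y))\<^sup>2) \<le> ennreal (((1/2)^k)\<^sup>2)"
        using eventually_ge_at_top[of k]
        by eventually_elim (intro ennreal_leI power_mono less_imp_le[OF Fdist]; simp)
    qed simp
    finally show ?thesis .
  qed
  have dL2: "(\<lambda>y. f y - F k y) \<in> L2" for k
  proof -
    have "integrable cellM (\<lambda>y. (norm (f y - F k y))\<^sup>2)"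
    proof (rule integrableI_bounded)
      have "(\<integral>\<^sup>+ y. ennreal (norm ((norm (f y - F k y))\<^sup>2)) \<partial>cellM) \<le> ennreal (((1/2)^k)\<^sup>2)"
        using nn[of k] by simp
      also have "\<dots> < \<infinity>" by simp
      finally show "(\<integral>\<^sup>+ y. ennreal (norm ((norm (f y - F k y))\<^sup>2)) \<partial>cellM) < \<infinity>" .
    qed measurable
    then show ?thesis by (simp add: L2_def)
  qed
  have fL2: "f \<in> L2" using L2_add[OF dL2[of 0] F[of 0]] by simp
  have dist: "dist (X (r k)) (l2_of f) \<le> (1/2)^k" for k
  proof -
    have "ennreal ((L2norm (\<lambda>y. f y - F k y))\<^sup>2) \<le> ennreal (((1/2)^k)\<^sup>2)"
      using nn[of k] L2_norm_integrable[OF dL2[of k]]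
      unfolding L2norm_square by (subst nn_integral_eq_integral[symmetric]) auto
    then have "(L2norm (\<lambda>y. f y - F k y))\<^sup>2 \<le> ((1/2)^k)\<^sup>2" by (subst (asm) ennreal_le_iff) auto
    then have "L2norm (\<lambda>y. f y - F k y) \<le> (1/2)^k" by (rule power2_le_imp_le) simp
    then show ?thesis
      using fL2 F[of k] by (simp add: dist_commute dist_norm FX[symmetric] l2_of_diff[symmetric] norm_l2_of L2_diff)
  qed
  have "X \<longlonglongrightarrow> l2_of f"
  proof (rule metric_LIMSEQ_I)
    fix e :: real assume "0 < e"
    then obtain k where k: "(1/2 :: real)^k < e / 2"
      using real_arch_pow_inv[of "e/2" "1/2"] by auto
    show "\<exists>no. \<forall>n\<ge>no. dist (X n) (l2_of f) < e"
    proof (intro exI allI impI)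
      fix n assume "N k \<le> n"
      then have "dist (X n) (X (r k)) < (1/2)^k" using N rN[of k k] by blast
      then show "dist (X n) (l2_of f) < e"
        using dist[of k] k dist_triangle[of "X n" "l2_of f" "X (r k)"] by linarith
    qed
  qed
  then show "convergent X" by (rule convergentI)
qed


section \<open>Continuously differentiable periodic functions\<close>

lemma continuous_measurable_cellM:
  fixes f :: "real ^ 'n \<Rightarrow> 'b::euclidean_space"
  assumes "continuous_on UNIV f"
  shows "f \<in> borel_measurable cellM"
  using borel_measurable_continuous_onI[OF assms]
  by (intro measurable_restrict_space1 measurable_completion) simp

lemma continuous_bounded_cell:
  fixes f :: "real ^ 'n \<Rightarrow> 'b::euclidean_space"
  assumes "continuous_on UNIV f"
  shows "\<exists>B\<ge>0. \<forall>y\<in>cbox 0 1. norm (f y) \<le> B"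
proof -
  have "compact (f ` cbox 0 1)"
    by (intro compact_continuous_image continuous_on_subset[OF assms]) auto
  then have "bounded (f ` cbox 0 1)" by (rule compact_imp_bounded)
  then obtain B where "\<forall>y\<in>cbox 0 1. norm (f y) \<le> B" by (auto simp: bounded_iff)
  then show ?thesis by (intro exI[of _ "max 0 B"]) auto
qed

lemma bounded_integrable_cellM:
  fixes f :: "real ^ 'n \<Rightarrow> 'b::euclidean_space"
  assumes "f \<in> borel_measurable cellM" "\<And>y. y \<in> cell \<Longrightarrow> norm (f y) \<le> B"
  shows "integrable cellM f"
proof (rule finite_measure.integrable_const_bound[OF finite_measure_cellM])
  show "AE y in cellM. norm (f y) \<le> B" using assms(2) by (intro AE_I2) simp
qed fact

lemma bounded_L2:
  fixes f :: "real ^ 'n \<Rightarrow> 'b::euclidean_space"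
  assumes "f \<in> borel_measurable cellM" "\<And>y. y \<in> cell \<Longrightarrow> norm (f y) \<le> B"
  shows "f \<in> L2"
proof (rule L2_bound)
  show "integrable cellM (\<lambda>y. B\<^sup>2)" by simp
  show "AE y in cellM. (norm (f y))\<^sup>2 \<le> B\<^sup>2" using assms(2) by (intro AE_I2 power_mono) auto
qed fact

lemma continuous_integrable_cellM:
  fixes f :: "real ^ 'n \<Rightarrow> 'b::euclidean_space"
  assumes "continuous_on UNIV f"
  shows "integrable cellM f"
proof -
  obtain B where "\<forall>y\<in>cbox 0 1. norm (f y) \<le> B" using continuous_bounded_cell[OF assms] by auto
  then show ?thesis
    using box_subset_cbox by (intro bounded_integrable_cellM[of f B] continuous_measurable_cellM assms) blast
qed

lemma continuous_L2:
  fixes f :: "real ^ 'n \<Rightarrow> 'b::euclidean_space"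
  assumes "continuous_on UNIV f"
  shows "f \<in> L2"
proof -
  obtain B where "\<forall>y\<in>cbox 0 1. norm (f y) \<le> B" using continuous_bounded_cell[OF assms] by auto
  then show ?thesis
    using box_subset_cbox by (intro bounded_L2[of f B] continuous_measurable_cellM assms) blast
qed

text \<open>Bridge to the gauge integral over the closed cube, for which shifting, splitting and
  exchanging the order of integration are available; the boundary is negligible.\<close>

lemma integral_cellM_eq:
  fixes f :: "real ^ 'n \<Rightarrow> 'b::euclidean_space"
  assumes "continuous_on UNIV f"
  shows "(\<integral>y. f y \<partial>cellM) = integral (cbox 0 1) f"
  using lebesgue_integral_eq_integral[OF continuous_integrable_cellM[OF assms]]
  by (simp add: integral_open_interval)

section \<open>Invariance of integrals of periodic functions under translation\<close>

lemma continuous_on_shift: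
  fixes f :: "real ^ 'n \<Rightarrow> 'b::topological_space"
  assumes "continuous_on UNIV f"
  shows "continuous_on S (\<lambda>x. f (x + h))"
  by (rule continuous_on_compose2[OF assms]) (auto intro: continuous_intros)

lemma Y_periodic_shift: "Y_periodic f \<Longrightarrow> Y_periodic (\<lambda>x. f (x + h))"
  unfolding Y_periodic_def by (metis add.assoc add.commute)

lemma Y_periodic_bounded:
  fixes f :: "real ^ 'n \<Rightarrow> 'b::euclidean_space"
  assumes f: "continuous_on UNIV f" "Y_periodic f"
  shows "\<exists>B\<ge>0. \<forall>y. norm (f y) \<le> B"
proof -
  obtain B where B: "0 \<le> B" "\<forall>y\<in>cbox 0 1. norm (f y) \<le> B" using continuous_bounded_cell[OF f(1)] by auto
  have "norm (f y) \<le> B" for y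
  proof -
    define k :: "real ^ 'n" where "k = (\<chi> i. of_int \<lfloor>y $ i\<rfloor>)"
    have "\<forall>i. k $ i \<in> \<int>" by (simp add: k_def)
    then have "f ((y - k) + k) = f (y - k)"
      using f(2) unfolding Y_periodic_def by blast
    moreover have "y - k \<in> cbox 0 1" by (auto simp: k_def mem_box_cart) linarith
    ultimately have "norm (f (y - k)) \<le> B" "f y = f (y - k)" using B(2) by auto
    then show ?thesis by simp
  qed
  with B(1) show ?thesis by blast
qed

text \<open>The shifted cube sticks out of the unit cube by a slab beyond the face where coordinate
  \<open>i\<close> equals 1. Moved back by the unit vector, this slab fills exactly the part of the
  unit cube that was left uncovered.\<close>

lemma integral_periodic_shift_axis:
  fixes f :: "real ^ 'n \<Rightarrow> real"
  assumes f: "continuous_on UNIV f" "Y_periodic f" and t: "0 \<le> t" "t \<le> 1"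
  shows "integral (cbox 0 1) (\<lambda>x. f (x + t *\<^sub>R axis i 1)) = integral (cbox 0 1) f"
proof -
  let ?e = "axis i 1 :: real ^ 'n"
  define c where "c = t *\<^sub>R ?e"
  have eB: "?e \<in> Basis" by (auto simp: Basis_vec_def)
  have int: "f integrable_on cbox a b" for a b
    by (rule integrable_continuous) (rule continuous_on_subset[OF f(1)], simp)
  have slab: "x \<in> cbox (a *\<^sub>R ?e) (1 + b *\<^sub>R ?e) \<longleftrightarrow>
      (\<forall>j. j \<noteq> i \<longrightarrow> 0 \<le> x $ j \<and> x $ j \<le> 1) \<and> a \<le> x $ i \<and> x $ i \<le> 1 + b" for a b x
    by (auto simp: mem_box_cart axis_def split: if_splits)
  have ie: "x \<bullet> ?e = x $ i" for x :: "real ^ 'n" by (simp add: inner_axis)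
  have "integral (cbox 0 1) (\<lambda>x. f (x + c)) = integral (cbox c (1 + c)) f"
    using integral_shift_cbox[of c c "1 + c" f] by simp
  also have "\<dots> = integral (cbox c (1 + c) \<inter> {x. x \<bullet> ?e \<le> 1}) f + integral (cbox c (1 + c) \<inter> {x. x \<bullet> ?e \<ge> 1}) f"
    by (rule integral_split[OF int eB])
  also have "cbox c (1 + c) \<inter> {x. x \<bullet> ?e \<le> 1} = cbox c 1"
    using slab[where a = t and b = t] slab[where a = t and b = 0] t by (auto simp: ie c_def)
  also have "cbox c (1 + c) \<inter> {x. x \<bullet> ?e \<ge> 1} = cbox ?e (1 + c)"
    using slab[where a = t and b = t] slab[where a = 1 and b = t] t by (auto simp: ie c_def)
  also have "integral (cbox ?e (1 + c)) f = integral (cbox 0 (1 + c - ?e)) (\<lambda>x. f (x + ?e))"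
    using integral_shift_cbox[of ?e ?e "1 + c" f] by simp
  also have "(\<lambda>x. f (x + ?e)) = f"
    using f(2) by (auto simp: Y_periodic_def fun_eq_iff axis_def)
  also have "cbox c 1 = cbox 0 1 \<inter> {x. x \<bullet> ?e \<ge> t}"
    using slab[where a = 0 and b = 0] slab[where a = t and b = 0] t by (auto simp: ie c_def)
  also have "1 + c - ?e = 1 + (t - 1) *\<^sub>R ?e"
    by (simp add: c_def algebra_simps)
  also have "cbox 0 \<dots> = cbox 0 1 \<inter> {x. x \<bullet> ?e \<le> t}"
    using slab[where a = 0 and b = 0] slab[where a = 0 and b = "t - 1"] t by (auto simp: ie)
  also have "integral (cbox 0 1 \<inter> {x. x \<bullet> ?e \<ge> t}) f + integral (cbox 0 1 \<inter> {x. x \<bullet> ?e \<le> t}) f = integral (cbox 0 1) f"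
    using integral_split[OF int eB, of 0 1 t] by simp
  finally show ?thesis by (simp add: c_def)
qed

text \<open>The shifts under which the integral is invariant are closed under addition, so multiples
  of the unit vectors suffice. Such a multiple is an integer shift, absorbed by periodicity, plus a
  fractional one.\<close>

lemma integral_periodic_shift:
  fixes f :: "real ^ 'n \<Rightarrow> real"
  assumes "continuous_on UNIV f" "Y_periodic f"
  shows "integral (cbox 0 1) (\<lambda>x. f (x + h)) = integral (cbox 0 1) f"
proof -
  \<comment> \<open>The quantifier over \<open>f\<close> is part of \<open>I\<close>, since in a sum
    of two shifts one of them acts on an already shifted function.\<close>
  define I where "I h \<longleftrightarrow> (\<forall>f :: real ^ 'n \<Rightarrow> real. continuous_on UNIV f \<longrightarrow> Y_periodic f \<longrightarrow>
    integral (cbox 0 1) (\<lambda>x. f (x + h)) = integral (cbox 0 1) f)" for h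
  have I0: "I 0" by (simp add: I_def)
  have Iadd: "I (h + k)" if h: "I h" and k: "I k" for h k
    unfolding I_def
  proof (intro allI impI)
    fix f :: "real ^ 'n \<Rightarrow> real" assume f: "continuous_on UNIV f" "Y_periodic f"
    have "integral (cbox 0 1) (\<lambda>x. f (x + h + k)) = integral (cbox 0 1) (\<lambda>x. f (x + k))"
      using h continuous_on_shift[OF f(1), of UNIV k] Y_periodic_shift[OF f(2), of k]
      unfolding I_def by (auto simp: add.assoc)
    also have "\<dots> = integral (cbox 0 1) f" using k f by (auto simp: I_def)
    finally show "integral (cbox 0 1) (\<lambda>x. f (x + (h + k))) = integral (cbox 0 1) f"
      by (simp add: add.assoc)
  qed
  have Iaxis: "I (t *\<^sub>R axis i 1)" for t i
  proof -
    have "I (frac t *\<^sub>R axis i 1)"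
      unfolding I_def by (intro allI impI integral_periodic_shift_axis) (auto simp: frac_lt_1 less_imp_le)
    moreover have "I (of_int \<lfloor>t\<rfloor> *\<^sub>R axis i 1)"
    proof -
      have "(\<forall>j. (of_int \<lfloor>t\<rfloor> *\<^sub>R axis i 1 :: real ^ 'n) $ j \<in> \<int>)" by (simp add: axis_def)
      then show ?thesis unfolding I_def Y_periodic_def by simp
    qed
    ultimately have "I (frac t *\<^sub>R axis i 1 + of_int \<lfloor>t\<rfloor> *\<^sub>R axis i 1)" by (rule Iadd)
    then show ?thesis by (simp add: frac_def flip: scaleR_add_left)
  qed
  have "I (\<Sum>i\<in>S. (h $ i) *\<^sub>R axis i 1)" if "finite S" for S :: "'n set"
    using that by (induction S) (auto intro: I0 Iadd Iaxis)
  then have "I (\<Sum>i\<in>UNIV. (h $ i) *\<^sub>R axis i 1)" by simp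
  then have "I h" using basis_expansion[of h] by (simp add: scalar_mult_eq_scaleR)
  with assms show ?thesis by (simp add: I_def)
qed

definition grad :: "(real ^ 'n \<Rightarrow> real) \<Rightarrow> real ^ 'n \<Rightarrow> real ^ 'n" where
  "grad f y = (\<chi> i. partial_deriv i f y)"

lemma grad_nth [simp]: "grad f y $ i = partial_deriv i f y"
  by (simp add: grad_def)

lemma C1_has_derivative:
  assumes "Ck (Suc 0) f"
  shows "(f has_derivative (\<lambda>h. grad f y \<bullet> h)) (at y)"
proof -
  have d: "f differentiable (at y)" using assms by simp
  then have "(f has_derivative frechet_derivative f (at y)) (at y)" by (simp add: frechet_derivative_works)
  moreover have "frechet_derivative f (at y) h = grad f y \<bullet> h" for h
  proof -
    have lin: "linear (frechet_derivative f (at y))" using d by (rule linear_frechet_derivative)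
    have "frechet_derivative f (at y) h = frechet_derivative f (at y) (\<Sum>i\<in>UNIV. (h $ i) *\<^sub>R axis i 1)"
      using basis_expansion[of h] by (simp add: scalar_mult_eq_scaleR)
    also have "\<dots> = (\<Sum>i\<in>UNIV. (h $ i) * partial_deriv i f y)"
      by (simp add: linear_sum[OF lin] linear_scale[OF lin] partial_deriv_def)
    finally show ?thesis by (simp add: inner_vec_def mult.commute)
  qed
  ultimately show ?thesis by (metis (no_types, lifting) ext)
qed

lemma C1_continuous: "Ck (Suc 0) f \<Longrightarrow> continuous_on UNIV f"
  by (auto intro!: differentiable_imp_continuous_on simp: differentiable_on_def differentiable_at_withinI)

lemma C1_continuous_grad: "Ck (Suc 0) f \<Longrightarrow> continuous_on UNIV (grad f)"
  unfolding grad_def by (intro continuous_intros) auto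

lemma partial_deriv_periodic:
  fixes f :: "real ^ 'n \<Rightarrow> real"
  assumes "Y_periodic f"
  shows "Y_periodic (partial_deriv i f)"
  unfolding Y_periodic_def
proof (intro allI impI)
  fix y k :: "real ^ 'n" assume k: "\<forall>i. k $ i \<in> \<int>"
  \<comment> \<open>\<open>frechet_derivative\<close> chooses among the derivatives at a point. If
    two points have the same derivatives then the choices agree, even where \<open>f\<close> is not
    differentiable.\<close>
  have "(f has_derivative D) (at (y + k)) \<longleftrightarrow> (f has_derivative D) (at y)" for D
  proof -
    have shift: "(f has_derivative D) (at (y' + k'))"
      if "(f has_derivative D) (at y')" "\<forall>i. k' $ i \<in> \<int>" for y' k'
    proof -
      have "((\<lambda>x. f (x - k')) has_derivative D \<circ> (\<lambda>h. h)) (at (y' + k'))"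
        using that(1) diff_chain_at[of "\<lambda>x. x - k'" "\<lambda>h. h" "y' + k'" f D]
        by (auto simp: o_def intro: has_derivative_diff[OF has_derivative_ident has_derivative_const, simplified])
      moreover have "f (x - k') = f x" for x
        using assms that(2) unfolding Y_periodic_def by (metis diff_add_cancel)
      ultimately show ?thesis by (simp add: o_def)
    qed
    show ?thesis using shift[of y k] shift[of "y + k" "- k"] k by auto
  qed
  then show "partial_deriv i f (y + k) = partial_deriv i f y"
    by (simp add: partial_deriv_def frechet_derivative_def)
qed

lemma grad_periodic: "Y_periodic f \<Longrightarrow> Y_periodic (grad f)"
  using partial_deriv_periodic[of f] by (simp add: Y_periodic_def vec_eq_iff)

lemma C1_line_derivative:
  assumes "Ck (Suc 0) f"
  shows "((\<lambda>t. f (x + t *\<^sub>R h)) has_vector_derivative grad f (x + t *\<^sub>R h) \<bullet> h) (at t within S)"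
proof -
  have "((\<lambda>t. f (x + t *\<^sub>R h)) has_derivative (\<lambda>s. grad f (x + t *\<^sub>R h) \<bullet> (s *\<^sub>R h))) (at t within S)"
    by (rule has_derivative_compose[OF _ C1_has_derivative[OF assms]])
       (auto intro!: derivative_eq_intros)
  then show ?thesis by (simp add: has_vector_derivative_def)
qed

lemma C1_line_integral:
  assumes "Ck (Suc 0) f"
  shows "((\<lambda>t. grad f (x + t *\<^sub>R h) \<bullet> h) has_integral (f (x + h) - f x)) {0..1}"
  using fundamental_theorem_of_calculus[OF _ C1_line_derivative[OF assms], of 0 1 x h] by simp

lemma C1_lipschitz:
  assumes f: "Ck (Suc 0) f" and B: "\<And>y. norm (grad f y) \<le> B"
  shows "\<bar>f (x + h) - f x\<bar> \<le> B * norm h"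
proof -
  have "norm (f (x + h) - f x) \<le> B * norm ((x + h) - x)"
  proof (rule differentiable_bound[OF convex_UNIV C1_has_derivative[OF f]])
    fix y
    have "\<bar>grad f y \<bullet> v\<bar> \<le> B * norm v" for v
      using Cauchy_Schwarz_ineq2[of "grad f y" v] mult_right_mono[OF B[of y] norm_ge_zero[of v]] by linarith
    then show "onorm (\<lambda>h. grad f y \<bullet> h) \<le> B" by (intro onorm_le) simp
  qed auto
  then show ?thesis by simp
qed

lemma integrable_cbox_continuous:
  fixes f :: "real ^ 'n \<Rightarrow> real"
  shows "continuous_on UNIV f \<Longrightarrow> f integrable_on cbox a b"
  by (rule integrable_continuous) (rule continuous_on_subset, auto)

section \<open>Difference quotients with step \<open>1 / (k + 1)\<close>, and integration by
  parts\<close>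

definition dq :: "(real ^ 'n \<Rightarrow> real) \<Rightarrow> real ^ 'n \<Rightarrow> nat \<Rightarrow> real ^ 'n \<Rightarrow> real" where
  "dq f e k x = (f (x + inverse (real (Suc k)) *\<^sub>R e) - f x) * real (Suc k)"

lemma dq_tendsto:
  assumes "Ck (Suc 0) f"
  shows "(\<lambda>k. dq f e k x) \<longlonglongrightarrow> grad f x \<bullet> e"
proof -
  have "((\<lambda>t. f (x + t *\<^sub>R e)) has_field_derivative grad f x \<bullet> e) (at 0)"
    using C1_line_derivative[OF assms, of x e 0 UNIV] by (simp add: has_real_derivative_iff_has_vector_derivative)
  then have "((\<lambda>t. (f (x + t *\<^sub>R e) - f x) / t) \<longlongrightarrow> grad f x \<bullet> e) (at 0)"
    unfolding DERIV_def by simp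
  then have "(\<lambda>k. (f (x + inverse (real (Suc k)) *\<^sub>R e) - f x) / inverse (real (Suc k))) \<longlonglongrightarrow> grad f x \<bullet> e"
    by (rule filterlim_compose)
       (use LIMSEQ_inverse_real_of_nat in \<open>auto simp: filterlim_at intro!: always_eventually\<close>)
  then show ?thesis by (simp add: dq_def divide_inverse)
qed

lemma dq_bound:
  assumes "Ck (Suc 0) f" "\<And>y. norm (grad f y) \<le> B"
  shows "\<bar>dq f e k x\<bar> \<le> B * norm e"
proof -
  have "\<bar>f (x + inverse (real (Suc k)) *\<^sub>R e) - f x\<bar> * real (Suc k) \<le> (B * norm (inverse (real (Suc k)) *\<^sub>R e)) * real (Suc k)"
    by (rule mult_right_mono[OF C1_lipschitz[OF assms]]) simp
  moreover have "\<bar>dq f e k x\<bar> = \<bar>f (x + inverse (real (Suc k)) *\<^sub>R e) - f x\<bar> * real (Suc k)"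
    unfolding dq_def by (simp only: abs_mult abs_of_nat)
  moreover have "(B * norm (inverse (real (Suc k)) *\<^sub>R e)) * real (Suc k) = B * norm e" by simp
  ultimately show ?thesis by linarith
qed

lemma dq_continuous: "Ck (Suc 0) f \<Longrightarrow> continuous_on UNIV (dq f e k)"
  unfolding dq_def[abs_def] by (intro continuous_intros continuous_on_shift C1_continuous)

lemma grad_bounded:
  assumes "Ck (Suc 0) f" "Y_periodic f"
  shows "\<exists>B\<ge>0. \<forall>y. norm (grad f y) \<le> B"
  using assms by (intro Y_periodic_bounded C1_continuous_grad grad_periodic)

text \<open>The second factor may vary with \<open>k\<close>, so that dominated convergence covers
  both a fixed function and another difference quotient.\<close>

lemma dq_integral_tendsto:
  fixes f :: "real ^ 'n \<Rightarrow> real" and g' :: "real ^ 'n \<Rightarrow> real"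
  assumes f: "Ck (Suc 0) f" "\<And>y. norm (grad f y) \<le> B"
    and g: "\<And>k. continuous_on UNIV (g k)" "\<And>k y. \<bar>g k y\<bar> \<le> C" "\<And>y. (\<lambda>k. g k y) \<longlonglongrightarrow> g' y"
    and g': "continuous_on UNIV g'"
  shows "(\<lambda>k. \<integral>y. dq f e k y * g k y \<partial>cellM) \<longlonglongrightarrow> (\<integral>y. (grad f y \<bullet> e) * g' y \<partial>cellM)"
proof (rule integral_dominated_convergence[where w = "\<lambda>y. B * norm e * C"])
  show "(\<lambda>y. (grad f y \<bullet> e) * g' y) \<in> borel_measurable cellM"
    by (intro continuous_measurable_cellM continuous_intros C1_continuous_grad f g')
  show "(\<lambda>y. dq f e k y * g k y) \<in> borel_measurable cellM" for k
    by (intro continuous_measurable_cellM continuous_intros dq_continuous f g)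
  show "AE y in cellM. (\<lambda>k. dq f e k y * g k y) \<longlonglongrightarrow> (grad f y \<bullet> e) * g' y"
    by (intro AE_I2 tendsto_mult dq_tendsto f g)
  show "AE y in cellM. norm (dq f e k y * g k y) \<le> B * norm e * C" for k
  proof (rule AE_I2)
    fix y
    have "\<bar>dq f e k y\<bar> * \<bar>g k y\<bar> \<le> (B * norm e) * C"
      using g(2)[of k y] dq_bound[OF f, of e k y] by (intro mult_mono) (auto intro: order_trans[OF abs_ge_zero])
    then show "norm (dq f e k y * g k y) \<le> B * norm e * C" by (simp add: abs_mult)
  qed
qed simp

text \<open>The hypothesis \<open>shift\<close> isolates the one translation that is involved. It
  holds by periodicity for periodic functions and by compact support for test functions. The
  direction \<open>- e\<close> absorbs the sign.\<close>

lemma dq_summation_by_parts: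
  fixes f g :: "real ^ 'n \<Rightarrow> real" and e :: "real ^ 'n" and k :: nat
  defines "h \<equiv> inverse (real (Suc k)) *\<^sub>R e"
  assumes f: "Ck (Suc 0) f" and g: "Ck (Suc 0) g"
    and shift: "integral (cbox 0 1) (\<lambda>y. g (y + h) * f y) = integral (cbox 0 1) (\<lambda>y. g y * f (y - h))"
  shows "(\<integral>y. dq g e k y * f y \<partial>cellM) = (\<integral>y. dq f (- e) k y * g y \<partial>cellM)"
proof -
  note cf = C1_continuous[OF f] and cg = C1_continuous[OF g]
  note int = integrable_cbox_continuous
  have c: "continuous_on UNIV (\<lambda>y. g (y + h) * f y)" "continuous_on UNIV (\<lambda>y. g y * f (y - h))" "continuous_on UNIV (\<lambda>y. g y * f y)"
    using continuous_on_shift[OF cf, of UNIV "- h"] by (auto intro!: continuous_intros continuous_on_shift cf cg)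
  have "(\<integral>y. dq g e k y * f y \<partial>cellM) = integral (cbox 0 1) (\<lambda>y. (g (y + h) * f y - g y * f y) * real (Suc k))"
    by (subst integral_cellM_eq[OF continuous_on_mult[OF dq_continuous[OF g] cf]])
       (simp only: dq_def h_def algebra_simps)
  also have "\<dots> = (integral (cbox 0 1) (\<lambda>y. g (y + h) * f y) - integral (cbox 0 1) (\<lambda>y. g y * f y)) * real (Suc k)"
    by (simp only: integral_mult_left integral_diff[OF int[OF c(1)] int[OF c(3)]])
  also have "\<dots> = integral (cbox 0 1) (\<lambda>y. (g y * f (y - h) - g y * f y) * real (Suc k))"
    by (simp only: shift integral_mult_left integral_diff[OF int[OF c(2)] int[OF c(3)]])
  also have "\<dots> = (\<integral>y. dq f (- e) k y * g y \<partial>cellM)"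
    by (subst integral_cellM_eq[OF continuous_on_mult[OF dq_continuous[OF f] cg]])
       (simp add: dq_def h_def algebra_simps)
  finally show ?thesis .
qed

text \<open>Limit of summation by parts: with translation invariance no boundary term appears at any
  stage.\<close>

lemma periodic_integration_by_parts:
  fixes f g :: "real ^ 'n \<Rightarrow> real"
  assumes f: "Ck (Suc 0) f" "Y_periodic f" and g: "Ck (Suc 0) g" "Y_periodic g"
  shows "(\<integral>y. f y * partial_deriv i g y \<partial>cellM) = - (\<integral>y. partial_deriv i f y * g y \<partial>cellM)"
proof -
  let ?e = "axis i 1 :: real ^ 'n"
  obtain B1 where B1: "\<And>y. norm (grad f y) \<le> B1" using grad_bounded[OF f] by auto
  obtain B2 where B2: "\<And>y. norm (grad g y) \<le> B2" using grad_bounded[OF g] by auto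
  obtain C1 where C1: "\<And>y. norm (f y) \<le> C1" using Y_periodic_bounded[OF C1_continuous[OF f(1)] f(2)] by auto
  obtain C2 where C2: "\<And>y. norm (g y) \<le> C2" using Y_periodic_bounded[OF C1_continuous[OF g(1)] g(2)] by auto
  note cf = C1_continuous[OF f(1)] and cg = C1_continuous[OF g(1)]
  have eq: "(\<integral>y. dq g ?e k y * f y \<partial>cellM) = (\<integral>y. dq f (- ?e) k y * g y \<partial>cellM)" for k
  proof -
    let ?s = "inverse (real (Suc k)) *\<^sub>R ?e"
    have cF: "continuous_on UNIV (\<lambda>y. g y * f (y - ?s))"
      using continuous_on_shift[OF cf, of UNIV "- ?s"] by (intro continuous_intros cg) simp
    have pF: "Y_periodic (\<lambda>y. g y * f (y - ?s))"
      using Y_periodic_shift[OF f(2), of "- ?s"] g(2) by (auto simp: Y_periodic_def)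
    have "integral (cbox 0 1) (\<lambda>y. g (y + ?s) * f y) = integral (cbox 0 1) (\<lambda>y. g y * f (y - ?s))"
      using integral_periodic_shift[OF cF pF, of ?s] by simp
    then show ?thesis by (rule dq_summation_by_parts[OF f(1) g(1)])
  qed
  have "(\<lambda>k. \<integral>y. dq g ?e k y * f y \<partial>cellM) \<longlonglongrightarrow> (\<integral>y. (grad g y \<bullet> ?e) * f y \<partial>cellM)"
    using C1 by (intro dq_integral_tendsto[OF g(1) B2]) (auto intro: cf)
  moreover have "(\<lambda>k. \<integral>y. dq f (- ?e) k y * g y \<partial>cellM) \<longlonglongrightarrow> (\<integral>y. (grad f y \<bullet> (- ?e)) * g y \<partial>cellM)"
    using C2 by (intro dq_integral_tendsto[OF f(1) B1]) (auto intro: cg)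
  ultimately have "(\<integral>y. (grad g y \<bullet> ?e) * f y \<partial>cellM) = (\<integral>y. (grad f y \<bullet> (- ?e)) * g y \<partial>cellM)"
    unfolding eq by (rule LIMSEQ_unique)
  then show ?thesis by (simp add: inner_axis mult.commute)
qed

text \<open>Only first derivatives are used: the identity is the limit of its counterpart for
  difference quotients, where it is a consequence of translation invariance.\<close>

lemma periodic_cross_derivatives:
  fixes f g :: "real ^ 'n \<Rightarrow> real"
  assumes f: "Ck (Suc 0) f" "Y_periodic f" and g: "Ck (Suc 0) g" "Y_periodic g"
  shows "(\<integral>y. partial_deriv i f y * partial_deriv j g y \<partial>cellM) = (\<integral>y. partial_deriv j f y * partial_deriv i g y \<partial>cellM)"
proof -
  let ?e = "axis i 1 :: real ^ 'n" and ?d = "axis j 1 :: real ^ 'n"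
  obtain B1 where B1: "\<And>y. norm (grad f y) \<le> B1" using grad_bounded[OF f] by auto
  obtain B2 where B2: "\<And>y. norm (grad g y) \<le> B2" using grad_bounded[OF g] by auto
  note cf = C1_continuous[OF f(1)] and cg = C1_continuous[OF g(1)]
  have eq: "(\<integral>y. dq f ?e k y * dq g ?d k y \<partial>cellM) = (\<integral>y. dq f (- ?d) k y * dq g (- ?e) k y \<partial>cellM)" for k
  proof -
    let ?s = "inverse (real (Suc k)) *\<^sub>R ?e" and ?t = "inverse (real (Suc k)) *\<^sub>R ?d"
    have c: "continuous_on UNIV (\<lambda>y. f (y + a) * g (y + b))" for a b
      by (intro continuous_intros continuous_on_shift cf cg)
    have p: "Y_periodic (\<lambda>y. f (y + a) * g (y + b))" for a b
      using Y_periodic_shift[OF f(2), of a] Y_periodic_shift[OF g(2), of b] by (auto simp: Y_periodic_def)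
    \<comment> \<open>\<open>J a b\<close> depends on the difference of the shifts only. Hence the
      four terms of the expanded product for the directions \<open>?e\<close>, \<open>?d\<close>
      match those for \<open>- ?d\<close>, \<open>- ?e\<close>.\<close>
    define J where "J a b = integral (cbox 0 1) (\<lambda>y. f (y + a) * g (y + b))" for a b
    have Jshift: "J (a + h) (b + h) = J a b" for a b h
      unfolding J_def using integral_periodic_shift[OF c[of a b] p[of a b], of h] by (simp add: add_ac)
    have expand: "integral (cbox 0 1) (\<lambda>y. (f (y + a) - f y) * (g (y + b) - g y)) = J a b - J a 0 - J 0 b + J 0 0" for a b
    proof -
      have "((\<lambda>y. f (y + a) * g (y + b) - f (y + a) * g (y + 0) - f (y + 0) * g (y + b) + f (y + 0) * g (y + 0))
        has_integral (J a b - J a 0 - J 0 b + J 0 0)) (cbox 0 1)"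
        unfolding J_def by (intro has_integral_add has_integral_diff integrable_integral integrable_cbox_continuous c)
      then show ?thesis by (simp add: integral_unique algebra_simps)
    qed
    have main: "(\<integral>y. dq f a k y * dq g b k y \<partial>cellM) =
      integral (cbox 0 1) (\<lambda>y. (f (y + inverse (real (Suc k)) *\<^sub>R a) - f y) * (g (y + inverse (real (Suc k)) *\<^sub>R b) - g y)) * (real (Suc k))\<^sup>2" for a b
    proof -
      have "(\<integral>y. dq f a k y * dq g b k y \<partial>cellM) = integral (cbox 0 1) (\<lambda>y. dq f a k y * dq g b k y)"
        by (intro integral_cellM_eq continuous_intros dq_continuous f g)
      also have "\<dots> = integral (cbox 0 1) (\<lambda>y. ((f (y + inverse (real (Suc k)) *\<^sub>R a) - f y) * (g (y + inverse (real (Suc k)) *\<^sub>R b) - g y)) * (real (Suc k))\<^sup>2)"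
        by (rule integral_cong) (simp only: dq_def power2_eq_square mult_ac)
      also have "\<dots> = integral (cbox 0 1) (\<lambda>y. (f (y + inverse (real (Suc k)) *\<^sub>R a) - f y) * (g (y + inverse (real (Suc k)) *\<^sub>R b) - g y)) * (real (Suc k))\<^sup>2"
        by (rule integral_mult_left)
      finally show ?thesis .
    qed
    have "J ?s ?t = J (- ?t) (- ?s)" using Jshift[of "- ?t" "?s + ?t" "- ?s"] by simp
    moreover have "J ?s 0 = J 0 (- ?s)" using Jshift[of 0 ?s "- ?s"] by simp
    moreover have "J 0 ?t = J (- ?t) 0" using Jshift[of "- ?t" ?t 0] by simp
    ultimately have "J ?s ?t - J ?s 0 - J 0 ?t + J 0 0 = J (- ?t) (- ?s) - J (- ?t) 0 - J 0 (- ?s) + J 0 0"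
      by linarith
    then show ?thesis by (simp only: main scaleR_minus_right expand)
  qed
  have lim: "(\<lambda>k. \<integral>y. dq f a k y * dq g b k y \<partial>cellM) \<longlonglongrightarrow> (\<integral>y. (grad f y \<bullet> a) * (grad g y \<bullet> b) \<partial>cellM)" for a b
    using dq_bound[OF g(1) B2] g
    by (intro dq_integral_tendsto[OF f(1) B1]) (auto intro!: dq_continuous dq_tendsto continuous_intros C1_continuous_grad)
  have "(\<integral>y. (grad f y \<bullet> ?e) * (grad g y \<bullet> ?d) \<partial>cellM) = (\<integral>y. (grad f y \<bullet> (- ?d)) * (grad g y \<bullet> (- ?e)) \<partial>cellM)"
    using lim[of ?e ?d] lim[of "- ?d" "- ?e"] unfolding eq by (rule LIMSEQ_unique)
  then show ?thesis by (simp add: inner_axis)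
qed


section \<open>Poincare's inequality for smooth periodic functions\<close>

text \<open>The variance of \<open>g\<close> on an interval of length one is nonnegative.\<close>

lemma integral_square_le:
  fixes g :: "real \<Rightarrow> real"
  assumes "continuous_on {0..1} g"
  shows "(integral {0..1} g)\<^sup>2 \<le> integral {0..1} (\<lambda>t. (g t)\<^sup>2)"
proof -
  define c where "c = integral {0..1} g"
  have g: "(g has_integral c) {0..1}" unfolding c_def
    by (intro integrable_integral integrable_continuous_real assms)
  have g2: "((\<lambda>t. (g t)\<^sup>2) has_integral integral {0..1} (\<lambda>t. (g t)\<^sup>2)) {0..1}"
    by (intro integrable_integral integrable_continuous_real continuous_intros assms)
  have c2: "((\<lambda>t. c\<^sup>2) has_integral c\<^sup>2) {0..1::real}"
    using has_integral_const_real[of "c\<^sup>2" 0 1] by simp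
  have "((\<lambda>t. (g t)\<^sup>2 - 2 * c * g t + c\<^sup>2) has_integral (integral {0..1} (\<lambda>t. (g t)\<^sup>2) - 2 * c * c + c\<^sup>2)) {0..1}"
    by (intro has_integral_add has_integral_diff g2 c2 has_integral_mult_right g)
  moreover have "0 \<le> (g t)\<^sup>2 - 2 * c * g t + c\<^sup>2" for t
    using zero_le_power2[of "g t - c"] by (simp add: power2_diff algebra_simps)
  ultimately have "0 \<le> integral {0..1} (\<lambda>t. (g t)\<^sup>2) - 2 * c * c + c\<^sup>2"
    by (meson has_integral_nonneg)
  then show ?thesis by (simp add: c_def[symmetric] power2_eq_square)
qed

lemma continuous_on_shift2:
  fixes f :: "real ^ 'n \<Rightarrow> 'b::topological_space"
  assumes "continuous_on UNIV f" "continuous_on S g"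
  shows "continuous_on S (\<lambda>x. f (g x))"
  by (rule continuous_on_compose2[OF assms]) auto

lemma content_unit_cell: "measure lborel (cbox (0::real ^ 'n) 1) = 1"
  by (simp add: measure_lborel_cbox_eq one_inner_Basis)

text \<open>The difference is the integral of the directional derivative along the segment. After
  Jensen's inequality and an exchange of the integrals, every translate of the gradient contributes
  the same by periodicity.\<close>

lemma periodic_shift_difference_le:
  fixes f :: "real ^ 'n \<Rightarrow> real"
  assumes f: "Ck (Suc 0) f" "Y_periodic f"
  shows "integral (cbox 0 1) (\<lambda>x. (f (x + h) - f x)\<^sup>2)
    \<le> (norm h)\<^sup>2 * integral (cbox 0 1) (\<lambda>x. (norm (grad f x))\<^sup>2)"
proof -
  note cf = C1_continuous[OF f(1)] and cg = C1_continuous_grad[OF f(1)]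
  let ?q = "\<lambda>x t. (norm h)\<^sup>2 * (norm (grad f (x + t *\<^sub>R h)))\<^sup>2"
  have "(f (x + h) - f x)\<^sup>2 \<le> integral (cbox 0 1) (?q x)" for x
  proof -
    have c: "continuous_on {0..1} (\<lambda>t. grad f (x + t *\<^sub>R h) \<bullet> h)"
      by (intro continuous_intros continuous_on_shift2[OF cg])
    have "(f (x + h) - f x)\<^sup>2 = (integral {0..1} (\<lambda>t. grad f (x + t *\<^sub>R h) \<bullet> h))\<^sup>2"
      using C1_line_integral[OF f(1), of x h] by (simp add: integral_unique)
    also have "\<dots> \<le> integral {0..1} (\<lambda>t. (grad f (x + t *\<^sub>R h) \<bullet> h)\<^sup>2)"
      by (rule integral_square_le[OF c])
    also have "\<dots> \<le> integral {0..1} (?q x)"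
    proof (rule integral_le)
      show "(\<lambda>t. (grad f (x + t *\<^sub>R h) \<bullet> h)\<^sup>2) integrable_on {0..1}"
        by (intro integrable_continuous_real continuous_intros c)
      show "?q x integrable_on {0..1}"
        by (intro integrable_continuous_real continuous_intros continuous_on_shift2[OF cg])
      fix t :: real
      have "\<bar>grad f (x + t *\<^sub>R h) \<bullet> h\<bar> \<le> norm (grad f (x + t *\<^sub>R h)) * norm h"
        by (rule Cauchy_Schwarz_ineq2)
      then have "(grad f (x + t *\<^sub>R h) \<bullet> h)\<^sup>2 \<le> (norm (grad f (x + t *\<^sub>R h)) * norm h)\<^sup>2"
        by (rule abs_le_square_iff[THEN iffD1, OF order_trans[OF _ abs_ge_self]])
      then show "(grad f (x + t *\<^sub>R h) \<bullet> h)\<^sup>2 \<le> ?q x t" by (simp add: power_mult_distrib mult.commute)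
    qed
    finally show ?thesis by simp
  qed
  note le = this
  have cq: "continuous_on S (\<lambda>(x, t). ?q x t)" for S
    unfolding case_prod_unfold by (intro continuous_intros continuous_on_shift2[OF cg])
  have intq: "(\<lambda>x. integral (cbox 0 1) (?q x)) integrable_on (cbox 0 1)"
    using integral_integrable_2dim[OF cq, of 0 1 0 1] by simp
  have intd: "(\<lambda>x. (f (x + h) - f x)\<^sup>2) integrable_on cbox 0 1"
    by (intro integrable_cbox_continuous continuous_intros continuous_on_shift2[OF cf] cf)
  have "integral (cbox 0 1) (\<lambda>x. (f (x + h) - f x)\<^sup>2) \<le> integral (cbox 0 1) (\<lambda>x. integral (cbox 0 1) (?q x))"
    by (rule integral_le[OF intd intq le])
  also have "\<dots> = integral (cbox 0 1) (\<lambda>t. integral (cbox 0 1) (\<lambda>x. ?q x t))"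
    by (rule integral_swap_continuous[OF cq])
  also have "(\<lambda>t. integral (cbox 0 1) (\<lambda>x. ?q x t)) = (\<lambda>t. (norm h)\<^sup>2 * integral (cbox 0 1) (\<lambda>x. (norm (grad f x))\<^sup>2))"
  proof
    fix t
    have "integral (cbox 0 1) (\<lambda>x. (norm (grad f (x + t *\<^sub>R h)))\<^sup>2) = integral (cbox 0 1) (\<lambda>x. (norm (grad f x))\<^sup>2)"
      using grad_periodic[OF f(2)]
      by (intro integral_periodic_shift[where f = "\<lambda>x. (norm (grad f x))\<^sup>2"] continuous_intros cg) (simp add: Y_periodic_def)
    then show "integral (cbox 0 1) (\<lambda>x. ?q x t) = (norm h)\<^sup>2 * integral (cbox 0 1) (\<lambda>x. (norm (grad f x))\<^sup>2)"
      by simp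
  qed
  finally show ?thesis by simp
qed

lemma integral_shift_difference:
  fixes f :: "real ^ 'n \<Rightarrow> real"
  assumes f: "continuous_on UNIV f" "Y_periodic f"
  shows "integral (cbox 0 1) (\<lambda>x. (f (x + h) - f x)\<^sup>2)
    = 2 * integral (cbox 0 1) (\<lambda>x. (f x)\<^sup>2) - 2 * integral (cbox 0 1) (\<lambda>x. f (x + h) * f x)"
proof -
  have sh: "integral (cbox 0 1) (\<lambda>x. (f (x + h))\<^sup>2) = integral (cbox 0 1) (\<lambda>x. (f x)\<^sup>2)"
    using f(2) by (intro integral_periodic_shift[where f = "\<lambda>x. (f x)\<^sup>2"] continuous_intros f(1)) (simp add: Y_periodic_def)
  have "((\<lambda>x. (f (x + h))\<^sup>2 + (f x)\<^sup>2 - 2 * (f (x + h) * f x)) has_integral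
     (integral (cbox 0 1) (\<lambda>x. (f (x + h))\<^sup>2) + integral (cbox 0 1) (\<lambda>x. (f x)\<^sup>2) - 2 * integral (cbox 0 1) (\<lambda>x. f (x + h) * f x))) (cbox 0 1)"
    by (intro has_integral_diff has_integral_add has_integral_mult_right integrable_integral
        integrable_cbox_continuous continuous_intros f(1) continuous_on_shift2[OF f(1)])
  then show ?thesis
    by (simp add: integral_unique sh power2_diff algebra_simps)
qed

lemma integral_integral_shift_difference:
  fixes f :: "real ^ 'n \<Rightarrow> real"
  assumes f: "continuous_on UNIV f" "Y_periodic f" and mean: "integral (cbox 0 1) f = 0"
  shows "((\<lambda>h. integral (cbox 0 1) (\<lambda>x. (f (x + (h + a)) - f x)\<^sup>2)) has_integral
      2 * integral (cbox 0 1) (\<lambda>x. (f x)\<^sup>2)) (cbox 0 1)"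
proof -
  let ?q = "\<lambda>h x. f (x + (h + a)) * f x"
  have cq: "continuous_on S (\<lambda>(h, x). ?q h x)" for S
    unfolding case_prod_unfold by (intro continuous_intros continuous_on_shift2[OF f(1)])
  have "(\<lambda>h. integral (cbox 0 1) (?q h)) integrable_on cbox 0 1"
    using integral_integrable_2dim[OF cq, of 0 1 0 1] by simp
  then have int: "((\<lambda>h. integral (cbox 0 1) (?q h)) has_integral integral (cbox 0 1) (\<lambda>h. integral (cbox 0 1) (?q h))) (cbox 0 1)"
    by (rule integrable_integral)
  have "integral (cbox 0 1) (\<lambda>h. integral (cbox 0 1) (?q h)) = integral (cbox 0 1) (\<lambda>x. integral (cbox 0 1) (\<lambda>h. ?q h x))"
    by (rule integral_swap_continuous[OF cq])
  \<comment> \<open>For fixed \<open>x\<close> the variable \<open>h\<close> runs through a full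
    period, so the correlation term is a multiple of the mean of \<open>f\<close>.\<close>
  also have "(\<lambda>x. integral (cbox 0 1) (\<lambda>h. ?q h x)) = (\<lambda>x. 0)"
  proof
    fix x
    have "integral (cbox 0 1) (\<lambda>h. f (h + (x + a))) = 0"
      using integral_periodic_shift[OF f, of "x + a"] mean by simp
    then show "integral (cbox 0 1) (\<lambda>h. ?q h x) = 0" by (simp add: add_ac)
  qed
  finally have q0: "((\<lambda>h. integral (cbox 0 1) (?q h)) has_integral 0) (cbox 0 1)"
    using int by simp
  have c0: "((\<lambda>h. 2 * integral (cbox 0 1) (\<lambda>x. (f x)\<^sup>2)) has_integral 2 * integral (cbox 0 1) (\<lambda>x. (f x)\<^sup>2)) (cbox (0::real ^ 'n) 1)"
  proof -
    have "measure lborel (cbox (0::real ^ 'n) 1) = 1" by (rule content_unit_cell)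
    then show ?thesis using has_integral_const[of "2 * integral (cbox 0 1) (\<lambda>x. (f x)\<^sup>2)" "0::real ^ 'n" 1] by simp
  qed
  have "((\<lambda>h. 2 * integral (cbox 0 1) (\<lambda>x. (f x)\<^sup>2) - 2 * integral (cbox 0 1) (?q h)) has_integral
      2 * integral (cbox 0 1) (\<lambda>x. (f x)\<^sup>2) - 2 * 0) (cbox 0 1)"
    by (rule has_integral_diff[OF c0 has_integral_mult_right[OF q0]])
  then show ?thesis by (simp add: integral_shift_difference[OF f])
qed

text \<open>The mean square of the differences \<open>f(x + h) - f(x)\<close> over all \<open>x, h\<close> is \<open>2\<integral>f\<^sup>2\<close>. Averaging the
  steps \<open>h\<close> and \<open>h + (1/2, \<dots>, 1/2)\<close>, each taken modulo \<open>1\<close> in \<open>[-1/2, 1/2]\<^sup>n\<close>, improves the bound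
  \<open>n/4\<close> for the square of the length of a step to \<open>n/8\<close>.\<close>

lemma Poincare_C1:
  fixes f :: "real ^ 'n \<Rightarrow> real"
  assumes f: "Ck (Suc 0) f" "Y_periodic f" and mean: "(\<integral>x. f x \<partial>cellM) = 0"
  shows "(\<integral>x. (f x)\<^sup>2 \<partial>cellM) \<le> real CARD('n) / 16 * (\<integral>x. (norm (grad f x))\<^sup>2 \<partial>cellM)"
proof -
  note cf = C1_continuous[OF f(1)] and cg = C1_continuous_grad[OF f(1)]
  define G where "G = integral (cbox 0 1) (\<lambda>x. (norm (grad f x))\<^sup>2)"
  define D where "D h = integral (cbox 0 1) (\<lambda>x. (f (x + h) - f x)\<^sup>2)" for h
  have mean': "integral (cbox 0 1) f = 0" using mean by (simp add: integral_cellM_eq cf)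
  have G0: "0 \<le> G" unfolding G_def
    by (intro integral_nonneg integrable_cbox_continuous continuous_intros cg) auto
  define a :: "real ^ 'n" where "a = (\<chi> i. 1/2)"
  have D1: "(D has_integral 2 * integral (cbox 0 1) (\<lambda>x. (f x)\<^sup>2)) (cbox 0 1)"
    using integral_integral_shift_difference[OF cf f(2) mean', of 0] by (simp add: D_def[abs_def])
  have D2: "((\<lambda>h. D (h + a)) has_integral 2 * integral (cbox 0 1) (\<lambda>x. (f x)\<^sup>2)) (cbox 0 1)"
    using integral_integral_shift_difference[OF cf f(2) mean', of a] by (simp add: D_def)
  have Dper: "D (h + k) = D h" if "\<forall>i. k $ i \<in> \<int>" for h k
    using f(2) that unfolding D_def Y_periodic_def by (simp flip: add.assoc)
  have le: "D h + D (h + a) \<le> real CARD('n) / 4 * G" if h: "h \<in> cbox 0 1" for h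
  proof -
    \<comment> \<open>Representatives of \<open>h\<close> and \<open>h + a\<close> modulo integers.
      In each coordinate their absolute values add up to 1/2, so the sum of the two squares is at
      most 1/4.\<close>
    define u v :: "real ^ 'n" where "u = (\<chi> i. if h $ i \<le> 1/2 then h $ i else h $ i - 1)" and "v = (\<chi> i. h $ i - 1/2)"
    have "D (u + (h - u)) = D u" by (rule Dper) (auto simp: u_def)
    moreover have "D (v + (h + a - v)) = D v" by (rule Dper) (auto simp: v_def a_def)
    ultimately have "D h + D (h + a) = D u + D v" by simp
    also have "\<dots> \<le> (norm u)\<^sup>2 * G + (norm v)\<^sup>2 * G"
      unfolding D_def G_def by (intro add_mono periodic_shift_difference_le f)
    also have "\<dots> = ((norm u)\<^sup>2 + (norm v)\<^sup>2) * G" by (simp add: algebra_simps)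
    also have "\<dots> \<le> (real CARD('n) / 4) * G"
    proof (rule mult_right_mono[OF _ G0])
      have "(norm u)\<^sup>2 + (norm v)\<^sup>2 = (\<Sum>i\<in>UNIV. (u $ i)\<^sup>2 + (v $ i)\<^sup>2)"
        unfolding power2_norm_eq_inner inner_vec_def sum.distrib by (simp add: power2_eq_square)
      also have "\<dots> \<le> (\<Sum>i\<in>(UNIV::'n set). 1/4)"
      proof (rule sum_mono)
        fix i
        have hi: "0 \<le> h $ i" "h $ i \<le> 1" using h by (auto simp: mem_box_cart)
        show "(u $ i)\<^sup>2 + (v $ i)\<^sup>2 \<le> 1/4"
        proof (cases "h $ i \<le> 1/2")
          case True
          have "0 \<le> h $ i * (1/2 - h $ i)" using True hi by (intro mult_nonneg_nonneg) auto
          then show ?thesis using True by (simp add: u_def v_def power2_eq_square algebra_simps)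
        next
          case False
          have "0 \<le> (1 - h $ i) * (h $ i - 1/2)" using False hi by (intro mult_nonneg_nonneg) auto
          moreover have "(u $ i)\<^sup>2 + (v $ i)\<^sup>2 = 1/4 - 2 * ((1 - h $ i) * (h $ i - 1/2))"
            using False by (simp add: u_def v_def power2_eq_square field_simps)
          ultimately show ?thesis by linarith
        qed
      qed
      finally show "(norm u)\<^sup>2 + (norm v)\<^sup>2 \<le> real CARD('n) / 4" by simp
    qed
    finally show ?thesis .
  qed
  have "measure lborel (cbox (0::real ^ 'n) 1) = 1" by (rule content_unit_cell)
  then have "((\<lambda>h::real ^ 'n. real CARD('n) / 4 * G) has_integral real CARD('n) / 4 * G) (cbox 0 1)"
    using has_integral_const[of "real CARD('n) / 4 * G" "0::real ^ 'n" 1] by simp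
  with has_integral_add[OF D1 D2]
  have "2 * integral (cbox 0 1) (\<lambda>x. (f x)\<^sup>2) + 2 * integral (cbox 0 1) (\<lambda>x. (f x)\<^sup>2) \<le> real CARD('n) / 4 * G"
    by (rule has_integral_le) (rule le)
  then show ?thesis
    by (simp add: G_def integral_cellM_eq continuous_intros cf cg)
qed

text \<open>A test function is not periodic. Translation invariance comes from its support instead:
  for steps shorter than the distance \<open>\<epsilon>\<close> from \<open>K\<close> to the
  boundary, the support does not leave the shifted cube.\<close>

lemma test_function_integration_by_parts:
  fixes f \<phi> :: "real ^ 'n \<Rightarrow> real"
  assumes f: "Ck (Suc 0) f" "Y_periodic f" and \<phi>: "test_function \<phi>"
  shows "(\<integral>y. f y * partial_deriv i \<phi> y \<partial>cellM) = - (\<integral>y. partial_deriv i f y * \<phi> y \<partial>cellM)"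
proof -
  let ?e = "axis i 1 :: real ^ 'n"
  obtain K where K: "compact K" "K \<subseteq> cell" "\<And>y. y \<notin> K \<Longrightarrow> \<phi> y = 0" using \<phi> by (auto simp: test_function_def)
  have g: "Ck (Suc 0) \<phi>" using \<phi> unfolding test_function_def smooth_def by blast
  note cf = C1_continuous[OF f(1)] and cg = C1_continuous[OF g]
  obtain B1 where B1: "\<And>y. norm (grad f y) \<le> B1" using grad_bounded[OF f] by auto
  have grad0: "grad \<phi> y = 0" if "y \<notin> K" for y
  proof -
    have "open (- K)" using K(1) by (simp add: compact_imp_closed open_Compl)
    moreover have "((\<lambda>x. 0) has_derivative (\<lambda>h. 0)) (at y)" by simp
    ultimately have "(\<phi> has_derivative (\<lambda>h. 0)) (at y)"
      using that K(3) by (intro has_derivative_transform_within_open[of "\<lambda>x. 0" "\<lambda>h. 0" y UNIV "- K" \<phi>]) auto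
    then have "frechet_derivative \<phi> (at y) = (\<lambda>h. 0)" by (rule frechet_derivative_at[symmetric])
    then show ?thesis by (simp add: vec_eq_iff partial_deriv_def)
  qed
  obtain B2 where B2: "\<And>y. norm (grad \<phi> y) \<le> B2"
  proof -
    obtain B where "0 \<le> B" "\<forall>y\<in>cbox 0 1. norm (grad \<phi> y) \<le> B" using continuous_bounded_cell[OF C1_continuous_grad[OF g]] by auto
    then have "norm (grad \<phi> y) \<le> B" for y using grad0[of y] subset_trans[OF K(2) box_subset_cbox] by (cases "y \<in> K") auto
    then show ?thesis using that by blast
  qed
  obtain C1 where C1: "\<And>y. norm (f y) \<le> C1" using Y_periodic_bounded[OF cf f(2)] by auto
  obtain C2 where C2: "\<And>y. norm (\<phi> y) \<le> C2"
  proof -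
    obtain B where "0 \<le> B" "\<forall>y\<in>cbox 0 1. norm (\<phi> y) \<le> B" using continuous_bounded_cell[OF cg] by auto
    then have "norm (\<phi> y) \<le> B" for y using K(3) subset_trans[OF K(2) box_subset_cbox] by (cases "y \<in> K") auto
    then show ?thesis using that by blast
  qed
  obtain \<epsilon> where \<epsilon>: "\<epsilon> > 0" "(\<Union>x\<in>K. ball x \<epsilon>) \<subseteq> cell"
    using compact_subset_open_imp_ball_epsilon_subset[OF K(1) open_box K(2)] by blast
  have eq: "(\<integral>y. dq \<phi> ?e k y * f y \<partial>cellM) = (\<integral>y. dq f (- ?e) k y * \<phi> y \<partial>cellM)"
    if k: "inverse (real (Suc k)) < \<epsilon>" for k
  proof -
    let ?s = "inverse (real (Suc k)) *\<^sub>R ?e"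
    let ?F = "\<lambda>y. \<phi> y * f (y - ?s)"
    have cF: "continuous_on UNIV ?F"
      using continuous_on_shift[OF cf, of UNIV "- ?s"] by (intro continuous_intros cg) simp
    have F0: "?F y = 0" if "y \<notin> K" for y using K(3)[OF that] by simp
    have sub: "K \<subseteq> cbox ?s (1 + ?s)"
    proof
      fix y assume "y \<in> K"
      moreover have "y - ?s \<in> ball y \<epsilon>" using k by (simp add: dist_norm)
      ultimately have "y - ?s \<in> cell" using \<epsilon>(2) by blast
      then show "y \<in> cbox ?s (1 + ?s)" by (force simp: mem_box_cart algebra_simps less_imp_le)
    qed
    have sub0: "K \<subseteq> cbox 0 1" using K(2) box_subset_cbox by blast
    have "(?F has_integral integral (cbox ?s (1 + ?s)) ?F) UNIV"
      by (rule has_integral_on_superset[OF integrable_integral[OF integrable_cbox_continuous[OF cF]]]) (use F0 sub in auto)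
    moreover have "(?F has_integral integral (cbox 0 1) ?F) UNIV"
      by (rule has_integral_on_superset[OF integrable_integral[OF integrable_cbox_continuous[OF cF]]]) (use F0 sub0 in auto)
    ultimately have "integral (cbox ?s (1 + ?s)) ?F = integral (cbox 0 1) ?F" by (rule has_integral_unique)
    then have "integral (cbox 0 1) (\<lambda>y. \<phi> (y + ?s) * f y) = integral (cbox 0 1) ?F"
      using integral_shift_cbox[of ?s ?s "1 + ?s" ?F] by simp
    then show ?thesis by (rule dq_summation_by_parts[OF f(1) g])
  qed
  have "eventually (\<lambda>k. inverse (real (Suc k)) < \<epsilon>) sequentially"
    using order_tendstoD(2)[OF LIMSEQ_inverse_real_of_nat \<epsilon>(1)] by simp
  then have ev: "eventually (\<lambda>k. (\<integral>y. dq \<phi> ?e k y * f y \<partial>cellM) = (\<integral>y. dq f (- ?e) k y * \<phi> y \<partial>cellM)) sequentially"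
    by eventually_elim (rule eq)
  have "(\<lambda>k. \<integral>y. dq \<phi> ?e k y * f y \<partial>cellM) \<longlonglongrightarrow> (\<integral>y. (grad \<phi> y \<bullet> ?e) * f y \<partial>cellM)"
    using C1 by (intro dq_integral_tendsto[OF g B2]) (auto intro: cf)
  then have "(\<lambda>k. \<integral>y. dq f (- ?e) k y * \<phi> y \<partial>cellM) \<longlonglongrightarrow> (\<integral>y. (grad \<phi> y \<bullet> ?e) * f y \<partial>cellM)"
    using tendsto_cong[OF ev] by blast
  moreover have "(\<lambda>k. \<integral>y. dq f (- ?e) k y * \<phi> y \<partial>cellM) \<longlonglongrightarrow> (\<integral>y. (grad f y \<bullet> (- ?e)) * \<phi> y \<partial>cellM)"
    using C2 by (intro dq_integral_tendsto[OF f(1) B1]) (auto intro: cg)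
  ultimately have "(\<integral>y. (grad \<phi> y \<bullet> ?e) * f y \<partial>cellM) = (\<integral>y. (grad f y \<bullet> (- ?e)) * \<phi> y \<partial>cellM)"
    by (rule LIMSEQ_unique)
  then show ?thesis by (simp add: inner_axis mult.commute)
qed


section \<open>Test functions and the fundamental lemma\<close>

text \<open>The positive and the negative part are densities of two finite measures that agree on
  boxes, an intersection stable generator. So the measures are equal, and both parts agree almost
  everywhere; as they are never positive together, they vanish.\<close>

lemma AE_zero_if_box_integrals_zero:
  fixes g :: "real ^ 'n \<Rightarrow> real"
  assumes g: "integrable cellM g"
    and zero: "\<And>a b. box a b \<subseteq> cell \<Longrightarrow> (\<integral>y. g y * indicator (box a b) y \<partial>cellM) = 0"
  shows "AE y in cellM. g y = 0"
proof -
  define h where "h y = indicator cell y *\<^sub>R g y" for y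
  have hint: "integrable lebesgue h"
    unfolding h_def[abs_def] using g by (subst (asm) integrable_restrict_space) auto
  \<comment> \<open>The comparison of densities is carried out over \<open>lborel\<close>, so the
    zero extension \<open>h\<close> is replaced by a Borel function that agrees with it almost
    everywhere.\<close>
  then have "h \<in> borel_measurable (completion lborel)" by (rule borel_measurable_integrable)
  then obtain h' where h'[measurable]: "h' \<in> borel_measurable lborel" and hh': "AE y in lborel. h y = h' y"
    using completion_ex_borel_measurable_real by blast
  have hh'': "AE y in lebesgue. h y = h' y" using hh' by (rule AE_completion)
  have h'leb: "h' \<in> borel_measurable lebesgue" using h' by (rule measurable_completion)
  have "integrable lebesgue h'"
    using hint integrable_cong_AE[OF borel_measurable_integrable[OF hint] h'leb hh''] by simp
  then have h'int: "integrable lborel h'" by (simp add: integrable_completion)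
  have box0: "(\<integral>y. h' y * indicator (box a b) y \<partial>lborel) = 0" for a b
  proof -
    define a' b' :: "real ^ 'n" where "a' = (\<chi> i. max 0 (a $ i))" and "b' = (\<chi> i. min 1 (b $ i))"
    have box: "box a' b' = cell \<inter> box a b" by (auto simp: a'_def b'_def mem_box_cart)
    have "(\<integral>y. h' y * indicator (box a b) y \<partial>lborel) = (\<integral>y. h' y * indicator (box a b) y \<partial>lebesgue)"
      by (rule integral_completion[symmetric]) measurable
    also have "\<dots> = (\<integral>y. h y * indicator (box a b) y \<partial>lebesgue)"
    proof (rule integral_cong_AE)
      have ind: "indicator (box a b) \<in> borel_measurable (lebesgue :: (real ^ 'n) measure)"
        by (rule measurable_completion) measurable
      show "(\<lambda>y. h' y * indicator (box a b) y) \<in> borel_measurable lebesgue"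
        by (intro borel_measurable_times h'leb ind)
      show "(\<lambda>y. h y * indicator (box a b) y) \<in> borel_measurable lebesgue"
        by (intro borel_measurable_times ind borel_measurable_integrable hint)
      show "AE y in lebesgue. h' y * indicator (box a b) y = h y * indicator (box a b) y"
        using hh'' by eventually_elim simp
    qed
    also have "\<dots> = (\<integral>y. indicator cell y *\<^sub>R (g y * indicator (box a' b') y) \<partial>lebesgue)"
      by (intro Bochner_Integration.integral_cong refl) (auto simp: h_def box indicator_def)
    also have "\<dots> = (\<integral>y. g y * indicator (box a' b') y \<partial>cellM)"
      by (rule integral_restrict_space[symmetric]) simp
    also have "\<dots> = 0" by (rule zero) (simp add: box)
    finally show ?thesis .
  qed
  have fin: "(\<integral>\<^sup>+ y. ennreal (h' y) \<partial>lborel) \<noteq> \<infinity>" "(\<integral>\<^sup>+ y. ennreal (- h' y) \<partial>lborel) \<noteq> \<infinity>"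
    using h'int by (auto simp: real_integrable_def)
  have eq: "density lborel (\<lambda>y. ennreal (h' y)) = density lborel (\<lambda>y. ennreal (- h' y))"
  proof (rule measure_eqI_generator_eq)
    let ?E = "range (\<lambda>(a, b). box a b :: (real ^ 'n) set)"
    show "Int_stable ?E" by (auto simp: Int_stable_def box_Int_box)
    show "?E \<subseteq> Pow UNIV" "sets (density lborel (\<lambda>y. ennreal (h' y))) = sigma_sets UNIV ?E"
      "sets (density lborel (\<lambda>y. ennreal (- h' y))) = sigma_sets UNIV ?E"
      by (simp_all add: borel_eq_box)
    let ?A = "\<lambda>n::nat. box (- (real n *\<^sub>R One)) (real n *\<^sub>R One) :: (real ^ 'n) set"
    show "range ?A \<subseteq> ?E" "(\<Union>i. ?A i) = UNIV" unfolding UN_box_eq_UNIV by auto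
    have "emeasure (density lborel (\<lambda>y. ennreal (h' y))) (?A i) \<le> (\<integral>\<^sup>+ y. ennreal (h' y) \<partial>lborel)" for i
      by (subst emeasure_density) (auto intro!: nn_integral_mono simp: indicator_def)
    then show "emeasure (density lborel (\<lambda>y. ennreal (h' y))) (?A i) \<noteq> \<infinity>" for i
      using fin(1) by (metis infinity_ennreal_def neq_top_trans)
    fix X assume "X \<in> ?E"
    then obtain a b where X: "X = box a b" by auto
    let ?k = "\<lambda>y. h' y * indicator (box a b) y"
    have kint: "integrable lborel ?k"
      using integrable_real_mult_indicator[OF _ h'int, of "box a b"] by (simp add: mult.commute)
    have e1: "emeasure (density lborel (\<lambda>y. ennreal (h' y))) X = (\<integral>\<^sup>+ y. ennreal (?k y) \<partial>lborel)"
      unfolding X by (subst emeasure_density) (auto intro!: nn_integral_cong simp: indicator_def)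
    have e2: "emeasure (density lborel (\<lambda>y. ennreal (- h' y))) X = (\<integral>\<^sup>+ y. ennreal (- ?k y) \<partial>lborel)"
      unfolding X by (subst emeasure_density) (auto intro!: nn_integral_cong simp: indicator_def)
    have f: "(\<integral>\<^sup>+ y. ennreal (?k y) \<partial>lborel) \<noteq> \<infinity>" "(\<integral>\<^sup>+ y. ennreal (- ?k y) \<partial>lborel) \<noteq> \<infinity>"
      using kint by (auto simp: real_integrable_def)
    have "enn2real (\<integral>\<^sup>+ y. ennreal (?k y) \<partial>lborel) = enn2real (\<integral>\<^sup>+ y. ennreal (- ?k y) \<partial>lborel)"
      using box0[of a b] real_lebesgue_integral_def[OF kint] by simp
    then have "ennreal (enn2real (\<integral>\<^sup>+ y. ennreal (?k y) \<partial>lborel)) = ennreal (enn2real (\<integral>\<^sup>+ y. ennreal (- ?k y) \<partial>lborel))"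
      by (simp only:)
    then show "emeasure (density lborel (\<lambda>y. ennreal (h' y))) X = emeasure (density lborel (\<lambda>y. ennreal (- h' y))) X"
      unfolding e1 e2 using f by (simp only: ennreal_enn2real_if infinity_ennreal_def if_False)
  qed
  have "AE y in lborel. ennreal (h' y) = ennreal (- h' y)"
    using fin(1) eq by (subst (asm) finite_density_unique) auto
  then have "AE y in lborel. h' y = 0"
  proof eventually_elim
    case (elim y)
    then show ?case by (cases "0 \<le> h' y") (auto simp: ennreal_neg dest: sym)
  qed
  then have "AE y in lborel. h y = 0" using hh' by eventually_elim simp
  then have "AE y in lebesgue. h y = 0" by (rule AE_completion)
  then have "AE y in lebesgue. y \<in> cell \<longrightarrow> g y = 0" by eventually_elim (auto simp: h_def)
  then show ?thesis by (subst AE_restrict_space_iff) auto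
qed

section \<open>Calculus of smooth functions\<close>

lemma Ck_Suc_imp_Ck: "Ck (Suc k) f \<Longrightarrow> Ck k f"
proof (induction k arbitrary: f)
  case 0
  then show ?case using C1_continuous[of f] by simp
next
  case (Suc k)
  then show ?case by (metis Ck.simps(2))
qed

lemma partial_deriv_eq:
  "(f has_derivative D) (at y) \<Longrightarrow> partial_deriv i f y = D (axis i 1)"
  unfolding partial_deriv_def using frechet_derivative_at by metis

lemma partial_deriv_add:
  assumes "f differentiable (at y)" "g differentiable (at y)"
  shows "partial_deriv i (\<lambda>y. f y + g y) y = partial_deriv i f y + partial_deriv i g y"
proof -
  have "((\<lambda>y. f y + g y) has_derivative (\<lambda>h. frechet_derivative f (at y) h + frechet_derivative g (at y) h)) (at y)"
    using assms by (intro has_derivative_add) (simp_all add: frechet_derivative_works)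
  from partial_deriv_eq[OF this] show ?thesis by (simp add: partial_deriv_def)
qed

lemma partial_deriv_mult:
  assumes "f differentiable (at y)" "g differentiable (at y)"
  shows "partial_deriv i (\<lambda>y. f y * g y) y = f y * partial_deriv i g y + partial_deriv i f y * g y"
proof -
  have "((\<lambda>y. f y * g y) has_derivative (\<lambda>h. f y * frechet_derivative g (at y) h + frechet_derivative f (at y) h * g y)) (at y)"
    using assms by (intro has_derivative_mult) (simp_all add: frechet_derivative_works)
  from partial_deriv_eq[OF this] show ?thesis by (simp add: partial_deriv_def)
qed

lemma Ck_add: "Ck k f \<Longrightarrow> Ck k g \<Longrightarrow> Ck k (\<lambda>y. f y + g y)"
proof (induction k arbitrary: f g)
  case 0
  then show ?case by (simp add: continuous_on_add)
next
  case (Suc k)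
  have "partial_deriv i (\<lambda>y. f y + g y) = (\<lambda>y. partial_deriv i f y + partial_deriv i g y)" for i
    using Suc.prems by (intro ext partial_deriv_add) auto
  with Suc show ?case by simp
qed

lemma Ck_mult: "Ck k f \<Longrightarrow> Ck k g \<Longrightarrow> Ck k (\<lambda>y. f y * g y)"
proof (induction k arbitrary: f g)
  case 0
  then show ?case by (simp add: continuous_on_mult)
next
  case (Suc k)
  have "partial_deriv i (\<lambda>y. f y * g y) = (\<lambda>y. f y * partial_deriv i g y + partial_deriv i f y * g y)" for i
    using Suc.prems by (intro ext partial_deriv_mult) auto
  moreover have "Ck k (\<lambda>y. f y * partial_deriv i g y + partial_deriv i f y * g y)" for i
    using Suc.prems by (intro Ck_add Suc.IH Ck_Suc_imp_Ck[of k f] Ck_Suc_imp_Ck[of k g]) auto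
  ultimately show ?case using Suc.prems by simp
qed

text \<open>Iterated derivatives of a concrete function are hard to write down, but they often stay
  in a simple family. It is enough to exhibit such a family \<open>P\<close>, as is done below for
  constants, \<open>flat\<close> and \<open>wave\<close>.\<close>

lemma smooth_coinduct:
  assumes "\<And>f. P f \<Longrightarrow> (\<forall>y. f differentiable (at y)) \<and> (\<forall>i. P (partial_deriv i f))" "P f"
  shows "smooth f"
proof -
  have "Ck k f" if "P f" for k f
    using that
  proof (induction k arbitrary: f)
    case 0
    then show ?case using assms(1)
      by (auto intro!: differentiable_imp_continuous_on simp: differentiable_on_def differentiable_at_withinI)
  next
    case (Suc k)
    then show ?case using assms(1) by simp
  qed
  then show ?thesis using assms(2) by (simp add: smooth_def)
qed

lemma smooth_C1: "smooth f \<Longrightarrow> Ck (Suc 0) f"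
  unfolding smooth_def by blast

lemma smooth_add: "smooth f \<Longrightarrow> smooth g \<Longrightarrow> smooth (\<lambda>y. f y + g y)"
  by (simp add: smooth_def Ck_add)

lemma smooth_mult: "smooth f \<Longrightarrow> smooth g \<Longrightarrow> smooth (\<lambda>y. f y * g y)"
  by (simp add: smooth_def Ck_mult)

lemma partial_deriv_const: "partial_deriv i (\<lambda>y. c) = (\<lambda>y. 0)"
  by (rule ext, rule partial_deriv_eq[OF has_derivative_const])

lemma smooth_const: "smooth (\<lambda>y. c)"
  by (rule smooth_coinduct[of "\<lambda>f. \<exists>c. f = (\<lambda>y. c)"]) (auto simp: partial_deriv_const)

lemma smooth_prod: "finite S \<Longrightarrow> (\<And>i. i \<in> S \<Longrightarrow> smooth (f i)) \<Longrightarrow> smooth (\<lambda>y. \<Prod>i\<in>S. f i y)"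
  by (induction S rule: finite_induct) (auto intro: smooth_const smooth_mult)

lemma smooth_partial_deriv: "smooth f \<Longrightarrow> smooth (partial_deriv i f)"
  unfolding smooth_def using Ck.simps(2) by blast

text \<open>For \<open>p = 1\<close> this is the classical function \<open>exp (- 1 / x)\<close> on
  the positive axis, flat at the origin. The polynomial factor in \<open>1 / x\<close> makes the
  family closed under differentiation.\<close>

definition flat :: "real poly \<Rightarrow> real \<Rightarrow> real" where
  "flat p x = (if x \<le> 0 then 0 else poly p (1 / x) * exp (- (1 / x)))"

text \<open>With \<open>t = 1 / x\<close> the derivative of \<open>p(t) exp(-t)\<close> with respect
  to \<open>x\<close> is \<open>t\<^sup>2 (p - p')(t) exp(-t)\<close>.\<close>

definition flat_deriv :: "real poly \<Rightarrow> real poly" where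
  "flat_deriv p = [:0, 0, 1:] * (p - pderiv p)"

lemma poly_times_exp_tendsto_0:
  fixes p :: "real poly"
  shows "((\<lambda>t. poly p t * exp (- t)) \<longlongrightarrow> 0) at_top"
proof -
  have "((\<lambda>t. \<Sum>i\<le>degree p. coeff p i * (t ^ i / exp t)) \<longlongrightarrow> (\<Sum>i\<le>degree p. coeff p i * 0)) at_top"
    by (intro tendsto_sum tendsto_mult tendsto_const tendsto_power_div_exp_0)
  moreover have "poly p t * exp (- t) = (\<Sum>i\<le>degree p. coeff p i * (t ^ i / exp t))" for t
    by (simp add: poly_altdef exp_minus sum_distrib_right field_simps sum_divide_distrib)
  ultimately show ?thesis by simp
qed

text \<open>Only the origin needs an argument: from the right, the difference quotient is again a
  polynomial in \<open>1 / h\<close> times \<open>exp (- 1 / h)\<close>, which tends to 0.\<close>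

lemma flat_has_derivative:
  "(flat p has_field_derivative flat (flat_deriv p) x) (at x)"
proof -
  consider "x < 0" | "x > 0" | "x = 0" by linarith
  then show ?thesis
  proof cases
    case 1
    have "((\<lambda>x. 0) has_field_derivative 0) (at x)" by simp
    then have "(flat p has_field_derivative 0) (at x)"
      by (rule has_field_derivative_transform_within_open[where S = "{..<0}"]) (use 1 in \<open>auto simp: flat_def\<close>)
    then show ?thesis using 1 by (simp add: flat_def)
  next
    case 2
    have "((\<lambda>x. poly p (1 / x) * exp (- (1 / x))) has_field_derivative
        poly (flat_deriv p) (1 / x) * exp (- (1 / x))) (at x)"
      using 2 by (auto intro!: derivative_eq_intros DERIV_chain2[OF poly_DERIV]
          simp: flat_deriv_def power2_eq_square algebra_simps divide_simps)
    then have "(flat p has_field_derivative poly (flat_deriv p) (1 / x) * exp (- (1 / x))) (at x)"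
      by (rule has_field_derivative_transform_within_open[where S = "{0<..}"]) (use 2 in \<open>auto simp: flat_def\<close>)
    then show ?thesis using 2 by (simp add: flat_def)
  next
    case 3
    have "((\<lambda>h. flat p h / h) \<longlongrightarrow> 0) (at_left 0)"
      by (rule Lim_transform_eventually[OF tendsto_const])
         (auto simp: flat_def eventually_at_left[of "-1"] intro!: exI[of _ "-1"])
    moreover have "((\<lambda>h. flat p h / h) \<longlongrightarrow> 0) (at_right 0)"
    proof -
      have "((\<lambda>h. poly (pCons 0 p) (inverse h) * exp (- (inverse h))) \<longlongrightarrow> 0) (at_right (0::real))"
        by (rule filterlim_compose[OF poly_times_exp_tendsto_0 filterlim_inverse_at_top_right])
      then show ?thesis
        by (rule Lim_transform_eventually)
           (auto simp: flat_def eventually_at_right[of _ 1] field_simps intro!: exI[of _ 1])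
    qed
    ultimately have "((\<lambda>h. flat p h / h) \<longlongrightarrow> 0) (at 0)" by (simp add: filterlim_split_at)
    then show ?thesis using 3 by (simp add: DERIV_def flat_def)
  qed
qed

lemma flat_smult: "flat (Polynomial.smult c p) x = c * flat p x"
  by (simp add: flat_def)

lemma smooth_flat: "smooth (\<lambda>y :: real ^ 'n. flat p (s * y $ i + c))"
proof (rule smooth_coinduct[of "\<lambda>f. \<exists>p. f = (\<lambda>y. flat p (s * y $ i + c))"])
  fix f :: "real ^ 'n \<Rightarrow> real" assume "\<exists>p. f = (\<lambda>y. flat p (s * y $ i + c))"
  then obtain p where f: "f = (\<lambda>y. flat p (s * y $ i + c))" by blast
  have d: "(f has_derivative (\<lambda>h. flat (flat_deriv p) (s * y $ i + c) * (s * h $ i))) (at y)" for y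
  proof -
    have "((\<lambda>y :: real ^ 'n. s * y $ i + c) has_derivative (\<lambda>h. s * h $ i)) (at y)"
      by (auto intro!: derivative_eq_intros bounded_linear.has_derivative[OF bounded_linear_vec_nth])
    moreover have "(flat p has_derivative (\<lambda>h. flat (flat_deriv p) (s * y $ i + c) * h)) (at (s * y $ i + c))"
      using flat_has_derivative by (simp add: has_field_derivative_def)
    ultimately show ?thesis unfolding f by (rule has_derivative_compose)
  qed
  have "\<exists>q. partial_deriv j f = (\<lambda>y. flat q (s * y $ i + c))" for j
  proof (intro exI ext)
    fix y
    show "partial_deriv j f y = flat (Polynomial.smult (if j = i then s else 0) (flat_deriv p)) (s * y $ i + c)"
      unfolding flat_smult partial_deriv_eq[OF d] by (simp add: axis_def)
  qed
  moreover have "\<forall>y. f differentiable (at y)" using d differentiableI by blast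
  ultimately show "(\<forall>y. f differentiable (at y)) \<and> (\<forall>j. \<exists>p. partial_deriv j f = (\<lambda>y. flat p (s * y $ i + c)))"
    by blast
qed auto

text \<open>The shift by \<open>1\<close> keeps the support compact in \<open>box a b\<close>.\<close>

definition bump :: "real ^ 'n \<Rightarrow> real ^ 'n \<Rightarrow> real \<Rightarrow> real ^ 'n \<Rightarrow> real" where
  "bump a b m y = (\<Prod>i\<in>UNIV. flat 1 (m * (y $ i - a $ i) - 1) * flat 1 (m * (b $ i - y $ i) - 1))"

lemma flat_1_bounds: "0 \<le> flat 1 x" "flat 1 x \<le> 1"
  by (auto simp: flat_def)

lemma bump_bounds: "0 \<le> bump a b m y" "bump a b m y \<le> 1"
  unfolding bump_def by (auto intro!: prod_nonneg prod_le_1 mult_nonneg_nonneg mult_le_one flat_1_bounds)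

lemma smooth_bump: "smooth (bump a b m)"
proof -
  have "smooth (\<lambda>y. flat 1 (m * (y $ i - a $ i) - 1) * flat 1 (m * (b $ i - y $ i) - 1))" for i
    using smooth_mult[OF smooth_flat[of 1 m i "- m * a $ i - 1"] smooth_flat[of 1 "- m" i "m * b $ i - 1"]]
    by (simp add: algebra_simps)
  then show ?thesis unfolding bump_def[abs_def] by (intro smooth_prod) auto
qed

lemma test_function_bump:
  fixes a b :: "real ^ 'n"
  assumes "box a b \<subseteq> cell" "m > 0"
  shows "test_function (bump a b m)"
proof -
  let ?K = "cbox (\<chi> i. a $ i + 1 / m) (\<chi> i. b $ i - 1 / m)"
  have "?K \<subseteq> box a b"
    using assms(2) by (auto simp: mem_box_cart) (smt (verit) divide_pos_pos)+
  moreover have "bump a b m y = 0" if y: "y \<notin> ?K" for y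
  proof -
    obtain i where "y $ i < a $ i + 1 / m \<or> b $ i - 1 / m < y $ i"
      using y by (auto simp: mem_box_cart not_le)
    then have "flat 1 (m * (y $ i - a $ i) - 1) = 0 \<or> flat 1 (m * (b $ i - y $ i) - 1) = 0"
      using assms(2) by (auto simp: flat_def field_simps)
    then show ?thesis unfolding bump_def by (intro prod_zero) auto
  qed
  ultimately show ?thesis
    unfolding test_function_def using smooth_bump assms(1) by (intro conjI exI[of _ ?K]) auto
qed

lemma flat_1_tendsto:
  assumes "c > 0"
  shows "(\<lambda>k. flat 1 (real (Suc k) * c - 1)) \<longlonglongrightarrow> 1"
proof -
  have top: "filterlim (\<lambda>k. real (Suc k) * c - 1) at_top sequentially"
  proof -
    have "filterlim (\<lambda>k. (- 1) + c * real (Suc k)) at_top sequentially"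
      by (intro filterlim_tendsto_add_at_top[OF tendsto_const] filterlim_tendsto_pos_mult_at_top[OF tendsto_const assms]
          filterlim_compose[OF filterlim_real_sequentially filterlim_Suc])
    then show ?thesis by (simp add: mult.commute)
  qed
  have "(\<lambda>k. exp (- (inverse (real (Suc k) * c - 1)))) \<longlonglongrightarrow> exp (- 0)"
    by (intro tendsto_exp tendsto_minus filterlim_compose[OF tendsto_inverse_0_at_top top] filterlim_ident)
  then have "(\<lambda>k. exp (- (inverse (real (Suc k) * c - 1)))) \<longlonglongrightarrow> 1" by simp
  then show ?thesis
  proof (rule Lim_transform_eventually)
    show "\<forall>\<^sub>F k in sequentially. exp (- inverse (real (Suc k) * c - 1)) = flat 1 (real (Suc k) * c - 1)"
      using top[unfolded filterlim_at_top_dense, rule_format, of 0]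
      by eventually_elim (simp add: flat_def inverse_eq_divide)
  qed
qed

lemma bump_tendsto:
  fixes a b :: "real ^ 'n"
  shows "(\<lambda>k. bump a b (real (Suc k)) y) \<longlonglongrightarrow> indicator (box a b) y"
proof (cases "y \<in> box a b")
  case True
  have "(\<lambda>k. flat 1 (real (Suc k) * (y $ i - a $ i) - 1) * flat 1 (real (Suc k) * (b $ i - y $ i) - 1)) \<longlonglongrightarrow> 1 * 1" for i
    using True by (intro tendsto_mult flat_1_tendsto) (auto simp: mem_box_cart)
  then have "(\<lambda>k. bump a b (real (Suc k)) y) \<longlonglongrightarrow> (\<Prod>i\<in>(UNIV::'n set). 1 * 1)"
    unfolding bump_def by (intro tendsto_prod)
  then show ?thesis using True by simp
next
  case False
  then obtain i where i: "y $ i \<le> a $ i \<or> b $ i \<le> y $ i" by (auto simp: mem_box_cart not_less)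
  have "bump a b (real (Suc k)) y = 0" for k
  proof -
    have "real (Suc k) * (y $ i - a $ i) - 1 \<le> 0 \<or> real (Suc k) * (b $ i - y $ i) - 1 \<le> 0"
      using i mult_nonneg_nonpos[of "real (Suc k)" "y $ i - a $ i"] mult_nonneg_nonpos[of "real (Suc k)" "b $ i - y $ i"]
      by auto
    then have "flat 1 (real (Suc k) * (y $ i - a $ i) - 1) = 0 \<or> flat 1 (real (Suc k) * (b $ i - y $ i) - 1) = 0"
      by (auto simp: flat_def)
    then show ?thesis unfolding bump_def by (intro prod_zero) auto
  qed
  then show ?thesis using False by simp
qed

text \<open>The functions \<open>bump\<close> converge boundedly to the indicator of a box, so by
  dominated convergence the integral of \<open>g\<close> over every box in the cell
  vanishes.\<close>

theorem fundamental_lemma: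
  fixes g :: "real ^ 'n \<Rightarrow> real"
  assumes g: "integrable cellM g" and zero: "\<And>\<phi>. test_function \<phi> \<Longrightarrow> (\<integral>y. g y * \<phi> y \<partial>cellM) = 0"
  shows "AE y in cellM. g y = 0"
proof (rule AE_zero_if_box_integrals_zero[OF g])
  fix a b :: "real ^ 'n" assume ab: "box a b \<subseteq> cell"
  have "(\<lambda>k. \<integral>y. g y * bump a b (real (Suc k)) y \<partial>cellM) \<longlonglongrightarrow> (\<integral>y. g y * indicator (box a b) y \<partial>cellM)"
  proof (rule integral_dominated_convergence[where w = "\<lambda>y. \<bar>g y\<bar>"])
    have m: "bump a b m \<in> borel_measurable cellM" for m
      by (intro continuous_measurable_cellM C1_continuous smooth_C1 smooth_bump)
    show "(\<lambda>y. g y * indicator (box a b) y) \<in> borel_measurable cellM"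
      by (intro borel_measurable_times borel_measurable_integrable[OF g] measurable_restrict_space1 measurable_completion) simp
    show "(\<lambda>y. g y * bump a b (real (Suc k)) y) \<in> borel_measurable cellM" for k
      by (intro borel_measurable_times borel_measurable_integrable g m)
    show "integrable cellM (\<lambda>y. \<bar>g y\<bar>)" using g by simp
    show "AE y in cellM. (\<lambda>k. g y * bump a b (real (Suc k)) y) \<longlonglongrightarrow> g y * indicator (box a b) y"
      by (intro AE_I2 tendsto_mult tendsto_const bump_tendsto)
    show "AE y in cellM. norm (g y * bump a b (real (Suc k)) y) \<le> \<bar>g y\<bar>" for k
      using bump_bounds[of a b "real (Suc k)"] by (auto simp: abs_mult intro!: AE_I2 mult_left_le)
  qed
  moreover have "(\<integral>y. g y * bump a b (real (Suc k)) y \<partial>cellM) = 0" for k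
    by (rule zero[OF test_function_bump[OF ab]]) simp
  ultimately have "(\<lambda>k::nat. 0) \<longlonglongrightarrow> (\<integral>y. g y * indicator (box a b) y \<partial>cellM)"
    by (simp only:)
  then show "(\<integral>y. g y * indicator (box a b) y \<partial>cellM) = 0"
    by (simp add: LIMSEQ_const_iff)
qed


section \<open>Weak gradients and periodic Sobolev functions\<close>

lemma L2_bounded_linear:
  assumes T: "bounded_linear T" and f: "f \<in> L2"
  shows "(\<lambda>y. T (f y)) \<in> L2"
proof -
  obtain K where K: "\<And>x. norm (T x) \<le> norm x * K" using bounded_linear.bounded[OF T] by blast
  show ?thesis
  proof (rule L2_bound)
    show "integrable cellM (\<lambda>y. K\<^sup>2 * (norm (f y))\<^sup>2)" using f by (simp add: L2_def)
    show "(\<lambda>y. T (f y)) \<in> borel_measurable cellM"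
      using L2_measurable[OF f] borel_measurable_continuous_onI[OF linear_continuous_on[OF T]]
      by (rule measurable_compose)
    have "(norm (T (f y)))\<^sup>2 \<le> (norm (f y) * K)\<^sup>2" for y using K by (intro power_mono) auto
    then show "AE y in cellM. (norm (T (f y)))\<^sup>2 \<le> K\<^sup>2 * (norm (f y))\<^sup>2"
      by (simp add: power_mult_distrib mult.commute)
  qed
qed

text \<open>Makes coordinates, trace and transposition bounded operators on classes, so that they
  commute with limits in L2.\<close>

definition l2_map :: "('b::euclidean_space \<Rightarrow> 'c::euclidean_space) \<Rightarrow> ('n::finite, 'b) l2 \<Rightarrow> ('n, 'c) l2" where
  "l2_map T h = l2_of (\<lambda>y. T (rep_l2 h y))"

lemma l2_map_l2_of:
  assumes "bounded_linear T" "f \<in> L2"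
  shows "l2_map T (l2_of f) = l2_of (\<lambda>y. T (f y))"
proof -
  have "AE y in cellM. T (rep_l2 (l2_of f) y) = T (f y)"
    using rep_l2_of[OF assms(2)] by eventually_elim simp
  then show ?thesis
    unfolding l2_map_def
    using l2_of_eq_iff[OF L2_bounded_linear[OF assms(1) rep_l2_mem] L2_bounded_linear[OF assms]] by blast
qed

lemma bounded_linear_l2_map:
  assumes T: "bounded_linear T"
  shows "bounded_linear (l2_map T :: ('n::finite, _) l2 \<Rightarrow> _)"
proof -
  obtain K where K: "0 < K" "\<And>x. norm (T x) \<le> norm x * K" using bounded_linear.pos_bounded[OF T] by blast
  interpret T: bounded_linear T by fact
  have mem: "f \<in> L2 \<Longrightarrow> (\<lambda>y. T (f y)) \<in> L2" for f :: "real ^ 'n \<Rightarrow> _" using L2_bounded_linear[OF T] .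
  show ?thesis
  proof (rule bounded_linear_intro)
    fix h k :: "('n, 'a) l2" and r :: real
    have "l2_map T (l2_of (\<lambda>y. rep_l2 h y + rep_l2 k y)) = l2_of (\<lambda>y. T (rep_l2 h y + rep_l2 k y))"
      by (rule l2_map_l2_of[OF T L2_add[OF rep_l2_mem rep_l2_mem]])
    also have "\<dots> = l2_map T h + l2_map T k"
      by (simp add: T.add l2_of_add mem rep_l2_mem l2_map_def)
    also have "l2_of (\<lambda>y. rep_l2 h y + rep_l2 k y) = h + k" by (simp add: l2_of_add rep_l2_mem)
    finally show "l2_map T (h + k) = l2_map T h + l2_map T k" .
    have "l2_map T (l2_of (\<lambda>y. r *\<^sub>R rep_l2 h y)) = l2_of (\<lambda>y. T (r *\<^sub>R rep_l2 h y))"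
      by (rule l2_map_l2_of[OF T L2_scaleR[OF rep_l2_mem]])
    also have "\<dots> = r *\<^sub>R l2_map T h"
      by (simp add: T.scaleR l2_of_scaleR mem rep_l2_mem l2_map_def)
    also have "l2_of (\<lambda>y. r *\<^sub>R rep_l2 h y) = r *\<^sub>R h" by (simp add: l2_of_scaleR rep_l2_mem)
    finally show "l2_map T (r *\<^sub>R h) = r *\<^sub>R l2_map T h" .
    have "norm (l2_map T h) \<le> L2norm (\<lambda>y. K *\<^sub>R rep_l2 h y)"
      unfolding l2_map_def norm_l2_of[OF mem[OF rep_l2_mem]]
      using K by (intro L2norm_mono mem L2_scaleR rep_l2_mem AE_I2) (auto simp: mult.commute)
    also have "\<dots> = norm h * K"
      using K(1) norm_l2_of[OF rep_l2_mem, of h] by (simp add: L2norm_scaleR rep_l2_mem)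
    finally show "norm (l2_map T h) \<le> norm h * K" .
  qed
qed

lemma l2_of_tendsto_iff:
  assumes "\<And>k. f k \<in> L2" "g \<in> L2"
  shows "(\<lambda>k. l2_of (f k)) \<longlonglongrightarrow> l2_of g \<longleftrightarrow> (\<lambda>k. L2norm (\<lambda>y. f k y - g y)) \<longlonglongrightarrow> 0"
  using assms
  by (subst LIM_zero_iff[symmetric], subst tendsto_norm_zero_iff[symmetric])
     (simp add: norm_l2_of L2_diff flip: l2_of_diff)

lemma L2_nth: "g \<in> L2 \<Longrightarrow> (\<lambda>y. g y $ i) \<in> L2"
  by (rule L2_bounded_linear[OF bounded_linear_vec_nth])

lemma L2_vec:
  fixes w :: "real ^ 'n \<Rightarrow> ('b::euclidean_space) ^ 'm"
  assumes "\<And>i. (\<lambda>y. w y $ i) \<in> L2"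
  shows "w \<in> L2"
proof (rule L2_bound)
  have "(norm (w y))\<^sup>2 = (\<Sum>i\<in>UNIV. (norm (w y $ i))\<^sup>2)" for y
    by (simp add: power2_norm_eq_inner inner_vec_def)
  then show "AE y in cellM. (norm (w y))\<^sup>2 \<le> (\<Sum>i\<in>UNIV. (norm (w y $ i))\<^sup>2)" by simp
  show "integrable cellM (\<lambda>y. \<Sum>i\<in>UNIV. (norm (w y $ i))\<^sup>2)"
    using assms by (intro Bochner_Integration.integrable_sum L2_norm_integrable)
  show "w \<in> borel_measurable cellM"
    unfolding borel_measurable_euclidean_space[of w]
  proof
    fix b :: "'b ^ 'm" assume "b \<in> Basis"
    then obtain i u where b: "b = axis i u" by (auto simp: Basis_vec_def)
    show "(\<lambda>y. w y \<bullet> b) \<in> borel_measurable cellM"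
      unfolding b inner_axis using L2_measurable[OF assms[of i]] by measurable
  qed
qed

lemma L2norm_vec_square:
  fixes w :: "real ^ 'n \<Rightarrow> ('b::euclidean_space) ^ 'm"
  assumes "w \<in> L2"
  shows "(L2norm w)\<^sup>2 = (\<Sum>i\<in>UNIV. (L2norm (\<lambda>y. w y $ i))\<^sup>2)"
proof -
  have "(\<lambda>y. w y $ i) \<in> L2" for i
    using L2_bounded_linear[OF bounded_linear_vec_nth assms] .
  then have "(\<integral>y. (\<Sum>i\<in>UNIV. (norm (w y $ i))\<^sup>2) \<partial>cellM) = (\<Sum>i\<in>UNIV. \<integral>y. (norm (w y $ i))\<^sup>2 \<partial>cellM)"
    by (intro Bochner_Integration.integral_sum L2_norm_integrable)
  then show ?thesis
    unfolding L2norm_square by (simp add: power2_norm_eq_inner inner_vec_def)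
qed

lemma test_function_L2:
  assumes "test_function \<phi>"
  shows "\<phi> \<in> L2" "partial_deriv i \<phi> \<in> L2"
  using assms unfolding test_function_def
  by (auto intro!: continuous_L2 C1_continuous smooth_C1 smooth_partial_deriv)

lemma weak_gradient_L2: "has_weak_gradient v g \<Longrightarrow> g \<in> L2"
  by (simp add: has_weak_gradient_def)

lemma weak_gradient_eq:
  "has_weak_gradient v g \<Longrightarrow> test_function \<phi> \<Longrightarrow>
    (\<integral>y. v y * partial_deriv i \<phi> y \<partial>cellM) = - (\<integral>y. g y $ i * \<phi> y \<partial>cellM)"
  by (simp add: has_weak_gradient_def)

text \<open>By \<open>fundamental_lemma\<close> in each coordinate. This is what makes the choice in
  \<open>wgrad\<close> immaterial up to null sets.\<close>

lemma weak_gradient_unique: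
  assumes "has_weak_gradient v g" "has_weak_gradient v g'"
  shows "AE y in cellM. g y = g' y"
proof -
  have gi: "(\<lambda>y. g y $ i) \<in> L2" "(\<lambda>y. g' y $ i) \<in> L2" for i
    using assms by (auto intro: L2_nth weak_gradient_L2)
  have "AE y in cellM. g y $ i - g' y $ i = 0" for i
  proof (rule fundamental_lemma)
    show "integrable cellM (\<lambda>y. g y $ i - g' y $ i)" by (intro L2_integrable L2_diff gi)
    fix \<phi> :: "real ^ 'a \<Rightarrow> real" assume \<phi>: "test_function \<phi>"
    have "(\<integral>y. (g y $ i - g' y $ i) * \<phi> y \<partial>cellM) = (\<integral>y. g y $ i * \<phi> y \<partial>cellM) - (\<integral>y. g' y $ i * \<phi> y \<partial>cellM)"
      unfolding left_diff_distrib
      by (intro Bochner_Integration.integral_diff L2_mult_integrable gi test_function_L2 \<phi>)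
    also have "\<dots> = 0"
      using weak_gradient_eq[OF assms(1) \<phi>, of i] weak_gradient_eq[OF assms(2) \<phi>, of i] by simp
    finally show "(\<integral>y. (g y $ i - g' y $ i) * \<phi> y \<partial>cellM) = 0" .
  qed
  then have "AE y in cellM. \<forall>i. g y $ i - g' y $ i = 0" by (simp add: AE_all_countable)
  then show ?thesis by eventually_elim (simp add: vec_eq_iff)
qed

lemma wgrad_works: "v \<in> H1 \<Longrightarrow> has_weak_gradient v (wgrad v)"
  unfolding H1_def wgrad_def using someI_ex[of "has_weak_gradient v"] by auto

lemma H1_L2: "v \<in> H1 \<Longrightarrow> v \<in> L2"
  by (simp add: H1_def)

lemma wgrad_L2: "v \<in> H1 \<Longrightarrow> wgrad v \<in> L2"
  by (rule weak_gradient_L2[OF wgrad_works])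

lemma H1I: "v \<in> L2 \<Longrightarrow> has_weak_gradient v g \<Longrightarrow> v \<in> H1"
  by (auto simp: H1_def)

lemma wgrad_AE: "v \<in> L2 \<Longrightarrow> has_weak_gradient v g \<Longrightarrow> AE y in cellM. wgrad v y = g y"
  by (rule weak_gradient_unique[OF wgrad_works[OF H1I]])

lemma has_weak_gradient_add:
  assumes v: "v \<in> L2" "has_weak_gradient v g" and v': "v' \<in> L2" "has_weak_gradient v' g'"
  shows "has_weak_gradient (\<lambda>y. v y + v' y) (\<lambda>y. g y + g' y)"
  unfolding has_weak_gradient_def
proof (intro conjI allI impI)
  have g: "g \<in> L2" "g' \<in> L2" using assms by (auto intro: weak_gradient_L2)
  then show "(\<lambda>y. g y + g' y) \<in> L2" by (rule L2_add)
  fix \<phi> :: "real ^ 'a \<Rightarrow> real" and i assume \<phi>: "test_function \<phi>"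
  note m = L2_mult_integrable[OF _ test_function_L2(1)[OF \<phi>]] L2_mult_integrable[OF _ test_function_L2(2)[OF \<phi>]]
  show "(\<integral>y. (v y + v' y) * partial_deriv i \<phi> y \<partial>cellM) = - (\<integral>y. (g y + g' y) $ i * \<phi> y \<partial>cellM)"
    using weak_gradient_eq[OF v(2) \<phi>, of i] weak_gradient_eq[OF v'(2) \<phi>, of i]
    by (simp add: distrib_right m v v' L2_nth g)
qed

lemma has_weak_gradient_scale:
  assumes "has_weak_gradient v g"
  shows "has_weak_gradient (\<lambda>y. c * v y) (\<lambda>y. c *\<^sub>R g y)"
  using assms by (auto simp: has_weak_gradient_def mult.assoc intro: L2_scaleR)

lemma has_weak_gradient_diff:
  assumes v: "v \<in> L2" "has_weak_gradient v g" and v': "v' \<in> L2" "has_weak_gradient v' g'"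
  shows "has_weak_gradient (\<lambda>y. v y - v' y) (\<lambda>y. g y - g' y)"
  using has_weak_gradient_add[OF v, of "\<lambda>y. (-1) * v' y" "\<lambda>y. (-1) *\<^sub>R g' y"]
    has_weak_gradient_scale[OF v'(2), of "-1"] L2_minus[OF v'(1)] by simp

lemma smooth_periodic_L2: "smooth \<phi> \<Longrightarrow> \<phi> \<in> L2" "smooth \<phi> \<Longrightarrow> grad \<phi> \<in> L2"
  by (auto intro!: continuous_L2 C1_continuous C1_continuous_grad smooth_C1)

lemma smooth_has_weak_gradient:
  assumes "smooth \<phi>" "Y_periodic \<phi>"
  shows "has_weak_gradient \<phi> (grad \<phi>)"
  unfolding has_weak_gradient_def
  using test_function_integration_by_parts[OF smooth_C1 assms(2)] assms smooth_periodic_L2 by auto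

lemma H1norm_bounds: "L2norm v \<le> H1norm v" "L2norm (wgrad v) \<le> H1norm v" "0 \<le> H1norm v"
  unfolding H1norm_def by (auto intro: real_le_rsqrt)

text \<open>The graph of the gradient over the smooth periodic functions. Its closure in the product
  Hilbert space turns out to be the graph of \<open>wgrad\<close> over \<open>H1_per\<close>, see
  \<open>graph_H1_per\<close>.\<close>

definition smooth_graph :: "(('n::finite, real) l2 \<times> ('n, real ^ 'n) l2) set" where
  "smooth_graph = {(l2_of \<phi>, l2_of (grad \<phi>)) |\<phi>. smooth \<phi> \<and> Y_periodic \<phi>}"

lemma subspace_smooth_graph: "subspace (smooth_graph :: (('n::finite, real) l2 \<times> _) set)"
proof (rule subspaceI)
  have g0: "grad (\<lambda>y. 0 :: real) = (\<lambda>y :: real ^ 'n. 0)"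
    by (simp add: fun_eq_iff vec_eq_iff partial_deriv_const)
  then show "0 \<in> (smooth_graph :: (('n, real) l2 \<times> _) set)"
    unfolding smooth_graph_def
    by (auto intro!: exI[of _ "\<lambda>y. 0"] simp: smooth_const Y_periodic_def l2_of_zero zero_prod_def)
next
  fix x y :: "('n, real) l2 \<times> ('n, real ^ 'n) l2" assume "x \<in> smooth_graph" "y \<in> smooth_graph"
  then obtain \<phi> \<psi> where x: "x = (l2_of \<phi>, l2_of (grad \<phi>))" "smooth \<phi>" "Y_periodic \<phi>"
    and y: "y = (l2_of \<psi>, l2_of (grad \<psi>))" "smooth \<psi>" "Y_periodic \<psi>" by (auto simp: smooth_graph_def)
  have "grad (\<lambda>y. \<phi> y + \<psi> y) = (\<lambda>y. grad \<phi> y + grad \<psi> y)"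
    using smooth_C1[OF x(2)] smooth_C1[OF y(2)] by (simp add: fun_eq_iff vec_eq_iff partial_deriv_add)
  then have "x + y = (l2_of (\<lambda>y. \<phi> y + \<psi> y), l2_of (grad (\<lambda>y. \<phi> y + \<psi> y)))"
    using x y by (simp add: l2_of_add smooth_periodic_L2)
  then show "x + y \<in> smooth_graph"
    using x y smooth_add[OF x(2) y(2)] unfolding smooth_graph_def Y_periodic_def by auto
next
  fix c and x :: "('n, real) l2 \<times> ('n, real ^ 'n) l2" assume "x \<in> smooth_graph"
  then obtain \<phi> where x: "x = (l2_of \<phi>, l2_of (grad \<phi>))" "smooth \<phi>" "Y_periodic \<phi>" by (auto simp: smooth_graph_def)
  have "grad (\<lambda>y. c * \<phi> y) = (\<lambda>y. c *\<^sub>R grad \<phi> y)"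
    using smooth_C1[OF x(2)] by (simp add: fun_eq_iff vec_eq_iff partial_deriv_mult partial_deriv_const)
  then have "c *\<^sub>R x = (l2_of (\<lambda>y. c * \<phi> y), l2_of (grad (\<lambda>y. c * \<phi> y)))"
    using x l2_of_scaleR[of \<phi> c] by (simp add: l2_of_scaleR smooth_periodic_L2)
  then show "c *\<^sub>R x \<in> smooth_graph"
    using x smooth_mult[OF smooth_const x(2)] unfolding smooth_graph_def Y_periodic_def by auto
qed

lemma H1_per_closure_graph:
  assumes "v \<in> H1_per"
  shows "(l2_of v, l2_of (wgrad v)) \<in> closure smooth_graph"
proof -
  have v: "v \<in> H1" using assms by (simp add: H1_per_def)
  obtain \<phi> where \<phi>: "\<And>k::nat. smooth (\<phi> k)" "\<And>k. Y_periodic (\<phi> k)" "(\<lambda>k. H1norm (\<lambda>y. \<phi> k y - v y)) \<longlonglongrightarrow> 0"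
    using assms unfolding H1_per_def by blast
  note w = has_weak_gradient_diff[OF smooth_periodic_L2(1)[OF \<phi>(1)] smooth_has_weak_gradient[OF \<phi>(1,2)] H1_L2[OF v] wgrad_works[OF v]]
  have e: "L2norm (wgrad (\<lambda>y. \<phi> k y - v y)) = L2norm (\<lambda>y. grad (\<phi> k) y - wgrad v y)" for k
    using H1I[OF L2_diff[OF smooth_periodic_L2(1)[OF \<phi>(1)] H1_L2[OF v]] w, of k]
    by (intro L2norm_cong_AE wgrad_AE[OF _ w] L2_measurable wgrad_L2 L2_diff smooth_periodic_L2 \<phi> H1_L2 v)
  have "(\<lambda>k. l2_of (\<phi> k)) \<longlonglongrightarrow> l2_of v"
    unfolding l2_of_tendsto_iff[OF smooth_periodic_L2(1)[OF \<phi>(1)] H1_L2[OF v]]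
    by (rule Lim_null_comparison[OF _ \<phi>(3)]) (simp add: H1norm_bounds)
  moreover have "(\<lambda>k. l2_of (grad (\<phi> k))) \<longlonglongrightarrow> l2_of (wgrad v)"
    unfolding l2_of_tendsto_iff[OF smooth_periodic_L2(2)[OF \<phi>(1)] wgrad_L2[OF v]] e[symmetric]
    by (rule Lim_null_comparison[OF _ \<phi>(3)]) (simp add: H1norm_bounds)
  ultimately have "(\<lambda>k. (l2_of (\<phi> k), l2_of (grad (\<phi> k)))) \<longlonglongrightarrow> (l2_of v, l2_of (wgrad v))"
    by (rule tendsto_Pair)
  moreover have "(l2_of (\<phi> k), l2_of (grad (\<phi> k))) \<in> smooth_graph" for k
    using \<phi> by (auto simp: smooth_graph_def)
  ultimately show ?thesis unfolding closure_sequential by (intro exI[of _ "\<lambda>k. (l2_of (\<phi> k), l2_of (grad (\<phi> k)))"]) auto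
qed

text \<open>A weak gradient is characterised by equations between inner products with fixed
  functions, and these survive limits in L2. That \<open>g\<close> is the weak gradient of
  \<open>v\<close> is therefore a conclusion and need not be assumed.\<close>

lemma closure_graph_H1_per:
  fixes v :: "real ^ 'n \<Rightarrow> real"
  assumes "(l2_of v, l2_of g) \<in> closure smooth_graph" and v: "v \<in> L2" and g: "g \<in> L2"
  shows "v \<in> H1_per" "has_weak_gradient v g"
proof -
  obtain p where p: "\<And>k::nat. p k \<in> smooth_graph" "p \<longlonglongrightarrow> (l2_of v, l2_of g)"
    using assms(1) unfolding closure_sequential by blast
  have "\<exists>\<phi>. smooth \<phi> \<and> Y_periodic \<phi> \<and> p k = (l2_of \<phi>, l2_of (grad \<phi>))" for k
    using p(1)[of k] by (auto simp: smooth_graph_def)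
  then obtain \<phi> where \<phi>: "\<And>k. smooth (\<phi> k)" "\<And>k. Y_periodic (\<phi> k)" "\<And>k. p k = (l2_of (\<phi> k), l2_of (grad (\<phi> k)))"
    by metis
  have l1: "(\<lambda>k. l2_of (\<phi> k)) \<longlonglongrightarrow> l2_of v" using tendsto_fst[OF p(2)] by (simp add: \<phi>(3))
  have l2: "(\<lambda>k. l2_of (grad (\<phi> k))) \<longlonglongrightarrow> l2_of g" using tendsto_snd[OF p(2)] by (simp add: \<phi>(3))
  show wg: "has_weak_gradient v g"
    unfolding has_weak_gradient_def
  proof (intro conjI allI impI g)
    fix \<psi> :: "real ^ 'n \<Rightarrow> real" and i assume \<psi>: "test_function \<psi>"
    have lim1: "(\<lambda>k. l2_of (\<phi> k) \<bullet> l2_of (partial_deriv i \<psi>)) \<longlonglongrightarrow> l2_of v \<bullet> l2_of (partial_deriv i \<psi>)"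
      by (intro tendsto_inner l1 tendsto_const)
    have lim2: "(\<lambda>k. l2_map (\<lambda>x. x $ i) (l2_of (grad (\<phi> k))) \<bullet> l2_of \<psi>) \<longlonglongrightarrow> l2_map (\<lambda>x. x $ i) (l2_of g) \<bullet> l2_of \<psi>"
      by (intro tendsto_inner tendsto_const bounded_linear.tendsto[OF bounded_linear_l2_map[OF bounded_linear_vec_nth] l2])
    have "l2_of (\<phi> k) \<bullet> l2_of (partial_deriv i \<psi>) = - (l2_map (\<lambda>x. x $ i) (l2_of (grad (\<phi> k))) \<bullet> l2_of \<psi>)" for k
      using weak_gradient_eq[OF smooth_has_weak_gradient[OF \<phi>(1,2)] \<psi>, of k i]
      by (simp add: l2_map_l2_of bounded_linear_vec_nth inner_l2_of smooth_periodic_L2 \<phi> test_function_L2 \<psi> L2_nth del: grad_nth)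
    with lim1 have "(\<lambda>k. - (l2_map (\<lambda>x. x $ i) (l2_of (grad (\<phi> k))) \<bullet> l2_of \<psi>)) \<longlonglongrightarrow> l2_of v \<bullet> l2_of (partial_deriv i \<psi>)"
      by (simp only:)
    from LIMSEQ_unique[OF this tendsto_minus[OF lim2]]
    have "l2_of v \<bullet> l2_of (partial_deriv i \<psi>) = - (l2_map (\<lambda>x. x $ i) (l2_of g) \<bullet> l2_of \<psi>)" .
    then show "(\<integral>y. v y * partial_deriv i \<psi> y \<partial>cellM) = - (\<integral>y. g y $ i * \<psi> y \<partial>cellM)"
      by (simp add: l2_map_l2_of bounded_linear_vec_nth inner_l2_of v g test_function_L2 \<psi> L2_nth)
  qed
  have vH: "v \<in> H1" using v wg by (rule H1I)
  note w = has_weak_gradient_diff[OF smooth_periodic_L2(1)[OF \<phi>(1)] smooth_has_weak_gradient[OF \<phi>(1,2)] v wg]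
  have e: "L2norm (wgrad (\<lambda>y. \<phi> k y - v y)) = L2norm (\<lambda>y. grad (\<phi> k) y - g y)" for k
    using H1I[OF L2_diff[OF smooth_periodic_L2(1)[OF \<phi>(1)] v] w, of k]
    by (intro L2norm_cong_AE wgrad_AE[OF _ w] L2_measurable wgrad_L2 L2_diff smooth_periodic_L2 \<phi> v g)
  have "(\<lambda>k. sqrt ((L2norm (\<lambda>y. \<phi> k y - v y))\<^sup>2 + (L2norm (\<lambda>y. grad (\<phi> k) y - g y))\<^sup>2)) \<longlonglongrightarrow> sqrt (0\<^sup>2 + 0\<^sup>2)"
    using l1 l2 unfolding l2_of_tendsto_iff[OF smooth_periodic_L2(1)[OF \<phi>(1)] v] l2_of_tendsto_iff[OF smooth_periodic_L2(2)[OF \<phi>(1)] g]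
    by (intro tendsto_intros)
  then have "(\<lambda>k. H1norm (\<lambda>y. \<phi> k y - v y)) \<longlonglongrightarrow> 0" by (simp add: H1norm_def e)
  then show "v \<in> H1_per" using vH \<phi> unfolding H1_per_def by blast
qed

lemma subspace_closure_graph: "subspace (closure (smooth_graph :: (('n::finite, real) l2 \<times> _) set))"
proof (rule subspaceI)
  show "0 \<in> closure (smooth_graph :: (('n, real) l2 \<times> _) set)"
    using subspace_0[OF subspace_smooth_graph] closure_subset by blast
next
  fix x y :: "('n, real) l2 \<times> ('n, real ^ 'n) l2"
  assume "x \<in> closure smooth_graph" "y \<in> closure smooth_graph"
  then obtain p q where "\<And>k::nat. p k \<in> smooth_graph" "p \<longlonglongrightarrow> x" "\<And>k::nat. q k \<in> smooth_graph" "q \<longlonglongrightarrow> y"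
    unfolding closure_sequential by blast
  then show "x + y \<in> closure smooth_graph"
    unfolding closure_sequential
    by (intro exI[of _ "\<lambda>k. p k + q k"]) (auto intro: subspace_add[OF subspace_smooth_graph] tendsto_add)
next
  fix c and x :: "('n, real) l2 \<times> ('n, real ^ 'n) l2"
  assume "x \<in> closure smooth_graph"
  then obtain p where "\<And>k::nat. p k \<in> smooth_graph" "p \<longlonglongrightarrow> x"
    unfolding closure_sequential by blast
  then show "c *\<^sub>R x \<in> closure smooth_graph"
    unfolding closure_sequential
    by (intro exI[of _ "\<lambda>k. c *\<^sub>R p k"]) (auto intro: subspace_scale[OF subspace_smooth_graph] tendsto_scaleR)
qed

section \<open>Linearity of \<open>H1_per\<close> and of the weak gradient\<close>

lemma H1_per_H1: "v \<in> H1_per \<Longrightarrow> v \<in> H1"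
  by (simp add: H1_per_def)

lemma H1_per_L2: "v \<in> H1_per \<Longrightarrow> v \<in> L2"
  by (intro H1_L2 H1_per_H1)

lemma H1_per_wgrad_L2: "v \<in> H1_per \<Longrightarrow> wgrad v \<in> L2"
  by (intro wgrad_L2 H1_per_H1)

lemma smooth_H1_per:
  assumes "smooth \<phi>" "Y_periodic \<phi>"
  shows "\<phi> \<in> H1_per" "AE y in cellM. wgrad \<phi> y = grad \<phi> y"
proof -
  have "(l2_of \<phi>, l2_of (grad \<phi>)) \<in> closure smooth_graph"
    using assms closure_subset[of smooth_graph] by (auto simp: smooth_graph_def)
  then show "\<phi> \<in> H1_per" using closure_graph_H1_per smooth_periodic_L2 assms by blast
  show "AE y in cellM. wgrad \<phi> y = grad \<phi> y"
    by (rule wgrad_AE[OF smooth_periodic_L2(1) smooth_has_weak_gradient]) fact+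
qed

lemma H1_per_add:
  assumes "v \<in> H1_per" "v' \<in> H1_per"
  shows "(\<lambda>y. v y + v' y) \<in> H1_per" "AE y in cellM. wgrad (\<lambda>y. v y + v' y) y = wgrad v y + wgrad v' y"
proof -
  have "(l2_of v, l2_of (wgrad v)) + (l2_of v', l2_of (wgrad v')) \<in> closure smooth_graph"
    by (intro subspace_add subspace_closure_graph H1_per_closure_graph assms)
  then have "(l2_of (\<lambda>y. v y + v' y), l2_of (\<lambda>y. wgrad v y + wgrad v' y)) \<in> closure smooth_graph"
    using assms by (simp add: l2_of_add H1_per_L2 H1_per_wgrad_L2)
  note c = closure_graph_H1_per[OF this L2_add[OF assms[THEN H1_per_L2]] L2_add[OF assms[THEN H1_per_wgrad_L2]]]
  show "(\<lambda>y. v y + v' y) \<in> H1_per" by (rule c)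
  show "AE y in cellM. wgrad (\<lambda>y. v y + v' y) y = wgrad v y + wgrad v' y"
    by (rule wgrad_AE[OF L2_add[OF assms[THEN H1_per_L2]] c(2)])
qed

lemma H1_per_scale:
  assumes "v \<in> H1_per"
  shows "(\<lambda>y. c * v y) \<in> H1_per" "AE y in cellM. wgrad (\<lambda>y. c * v y) y = c *\<^sub>R wgrad v y"
proof -
  have L: "(\<lambda>y. c * v y) \<in> L2" using L2_scaleR[OF H1_per_L2[OF assms], of c] by simp
  have "c *\<^sub>R (l2_of v, l2_of (wgrad v)) \<in> closure smooth_graph"
    by (intro subspace_scale subspace_closure_graph H1_per_closure_graph assms)
  then have "(l2_of (\<lambda>y. c * v y), l2_of (\<lambda>y. c *\<^sub>R wgrad v y)) \<in> closure smooth_graph"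
    using assms l2_of_scaleR[of v c] by (simp add: l2_of_scaleR H1_per_L2 H1_per_wgrad_L2)
  note c = closure_graph_H1_per[OF this L L2_scaleR[OF H1_per_wgrad_L2[OF assms]]]
  show "(\<lambda>y. c * v y) \<in> H1_per" by (rule c)
  show "AE y in cellM. wgrad (\<lambda>y. c * v y) y = c *\<^sub>R wgrad v y"
    by (rule wgrad_AE[OF L c(2)])
qed

lemma H1_per_diff:
  assumes "v \<in> H1_per" "v' \<in> H1_per"
  shows "(\<lambda>y. v y - v' y) \<in> H1_per" "AE y in cellM. wgrad (\<lambda>y. v y - v' y) y = wgrad v y - wgrad v' y"
proof -
  note s = H1_per_scale[OF assms(2), of "-1"] and a = H1_per_add[OF assms(1) H1_per_scale(1)[OF assms(2), of "-1"]]
  show "(\<lambda>y. v y - v' y) \<in> H1_per" using a(1) by simp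
  show "AE y in cellM. wgrad (\<lambda>y. v y - v' y) y = wgrad v y - wgrad v' y"
    using a(2) s(2) by eventually_elim simp
qed

lemma H1_per_0: "(\<lambda>y. 0) \<in> H1_per"
  by (rule smooth_H1_per(1)) (auto simp: smooth_const Y_periodic_def)

text \<open>Density in the form of an induction rule: what is closed under limits of function and
  gradient has to be checked for smooth periodic functions only.\<close>

lemma closure_graph_induct:
  assumes "(h, k) \<in> closure smooth_graph" "closed {(h, k). P h k}"
    "\<And>\<phi>. smooth \<phi> \<Longrightarrow> Y_periodic \<phi> \<Longrightarrow> P (l2_of \<phi>) (l2_of (grad \<phi>))"
  shows "P h k"
proof -
  have "closure smooth_graph \<subseteq> {(h, k). P h k}"
    by (rule closure_minimal[OF _ assms(2)]) (auto simp: smooth_graph_def assms(3))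
  with assms(1) show ?thesis by auto
qed

lemma continuous_on_l2_map:
  assumes "bounded_linear T" "continuous_on S f"
  shows "continuous_on S (\<lambda>x. l2_map T (f x))"
  using bounded_linear.continuous_on[OF bounded_linear_l2_map[OF assms(1)] assms(2)] .

abbreviation nth_l2 :: "'n \<Rightarrow> ('n::finite, real ^ 'n) l2 \<Rightarrow> ('n, real) l2" where
  "nth_l2 i \<equiv> l2_map (\<lambda>x. x $ i)"

text \<open>Two nested density arguments: \<open>v\<close> is made smooth while \<open>v'\<close>
  stays arbitrary, then \<open>v'\<close> is made smooth.\<close>

lemma H1_per_integration_by_parts:
  assumes "v \<in> H1_per" "v' \<in> H1_per"
  shows "(\<integral>y. v y * wgrad v' y $ i \<partial>cellM) = - (\<integral>y. wgrad v y $ i * v' y \<partial>cellM)"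
proof -
  have "h \<bullet> nth_l2 i k' = - (nth_l2 i k \<bullet> h')"
    if h: "(h, k) \<in> closure smooth_graph" and h': "(h', k') \<in> closure smooth_graph" for h k h' k'
    using h
  proof (rule closure_graph_induct)
    show "closed {(h, k). h \<bullet> nth_l2 i k' = - (nth_l2 i k \<bullet> h')}"
      unfolding case_prod_unfold by (intro closed_Collect_eq continuous_intros continuous_on_l2_map bounded_linear_vec_nth)
    fix \<phi> :: "real ^ 'a \<Rightarrow> real" assume \<phi>: "smooth \<phi>" "Y_periodic \<phi>"
    show "l2_of \<phi> \<bullet> nth_l2 i k' = - (nth_l2 i (l2_of (grad \<phi>)) \<bullet> h')"
      using h'
    proof (rule closure_graph_induct)
      show "closed {(h', k'). l2_of \<phi> \<bullet> nth_l2 i k' = - (nth_l2 i (l2_of (grad \<phi>)) \<bullet> h')}"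
        unfolding case_prod_unfold by (intro closed_Collect_eq continuous_intros continuous_on_l2_map bounded_linear_vec_nth)
      fix \<psi> :: "real ^ 'a \<Rightarrow> real" assume \<psi>: "smooth \<psi>" "Y_periodic \<psi>"
      show "l2_of \<phi> \<bullet> nth_l2 i (l2_of (grad \<psi>)) = - (nth_l2 i (l2_of (grad \<phi>)) \<bullet> l2_of \<psi>)"
        using periodic_integration_by_parts[OF smooth_C1[OF \<phi>(1)] \<phi>(2) smooth_C1[OF \<psi>(1)] \<psi>(2), of i]
          L2_nth[OF smooth_periodic_L2(2)[OF \<phi>(1)], of i] L2_nth[OF smooth_periodic_L2(2)[OF \<psi>(1)], of i]
        by (simp add: l2_map_l2_of bounded_linear_vec_nth inner_l2_of smooth_periodic_L2 \<phi> \<psi>)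
    qed
  qed
  from this[OF H1_per_closure_graph H1_per_closure_graph, OF assms]
  show ?thesis using assms
    by (simp add: l2_map_l2_of bounded_linear_vec_nth inner_l2_of H1_per_L2 H1_per_wgrad_L2 L2_nth)
qed

text \<open>Formally a double integration by parts, but second derivatives need not exist here.
  Density carries over \<open>periodic_cross_derivatives\<close>, whose proof does without
  them.\<close>

lemma H1_per_cross_derivatives:
  assumes "v \<in> H1_per" "v' \<in> H1_per"
  shows "(\<integral>y. wgrad v y $ i * wgrad v' y $ j \<partial>cellM) = (\<integral>y. wgrad v y $ j * wgrad v' y $ i \<partial>cellM)"
proof -
  have "nth_l2 i k \<bullet> nth_l2 j k' = nth_l2 j k \<bullet> nth_l2 i k'"
    if h: "(h, k) \<in> closure smooth_graph" and h': "(h', k') \<in> closure smooth_graph" for h k h' k'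
    using h
  proof (rule closure_graph_induct)
    show "closed {(h, k). nth_l2 i k \<bullet> nth_l2 j k' = nth_l2 j k \<bullet> nth_l2 i k'}"
      unfolding case_prod_unfold by (intro closed_Collect_eq continuous_intros continuous_on_l2_map bounded_linear_vec_nth)
    fix \<phi> :: "real ^ 'a \<Rightarrow> real" assume \<phi>: "smooth \<phi>" "Y_periodic \<phi>"
    show "nth_l2 i (l2_of (grad \<phi>)) \<bullet> nth_l2 j k' = nth_l2 j (l2_of (grad \<phi>)) \<bullet> nth_l2 i k'"
      using h'
    proof (rule closure_graph_induct)
      show "closed {(h', k'). nth_l2 i (l2_of (grad \<phi>)) \<bullet> nth_l2 j k' = nth_l2 j (l2_of (grad \<phi>)) \<bullet> nth_l2 i k'}"
        unfolding case_prod_unfold by (intro closed_Collect_eq continuous_intros continuous_on_l2_map bounded_linear_vec_nth)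
      fix \<psi> :: "real ^ 'a \<Rightarrow> real" assume \<psi>: "smooth \<psi>" "Y_periodic \<psi>"
      show "nth_l2 i (l2_of (grad \<phi>)) \<bullet> nth_l2 j (l2_of (grad \<psi>)) = nth_l2 j (l2_of (grad \<phi>)) \<bullet> nth_l2 i (l2_of (grad \<psi>))"
        using periodic_cross_derivatives[OF smooth_C1[OF \<phi>(1)] \<phi>(2) smooth_C1[OF \<psi>(1)] \<psi>(2), of i j]
          L2_nth[OF smooth_periodic_L2(2)[OF \<phi>(1)]] L2_nth[OF smooth_periodic_L2(2)[OF \<psi>(1)]]
        by (simp add: l2_map_l2_of bounded_linear_vec_nth inner_l2_of smooth_periodic_L2 \<phi> \<psi>)
    qed
  qed
  from this[OF H1_per_closure_graph H1_per_closure_graph, OF assms]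
  show ?thesis using assms
    by (simp add: l2_map_l2_of bounded_linear_vec_nth inner_l2_of H1_per_L2 H1_per_wgrad_L2 L2_nth)
qed

lemma Poincare_W_per:
  fixes v :: "real ^ 'n \<Rightarrow> real"
  assumes "v \<in> W_per"
  shows "(L2norm v)\<^sup>2 \<le> real CARD('n) / 16 * (L2norm (wgrad v))\<^sup>2"
proof -
  have v: "v \<in> H1_per" "(\<integral>y. v y \<partial>cellM) = 0" using assms by (auto simp: W_per_def)
  let ?one = "l2_of (\<lambda>y :: real ^ 'n. 1 :: real)"
  \<comment> \<open>Smooth approximations of \<open>v\<close> need not have mean zero. Subtracting
    the squared mean gives an inequality that holds for all of them and on the whole
    closure.\<close>
  have "h \<bullet> h - (h \<bullet> ?one)\<^sup>2 \<le> real CARD('n) / 16 * (k \<bullet> k)" if "(h, k) \<in> closure smooth_graph" for h :: "('n, real) l2" and k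
    using that
  proof (rule closure_graph_induct)
    show "closed {(h, k). h \<bullet> h - (h \<bullet> ?one)\<^sup>2 \<le> real CARD('n) / 16 * (k \<bullet> k)}"
      unfolding case_prod_unfold by (intro closed_Collect_le continuous_intros)
    fix \<phi> :: "real ^ 'n \<Rightarrow> real" assume \<phi>: "smooth \<phi>" "Y_periodic \<phi>"
    define c where "c = (\<integral>y. \<phi> y \<partial>cellM)"
    define \<psi> where "\<psi> y = \<phi> y + (- c)" for y
    have \<psi>: "smooth \<psi>" "Y_periodic \<psi>"
      using \<phi> smooth_add[OF \<phi>(1) smooth_const[of "- c"]] by (auto simp: \<psi>_def[abs_def] Y_periodic_def)
    have int: "integrable cellM \<phi>" "integrable cellM (\<lambda>y. \<phi> y * \<phi> y)"
      using L2_integrable[OF smooth_periodic_L2(1)[OF \<phi>(1)]] L2_mult_integrable[OF smooth_periodic_L2(1)[OF \<phi>(1)] smooth_periodic_L2(1)[OF \<phi>(1)]] by auto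
    have m: "(\<integral>y. \<psi> y \<partial>cellM) = 0" using int by (simp add: \<psi>_def c_def)
    have g: "grad \<psi> y = grad \<phi> y" for y
      using smooth_C1[OF \<phi>(1)] by (simp add: \<psi>_def[abs_def] vec_eq_iff partial_deriv_add partial_deriv_const del: add_uminus_conv_diff)
    have "(\<integral>y. (\<psi> y)\<^sup>2 \<partial>cellM) = (\<integral>y. \<phi> y * \<phi> y - 2 * c * \<phi> y + c\<^sup>2 \<partial>cellM)"
      by (intro Bochner_Integration.integral_cong) (auto simp: \<psi>_def power2_eq_square algebra_simps)
    also have "\<dots> = (\<integral>y. \<phi> y * \<phi> y \<partial>cellM) - 2 * c * c + c\<^sup>2"
      using int by (simp add: c_def)
    finally have "(\<integral>y. \<phi> y * \<phi> y \<partial>cellM) - c\<^sup>2 = (\<integral>y. (\<psi> y)\<^sup>2 \<partial>cellM)" by (simp add: power2_eq_square)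
    also have "\<dots> \<le> real CARD('n) / 16 * (\<integral>y. (norm (grad \<psi> y))\<^sup>2 \<partial>cellM)"
      by (rule Poincare_C1[OF smooth_C1[OF \<psi>(1)] \<psi>(2) m])
    finally show "l2_of \<phi> \<bullet> l2_of \<phi> - (l2_of \<phi> \<bullet> ?one)\<^sup>2 \<le> real CARD('n) / 16 * (l2_of (grad \<phi>) \<bullet> l2_of (grad \<phi>))"
      by (simp add: inner_l2_of smooth_periodic_L2 \<phi> g c_def power2_norm_eq_inner)
  qed
  from this[OF H1_per_closure_graph[OF v(1)]] show ?thesis
    unfolding L2norm_square power2_norm_eq_inner
    using v by (simp add: inner_l2_of H1_per_L2 H1_per_wgrad_L2)
qed


section \<open>Totality of the trigonometric system\<close>

text \<open>A real Fourier mode. The phase covers sine and cosine together, and a derivative only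
  shifts it by \<open>pi / 2\<close>.\<close>

definition wave :: "real ^ 'n \<Rightarrow> real \<Rightarrow> real ^ 'n \<Rightarrow> real" where
  "wave k \<theta> y = cos (2 * pi * (k \<bullet> y) + \<theta>)"

lemma wave_has_derivative:
  "((\<lambda>y. c * wave k \<theta> y) has_derivative (\<lambda>h. (c * wave k (\<theta> + pi / 2) y) * (2 * pi * (k \<bullet> h)))) (at y)"
  unfolding wave_def
  by (auto intro!: derivative_eq_intros simp: cos_add sin_add algebra_simps)

lemma partial_deriv_wave: "partial_deriv i (\<lambda>y. c * wave k \<theta> y) = (\<lambda>y. (c * (2 * pi * k $ i)) * wave k (\<theta> + pi / 2) y)"
proof
  fix y show "partial_deriv i (\<lambda>y. c * wave k \<theta> y) y = (c * (2 * pi * k $ i)) * wave k (\<theta> + pi / 2) y"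
    using partial_deriv_eq[OF wave_has_derivative[of c k \<theta> y], of i] by (simp add: inner_axis)
qed

lemma smooth_scaled_wave: "smooth (\<lambda>y. c * wave k \<theta> y)"
proof (rule smooth_coinduct[of "\<lambda>f. \<exists>c \<theta>. f = (\<lambda>y. c * wave k \<theta> y)"])
  fix f assume "\<exists>c \<theta>. f = (\<lambda>y. c * wave k \<theta> y)"
  then obtain c \<theta> where f: "f = (\<lambda>y. c * wave k \<theta> y)" by blast
  show "(\<forall>y. f differentiable (at y)) \<and> (\<forall>i. \<exists>c \<theta>. partial_deriv i f = (\<lambda>y. c * wave k \<theta> y))"
    unfolding f partial_deriv_wave using differentiableI[OF wave_has_derivative] by blast
qed blast

lemma wave_periodic:
  assumes "\<forall>i. k $ i \<in> \<int>"
  shows "Y_periodic (\<lambda>y. c * wave k \<theta> y)"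
  unfolding Y_periodic_def
proof (intro allI impI)
  fix y m :: "real ^ 'a" assume m: "\<forall>i. m $ i \<in> \<int>"
  have "k \<bullet> m \<in> \<int>" unfolding inner_vec_def using assms m by (auto intro!: Ints_sum)
  then obtain n where n: "k \<bullet> m = of_int n" by (auto elim: Ints_cases)
  have "cos ((2 * pi * (k \<bullet> y) + \<theta>) + (2 * pi) * of_int n) = cos (2 * pi * (k \<bullet> y) + \<theta>)"
    by (simp add: cos_add cos_int_2pin sin_int_2pin del: mult.assoc)
  then show "c * wave k \<theta> (y + m) = c * wave k \<theta> y"
    by (simp add: wave_def inner_add_right n algebra_simps)
qed

inductive trigonometric_polynomial :: "(real ^ 'n \<Rightarrow> real) \<Rightarrow> bool" where
  wave: "(\<forall>i. k $ i \<in> \<int>) \<Longrightarrow> trigonometric_polynomial (\<lambda>y. c * wave k \<theta> y)"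
| add: "trigonometric_polynomial f \<Longrightarrow> trigonometric_polynomial g \<Longrightarrow> trigonometric_polynomial (\<lambda>y. f y + g y)"

lemma trigonometric_polynomial_const: "trigonometric_polynomial (\<lambda>y. c)"
  using trigonometric_polynomial.wave[of 0 c 0] by (simp add: wave_def)

lemma trigonometric_polynomial_sum:
  "finite S \<Longrightarrow> (\<And>i. i \<in> S \<Longrightarrow> trigonometric_polynomial (f i)) \<Longrightarrow> trigonometric_polynomial (\<lambda>y. \<Sum>i\<in>S. f i y)"
  by (induction S rule: finite_induct) (auto intro: trigonometric_polynomial_const trigonometric_polynomial.add)

text \<open>The product of two cosines is a sum of cosines of the difference and of the sum of the
  arguments, and integer frequencies are closed under both.\<close>

lemma trigonometric_polynomial_mult:
  assumes "trigonometric_polynomial f" "trigonometric_polynomial g"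
  shows "trigonometric_polynomial (\<lambda>y. f y * g y)"
  using assms
proof (induction f rule: trigonometric_polynomial.induct)
  case (wave k c \<theta>)
  from wave(2,1) show ?case
  proof (induction g rule: trigonometric_polynomial.induct)
    case (wave l d \<eta>)
    have "c * wave k \<theta> y * (d * wave l \<eta> y) = (c * d / 2) * wave (k - l) (\<theta> - \<eta>) y + (c * d / 2) * wave (k + l) (\<theta> + \<eta>) y" for y
    proof -
      have "2 * (wave k \<theta> y * wave l \<eta> y) = wave (k - l) (\<theta> - \<eta>) y + wave (k + l) (\<theta> + \<eta>) y"
        using cos_times_cos[of "2 * pi * (k \<bullet> y) + \<theta>" "2 * pi * (l \<bullet> y) + \<eta>"]
        by (simp add: wave_def inner_diff_left inner_add_left algebra_simps)
      then have "(c * d / 2) * (2 * (wave k \<theta> y * wave l \<eta> y)) = (c * d / 2) * (wave (k - l) (\<theta> - \<eta>) y + wave (k + l) (\<theta> + \<eta>) y)"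
        by (simp only:)
      then show ?thesis by (simp add: algebra_simps)
    qed
    moreover have "trigonometric_polynomial (\<lambda>y. (c * d / 2) * wave (k - l) (\<theta> - \<eta>) y + (c * d / 2) * wave (k + l) (\<theta> + \<eta>) y)"
      using wave by (intro trigonometric_polynomial.intros) auto
    ultimately show ?case by (simp only:)
  next
    case (add f g)
    then show ?case by (simp add: distrib_left trigonometric_polynomial.add)
  qed
next
  case (add f g)
  then show ?case by (simp add: distrib_right trigonometric_polynomial.add)
qed

text \<open>The shifted cosine of a coordinate is itself a wave, and trigonometric polynomials form
  an algebra.\<close>

lemma polynomial_of_cosines:
  fixes a :: "real ^ 'n"
  assumes "real_polynomial_function P"
  shows "trigonometric_polynomial (\<lambda>y. P (\<chi> i. cos (2 * pi * (y $ i - a $ i))))"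
  using assms
proof (induction P rule: real_polynomial_function.induct)
  case (linear h)
  have "h (\<chi> i. cos (2 * pi * (y $ i - a $ i))) = (\<Sum>i\<in>UNIV. h (axis i 1) * wave (axis i 1) (- 2 * pi * a $ i) y)" for y
  proof -
    interpret h: bounded_linear h by fact
    have "h (\<chi> i. cos (2 * pi * (y $ i - a $ i))) = h (\<Sum>i\<in>UNIV. cos (2 * pi * (y $ i - a $ i)) *\<^sub>R axis i 1)"
      using basis_expansion[of "\<chi> i. cos (2 * pi * (y $ i - a $ i))"] by (simp add: scalar_mult_eq_scaleR)
    then show ?thesis by (simp add: h.sum h.scaleR wave_def inner_axis' algebra_simps)
  qed
  moreover have "trigonometric_polynomial (\<lambda>y. \<Sum>i\<in>UNIV. h (axis i 1) * wave (axis i 1) (- 2 * pi * a $ i) y)"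
    by (intro trigonometric_polynomial_sum trigonometric_polynomial.wave) (auto simp: axis_def)
  ultimately show ?case by (simp only:)
next
  case (const c)
  show ?case by (rule trigonometric_polynomial_const)
next
  case (add f g)
  then show ?case by (intro trigonometric_polynomial.add)
next
  case (mult f g)
  then show ?case by (intro trigonometric_polynomial_mult)
qed

lemma wave_L2: "(\<lambda>y. c * wave k \<theta> y) \<in> L2"
  by (rule smooth_periodic_L2(1)[OF smooth_scaled_wave])

lemma trigonometric_polynomial_L2: "trigonometric_polynomial p \<Longrightarrow> p \<in> L2"
  by (induction rule: trigonometric_polynomial.induct) (auto intro: wave_L2 L2_add)

lemma trigonometric_polynomial_integral_zero:
  assumes F: "F \<in> L2" and zero: "\<And>k \<theta>. \<forall>i. k $ i \<in> \<int> \<Longrightarrow> (\<integral>y. F y * wave k \<theta> y \<partial>cellM) = 0"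
    and p: "trigonometric_polynomial p"
  shows "(\<integral>y. F y * p y \<partial>cellM) = 0"
  using p
proof (induction rule: trigonometric_polynomial.induct)
  case (wave k c \<theta>)
  have "(\<integral>y. F y * (c * wave k \<theta> y) \<partial>cellM) = (\<integral>y. c * (F y * wave k \<theta> y) \<partial>cellM)"
    by (simp add: mult_ac)
  then show ?case using zero[OF wave] by simp
next
  case (add f g)
  then show ?case
    by (simp add: distrib_left L2_mult_integrable[OF F] trigonometric_polynomial_L2)
qed

text \<open>An interval in \<open>[0, 1]\<close> is a superlevel set of a shifted cosine, so boxes in the cell are
  described by the vector of cosines to which Stone-Weierstrass applies.\<close>

lemma interval_superlevel_cos:
  assumes "0 \<le> a" "a < b" "b \<le> 1" "0 < y" "y < 1"
  shows "cos (pi * (b - a)) < cos (2 * pi * (y - (a + b) / 2)) \<longleftrightarrow> a < y \<and> y < b"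
proof -
  define r t where "r = (b - a) / 2" and "t = \<bar>y - (a + b) / 2\<bar>"
  have r: "0 < r" "r \<le> 1/2" and t: "0 \<le> t" "t < 1 - r"
    using assms by (auto simp: r_def t_def abs_if field_simps)
  have iff: "a < y \<and> y < b \<longleftrightarrow> t < r" by (auto simp: t_def r_def abs_if field_simps)
  have c1: "cos (2 * pi * (y - (a + b) / 2)) = cos (2 * pi * t)"
    unfolding t_def by (cases "0 \<le> y - (a + b) / 2") (simp_all add: abs_if, metis cos_minus mult_minus_right minus_diff_eq)
  have c2: "pi * (b - a) = 2 * pi * r" by (simp add: r_def)
  have main: "cos (2 * pi * r) < cos (2 * pi * s) \<longleftrightarrow> s < r" if "0 \<le> s" "s \<le> 1/2" for s
    using that r by (subst cos_mono_less_eq) (auto simp: mult_less_cancel_left_pos)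
  have "cos (2 * pi * r) < cos (2 * pi * t) \<longleftrightarrow> t < r"
  proof (cases "t \<le> 1/2")
    case True
    then show ?thesis using main t(1) by simp
  next
    \<comment> \<open>Past half a period the cosine increases again, so the distance is measured
      from the other side. It is \<open>1 - t\<close>, which still exceeds \<open>r\<close>.\<close>
    case False
    have "cos (2 * pi * t) = cos (2 * pi - 2 * pi * t)" by (simp add: cos_diff)
    also have "\<dots> = cos (2 * pi * (1 - t))" by (simp add: algebra_simps)
    finally show ?thesis using main[of "1 - t"] False r t by auto
  qed
  then show ?thesis by (simp only: c1 c2 iff)
qed

theorem trigonometric_system_total:
  fixes F :: "real ^ 'n \<Rightarrow> real"
  assumes F: "F \<in> L2" and zero: "\<And>k \<theta>. \<forall>i. k $ i \<in> \<int> \<Longrightarrow> (\<integral>y. F y * wave k \<theta> y \<partial>cellM) = 0"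
  shows "AE y in cellM. F y = 0"
proof (rule AE_zero_if_box_integrals_zero[OF L2_integrable[OF F]])
  fix a b :: "real ^ 'n" assume sub: "box a b \<subseteq> cell"
  show "(\<integral>y. F y * indicator (box a b) y \<partial>cellM) = 0"
  proof (cases "box a b = {}")
    case False
    then have ab: "a $ i < b $ i" for i using interval_eq_empty_cart(1)[of a b] by (auto simp: not_le)
    then have ab01: "0 \<le> a $ i" "b $ i \<le> 1" for i
      using sub ab by (auto simp: subset_interval_cart)
    define Q :: "real ^ 'n \<Rightarrow> real ^ 'n" where "Q y = (\<chi> i. cos (2 * pi * (y $ i - ((1/2) *\<^sub>R (a + b)) $ i)))" for y
    \<comment> \<open>Continuous cutoffs that tend to the indicator of the superlevel set as
      \<open>m\<close> grows. For fixed \<open>m\<close> continuity permits uniform approximation by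
      polynomials on the cube that contains all values of \<open>Q\<close>.\<close>
    define \<Psi> :: "nat \<Rightarrow> real ^ 'n \<Rightarrow> real" where
      "\<Psi> m q = (\<Prod>i\<in>UNIV. min 1 (real m * max 0 (q $ i - cos (pi * (b $ i - a $ i)))))" for m q
    have Q: "Q y \<in> cbox (- 1) 1" for y by (auto simp: Q_def mem_box_cart)
    have Qcont: "continuous_on S Q" for S unfolding Q_def by (intro continuous_intros)
    have \<Psi>cont: "continuous_on S (\<Psi> m)" for m S unfolding \<Psi>_def by (intro continuous_intros)
    have \<Psi>b: "0 \<le> \<Psi> m q" "\<Psi> m q \<le> 1" for m q
      unfolding \<Psi>_def by (auto intro!: prod_nonneg prod_le_1)
    have \<Psi>QL2: "(\<lambda>y. \<Psi> m (Q y)) \<in> L2" for m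
      by (intro continuous_L2 continuous_on_compose2[OF \<Psi>cont Qcont]) auto
    have \<Psi>0: "(\<integral>y. F y * \<Psi> m (Q y) \<partial>cellM) = 0" for m
    proof -
      have "\<bar>\<integral>y. F y * \<Psi> m (Q y) \<partial>cellM\<bar> \<le> e * (\<integral>y. \<bar>F y\<bar> \<partial>cellM)" if e: "0 < e" for e
      proof -
        obtain P where P: "real_polynomial_function P" "\<And>q. q \<in> cbox (- 1) 1 \<Longrightarrow> \<bar>\<Psi> m q - P q\<bar> < e"
          using Stone_Weierstrass_real_polynomial_function[OF compact_cbox \<Psi>cont e] by blast
        have trig: "trigonometric_polynomial (\<lambda>y. P (Q y))"
          unfolding Q_def by (rule polynomial_of_cosines[OF P(1)])
        note PL2 = trigonometric_polynomial_L2[OF trig]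
        have "(\<integral>y. F y * \<Psi> m (Q y) \<partial>cellM) = (\<integral>y. F y * \<Psi> m (Q y) \<partial>cellM) - (\<integral>y. F y * P (Q y) \<partial>cellM)"
          using trigonometric_polynomial_integral_zero[OF F zero trig] by simp
        also have "\<dots> = (\<integral>y. F y * (\<Psi> m (Q y) - P (Q y)) \<partial>cellM)"
          unfolding right_diff_distrib
          by (intro Bochner_Integration.integral_diff[symmetric] L2_mult_integrable F \<Psi>QL2 PL2)
        also have "\<bar>\<dots>\<bar> \<le> (\<integral>y. e * \<bar>F y\<bar> \<partial>cellM)"
        proof (rule integral_abs_bound_integral)
          show "integrable cellM (\<lambda>y. F y * (\<Psi> m (Q y) - P (Q y)))"
            by (intro L2_mult_integrable F L2_diff \<Psi>QL2 PL2)
          show "integrable cellM (\<lambda>y. e * \<bar>F y\<bar>)" using L2_integrable[OF F] by simp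
          fix y
          have "\<bar>F y\<bar> * \<bar>\<Psi> m (Q y) - P (Q y)\<bar> \<le> \<bar>F y\<bar> * e"
            using P(2)[OF Q[of y]] by (intro mult_left_mono) auto
          then show "\<bar>F y * (\<Psi> m (Q y) - P (Q y))\<bar> \<le> e * \<bar>F y\<bar>" by (simp add: abs_mult mult.commute)
        qed
        finally show ?thesis by simp
      qed
      note le = this
      have "((\<lambda>e. e * (\<integral>y. \<bar>F y\<bar> \<partial>cellM)) \<longlongrightarrow> 0 * (\<integral>y. \<bar>F y\<bar> \<partial>cellM)) (at_right 0)"
        by (intro tendsto_intros)
      then have "\<bar>\<integral>y. F y * \<Psi> m (Q y) \<partial>cellM\<bar> \<le> 0 * (\<integral>y. \<bar>F y\<bar> \<partial>cellM)"
        by (rule tendsto_lowerbound) (auto simp: eventually_at_right[of 0 1] intro!: exI[of _ 1] le)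
      then show ?thesis by simp
    qed
    have "(\<lambda>m. \<integral>y. F y * \<Psi> m (Q y) \<partial>cellM) \<longlonglongrightarrow> (\<integral>y. F y * indicator (box a b) y \<partial>cellM)"
    proof (rule integral_dominated_convergence[where w = "\<lambda>y. \<bar>F y\<bar>"])
      show "(\<lambda>y. F y * indicator (box a b) y) \<in> borel_measurable cellM"
        by (intro borel_measurable_times L2_measurable[OF F] measurable_restrict_space1 measurable_completion) simp
      show "(\<lambda>y. F y * \<Psi> m (Q y)) \<in> borel_measurable cellM" for m
        by (intro borel_measurable_times L2_measurable[OF F] L2_measurable[OF \<Psi>QL2])
      show "integrable cellM (\<lambda>y. \<bar>F y\<bar>)" using L2_integrable[OF F] by simp
      show "AE y in cellM. norm (F y * \<Psi> m (Q y)) \<le> \<bar>F y\<bar>" for m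
        using \<Psi>b by (auto simp: abs_mult intro!: AE_I2 mult_left_le)
      show "AE y in cellM. (\<lambda>m. F y * \<Psi> m (Q y)) \<longlonglongrightarrow> F y * indicator (box a b) y"
      proof (rule AE_I2, intro tendsto_mult tendsto_const)
        fix y :: "real ^ 'n" assume "y \<in> space cellM"
        then have y: "0 < y $ i" "y $ i < 1" for i by (auto simp: mem_box_cart)
        have iff: "cos (pi * (b $ i - a $ i)) < Q y $ i \<longleftrightarrow> a $ i < y $ i \<and> y $ i < b $ i" for i
          using interval_superlevel_cos[OF ab01(1) ab ab01(2) y] by (simp add: Q_def)
        let ?z = "\<lambda>i. Q y $ i - cos (pi * (b $ i - a $ i))"
        have lim: "(\<lambda>m. min 1 (real m * max 0 (?z i))) \<longlonglongrightarrow> (if 0 < ?z i then 1 else 0)" for i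
        proof (cases "0 < ?z i")
          case True
          obtain N :: nat where "1 / ?z i < real N" using reals_Archimedean2 by blast
          then have "eventually (\<lambda>m. 1 = min 1 (real m * max 0 (?z i))) sequentially"
            using True eventually_ge_at_top[of N]
            by (elim eventually_mono) (auto simp: min_def divide_less_eq intro: antisym order_trans[OF less_imp_le] mult_right_mono)
          then show ?thesis using True by (simp add: tendsto_eventually eventually_mono)
        next
          case False
          then show ?thesis by (simp add: max_absorb1)
        qed
        have "(\<lambda>m. \<Psi> m (Q y)) \<longlonglongrightarrow> (\<Prod>i\<in>UNIV. if 0 < ?z i then 1 else 0)"
          unfolding \<Psi>_def by (intro tendsto_prod lim)
        also have "(\<Prod>i\<in>UNIV. if 0 < ?z i then 1 else 0) = (indicator (box a b) y :: real)"
        proof (cases "y \<in> box a b")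
          case True
          then show ?thesis using iff by (simp add: mem_box_cart)
        next
          case False
          then obtain i where "\<not> 0 < ?z i" using iff by (auto simp: mem_box_cart)
          then have "(\<Prod>i\<in>UNIV. if 0 < ?z i then 1 else (0::real)) = 0" by (intro prod_zero) auto
          then show ?thesis using False by simp
        qed
        finally show "(\<lambda>m. \<Psi> m (Q y)) \<longlonglongrightarrow> indicator (box a b) y" .
      qed
    qed
    then show ?thesis by (simp add: \<Psi>0 LIMSEQ_const_iff)
  qed simp
qed


section \<open>Vector fields\<close>

lemma L2norm_square_inner: "(L2norm f)\<^sup>2 = (\<integral>y. f y \<bullet> f y \<partial>cellM)"
  unfolding L2norm_square power2_norm_eq_inner ..

lemma W_per_H1_per: "v \<in> W_per \<Longrightarrow> v \<in> H1_per"
  by (simp add: W_per_def)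

lemma W_per_vecD: "w \<in> W_per_vec \<Longrightarrow> (\<lambda>y. w y $ i) \<in> W_per"
  by (simp add: W_per_vec_def)

lemma W_per_vec_H1_per: "w \<in> W_per_vec \<Longrightarrow> (\<lambda>y. w y $ i) \<in> H1_per"
  by (intro W_per_H1_per W_per_vecD)

lemma W_per_vec_L2: "w \<in> W_per_vec \<Longrightarrow> w \<in> L2"
  by (intro L2_vec H1_per_L2 W_per_vec_H1_per)

lemma Jac_nth [simp]: "Jac w y $ i = wgrad (\<lambda>z. w z $ i) y"
  by (simp add: Jac_def)

lemma Jac_L2: "w \<in> W_per_vec \<Longrightarrow> Jac w \<in> L2"
  by (rule L2_vec) (simp add: H1_per_wgrad_L2 W_per_vec_H1_per)

lemma Jac_entry_L2: "w \<in> W_per_vec \<Longrightarrow> (\<lambda>y. wgrad (\<lambda>z. w z $ i) y $ j) \<in> L2"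
  by (intro L2_nth H1_per_wgrad_L2 W_per_vec_H1_per)

lemma W_per_diff:
  assumes "v \<in> W_per" "v' \<in> W_per"
  shows "(\<lambda>y. v y - v' y) \<in> W_per"
  using assms H1_per_diff(1)[of v v'] L2_integrable[OF H1_per_L2[OF W_per_H1_per[OF assms(1)]]]
    L2_integrable[OF H1_per_L2[OF W_per_H1_per[OF assms(2)]]]
  by (simp add: W_per_def)

lemma W_per_vec_diff:
  assumes "w \<in> W_per_vec" "w' \<in> W_per_vec"
  shows "(\<lambda>y. w y - w' y) \<in> W_per_vec" "AE y in cellM. Jac (\<lambda>y. w y - w' y) y = Jac w y - Jac w' y"
proof -
  show "(\<lambda>y. w y - w' y) \<in> W_per_vec"
    using W_per_diff[OF W_per_vecD[OF assms(1)] W_per_vecD[OF assms(2)]] by (simp add: W_per_vec_def)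
  have "AE y in cellM. \<forall>i. wgrad (\<lambda>y. w y $ i - w' y $ i) y = wgrad (\<lambda>y. w y $ i) y - wgrad (\<lambda>y. w' y $ i) y"
    using H1_per_diff(2)[OF W_per_vec_H1_per[OF assms(1)] W_per_vec_H1_per[OF assms(2)]] by (simp add: AE_all_countable)
  then show "AE y in cellM. Jac (\<lambda>y. w y - w' y) y = Jac w y - Jac w' y"
    by eventually_elim (simp add: vec_eq_iff[of "Jac _ _"])
qed

lemma Poincare_W_per_vec:
  fixes w :: "real ^ 'n \<Rightarrow> real ^ 'n"
  assumes "w \<in> W_per_vec"
  shows "(L2norm w)\<^sup>2 \<le> real CARD('n) / 16 * (L2norm (Jac w))\<^sup>2"
  unfolding L2norm_vec_square[OF W_per_vec_L2[OF assms]] L2norm_vec_square[OF Jac_L2[OF assms]] sum_distrib_left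
  using Poincare_W_per[OF W_per_vecD[OF assms]] by (intro sum_mono) simp

lemma H1norm_vec_square:
  assumes "w \<in> W_per_vec"
  shows "(H1norm_vec w)\<^sup>2 = (L2norm w)\<^sup>2 + (L2norm (Jac w))\<^sup>2"
proof -
  have "(H1norm_vec w)\<^sup>2 = (\<Sum>i\<in>UNIV. (H1norm (\<lambda>y. w y $ i))\<^sup>2)"
    unfolding H1norm_vec_def by (rule real_sqrt_pow2) (simp add: sum_nonneg)
  also have "\<dots> = (\<Sum>i\<in>UNIV. (L2norm (\<lambda>y. w y $ i))\<^sup>2 + (L2norm (\<lambda>y. Jac w y $ i))\<^sup>2)"
    by (simp add: H1norm_def)
  also have "\<dots> = (L2norm w)\<^sup>2 + (L2norm (Jac w))\<^sup>2"
    by (simp only: sum.distrib L2norm_vec_square[OF W_per_vec_L2[OF assms]] L2norm_vec_square[OF Jac_L2[OF assms]])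
  finally show ?thesis .
qed

lemma divergence_L2: "w \<in> W_per_vec \<Longrightarrow> divergence w \<in> L2"
proof -
  have "bounded_linear (\<lambda>A :: real ^ 'a ^ 'a. \<Sum>i\<in>UNIV. A $ i $ i)"
    by (intro bounded_linear_sum bounded_linear_compose[OF bounded_linear_vec_nth bounded_linear_vec_nth])
  from L2_bounded_linear[OF this Jac_L2] show "w \<in> W_per_vec \<Longrightarrow> divergence w \<in> L2"
    by (simp add: divergence_def[abs_def])
qed

section \<open>Coordinates in dimensions two and three, and the rotation\<close>

lemma UNIV_card_2:
  assumes "CARD('n::{finite,comm_ring_1}) = 2"
  shows "UNIV = {1, 2 :: 'n}" "(1 :: 'n) \<noteq> 2"
proof -
  show ne: "(1 :: 'n) \<noteq> 2" using one_add_one[where 'a = 'n] by (metis add_cancel_left_right zero_neq_one)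
  show "UNIV = {1, 2 :: 'n}" using ne assms by (intro card_subset_eq[symmetric]) auto
qed

lemma UNIV_card_3:
  assumes "CARD('n::{finite,comm_ring_1}) = 3"
  shows "UNIV = {1, 2, 3 :: 'n}" "(1 :: 'n) \<noteq> 2" "(2 :: 'n) \<noteq> 3" "(1 :: 'n) \<noteq> 3"
proof -
  show 12: "(1 :: 'n) \<noteq> 2" using one_add_one[where 'a = 'n] by (metis add_cancel_left_right zero_neq_one)
  have three: "(3 :: 'n) = 2 + 1" by simp
  show 23: "(2 :: 'n) \<noteq> 3" unfolding three by (metis add_cancel_left_right zero_neq_one)
  have "(2 :: 'n) \<noteq> 0"
  proof
    \<comment> \<open>In characteristic two, adding 1 to the third element \<open>x\<close> would
      have to give \<open>0\<close>, \<open>1\<close> or \<open>x\<close>, and each of these is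
      impossible.\<close>
    assume two: "(2 :: 'n) = 0"
    have "card {0, 1 :: 'n} \<noteq> CARD('n)" using assms by simp
    then have "{0, 1 :: 'n} \<noteq> UNIV" by metis
    then obtain x :: 'n where x: "x \<noteq> 0" "x \<noteq> 1" by auto
    have "card {0, 1, x} = CARD('n)" using x assms by auto
    then have U: "UNIV = {0, 1, x}" by (intro card_subset_eq[symmetric]) auto
    have "x + 1 = 0 \<or> x + 1 = 1 \<or> x + 1 = x" using U by blast
    moreover have "x + 1 = 0 \<Longrightarrow> x = 1" using two by (metis add_right_cancel one_add_one)
    ultimately show False using x by auto
  qed
  then show 13: "(1 :: 'n) \<noteq> 3" unfolding three by (metis add_cancel_right_left)
  show "UNIV = {1, 2, 3 :: 'n}" using 12 23 13 assms by (intro card_subset_eq[symmetric]) auto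
qed

text \<open>Each component of the rotation occurs twice, with opposite signs, in the antisymmetric
  matrix. This treats both dimensions at once, so that later arguments never look at
  \<open>rot2\<close> or \<open>rot3\<close>.\<close>

lemma rot_dot_eq:
  fixes w w' :: "real ^ 'n::{finite,comm_ring_1} \<Rightarrow> real ^ 'n::{finite,comm_ring_1}"
  assumes "CARD('n) \<in> {2, 3}"
  shows "rot_dot w w' y = Jac w y \<bullet> (Jac w' y - transpose (Jac w' y))"
proof (cases "CARD('n) = 2")
  case True
  have sum: "(\<Sum>i\<in>UNIV. f i) = f 1 + f 2" for f :: "'n \<Rightarrow> real"
    using UNIV_card_2(2)[OF True] by (simp add: UNIV_card_2(1)[OF True])
  show ?thesis using True
    by (simp add: rot_dot_def rot2_def inner_vec_def transpose_def sum algebra_simps)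
next
  case False
  then have c: "CARD('n) = 3" using assms by auto
  have sum: "(\<Sum>i\<in>UNIV. f i) = f 1 + f 2 + f 3" for f :: "'n \<Rightarrow> real"
    using UNIV_card_3(2-)[OF c] by (simp add: UNIV_card_3(1)[OF c])
  show ?thesis using c
    by (simp add: sum rot_dot_def rot3_def inner_vec_def[of "Jac _ _"] inner_vec_def[of "wgrad _ _"] transpose_def
        inner_vec_def[of "vector _"] sum_3 algebra_simps)
qed

lemma transpose_bounded_linear: "bounded_linear (transpose :: real ^ 'n ^ 'm \<Rightarrow> real ^ 'm ^ 'n)"
proof -
  have "linear (transpose :: real ^ 'n ^ 'm \<Rightarrow> real ^ 'm ^ 'n)"
    by (rule linearI) (simp_all add: transpose_def vec_eq_iff)
  then show ?thesis by (rule linear_conv_bounded_linear[THEN iffD1])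
qed

text \<open>Exchanging the indices of differentiation turns each product of the entries
  \<open>i j\<close> and \<open>j i\<close> into a product of two diagonal entries, and these sum to
  the product of the divergences.\<close>

lemma integral_Jac_transpose:
  fixes w w' :: "real ^ 'n \<Rightarrow> real ^ 'n"
  assumes w: "w \<in> W_per_vec" and w': "w' \<in> W_per_vec"
  shows "(\<integral>y. Jac w y \<bullet> transpose (Jac w' y) \<partial>cellM) = (\<integral>y. divergence w y * divergence w' y \<partial>cellM)"
proof -
  let ?d = "\<lambda>w i j y. wgrad (\<lambda>z. w z $ i) y $ j"
  have int: "integrable cellM (\<lambda>y. ?d w i j y * ?d w' k l y)" for i j k l
    by (intro L2_mult_integrable Jac_entry_L2 w w')
  have "(\<integral>y. Jac w y \<bullet> transpose (Jac w' y) \<partial>cellM) = (\<integral>y. (\<Sum>i\<in>UNIV. \<Sum>j\<in>UNIV. ?d w i j y * ?d w' j i y) \<partial>cellM)"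
    by (simp add: inner_vec_def transpose_def)
  also have "\<dots> = (\<Sum>i\<in>UNIV. \<Sum>j\<in>UNIV. \<integral>y. ?d w i j y * ?d w' j i y \<partial>cellM)"
    using int by (simp add: Bochner_Integration.integrable_sum)
  also have "\<dots> = (\<Sum>i\<in>UNIV. \<Sum>j\<in>UNIV. \<integral>y. ?d w i i y * ?d w' j j y \<partial>cellM)"
    by (intro sum.cong refl H1_per_cross_derivatives W_per_vec_H1_per w w')
  also have "\<dots> = (\<integral>y. (\<Sum>i\<in>UNIV. \<Sum>j\<in>UNIV. ?d w i i y * ?d w' j j y) \<partial>cellM)"
    using int by (simp add: Bochner_Integration.integrable_sum)
  also have "\<dots> = (\<integral>y. divergence w y * divergence w' y \<partial>cellM)"
    by (simp add: divergence_def sum_product)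
  finally show ?thesis .
qed

lemma L2_transpose:
  fixes A :: "real ^ 'n \<Rightarrow> real ^ 'm ^ 'k"
  shows "A \<in> L2 \<Longrightarrow> (\<lambda>y. transpose (A y)) \<in> L2"
  by (rule L2_bounded_linear[OF transpose_bounded_linear])

lemma rot_dot_integral:
  fixes w w' :: "real ^ 'n::{finite,comm_ring_1} \<Rightarrow> real ^ 'n::{finite,comm_ring_1}"
  assumes "CARD('n) \<in> {2, 3}" "w \<in> W_per_vec" "w' \<in> W_per_vec"
  shows "(\<integral>y. rot_dot w w' y \<partial>cellM) = (\<integral>y. Jac w y \<bullet> Jac w' y \<partial>cellM) - (\<integral>y. divergence w y * divergence w' y \<partial>cellM)"
  unfolding rot_dot_eq[OF assms(1)] inner_diff_right integral_Jac_transpose[OF assms(2,3), symmetric]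
  by (intro Bochner_Integration.integral_diff L2_inner_integrable L2_transpose Jac_L2 assms)

lemma div_rot_identity:
  fixes w :: "real ^ 'n::{finite,comm_ring_1} \<Rightarrow> real ^ 'n::{finite,comm_ring_1}"
  assumes "CARD('n) \<in> {2, 3}" "w \<in> W_per_vec"
  shows "(\<integral>y. rot_dot w w y \<partial>cellM) + (L2norm (divergence w))\<^sup>2 = (L2norm (Jac w))\<^sup>2"
  unfolding rot_dot_integral[OF assms assms(2)] L2norm_square_inner by simp

lemma integral_times_divergence:
  fixes w :: "real ^ 'n \<Rightarrow> real ^ 'n"
  assumes u: "u \<in> H1_per" and w: "w \<in> W_per_vec"
  shows "(\<integral>y. u y * divergence w y \<partial>cellM) = - (\<integral>y. wgrad u y \<bullet> w y \<partial>cellM)"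
proof -
  have wi: "(\<lambda>y. w y $ i) \<in> H1_per" for i using w by (rule W_per_vec_H1_per)
  have "(\<integral>y. u y * divergence w y \<partial>cellM) = (\<integral>y. (\<Sum>i\<in>UNIV. u y * wgrad (\<lambda>z. w z $ i) y $ i) \<partial>cellM)"
    by (simp add: divergence_def sum_distrib_left)
  also have "\<dots> = (\<Sum>i\<in>UNIV. \<integral>y. u y * wgrad (\<lambda>z. w z $ i) y $ i \<partial>cellM)"
    by (intro Bochner_Integration.integral_sum L2_mult_integrable H1_per_L2 u Jac_entry_L2 w)
  also have "\<dots> = (\<Sum>i\<in>UNIV. - (\<integral>y. wgrad u y $ i * w y $ i \<partial>cellM))"
    by (intro sum.cong refl H1_per_integration_by_parts u wi)
  also have "\<dots> = - (\<integral>y. (\<Sum>i\<in>UNIV. wgrad u y $ i * w y $ i) \<partial>cellM)"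
    by (subst Bochner_Integration.integral_sum)
       (auto simp: sum_negf intro!: L2_mult_integrable L2_nth[OF H1_per_wgrad_L2[OF u]] H1_per_L2[OF wi])
  also have "\<dots> = - (\<integral>y. wgrad u y \<bullet> w y \<partial>cellM)" by (simp add: inner_vec_def)
  finally show ?thesis .
qed

lemma L_op_L2: "w \<in> W_per_vec \<Longrightarrow> u \<in> H1_per \<Longrightarrow> L_op lam (w, u) \<in> L2"
  unfolding L_op_def
  using L2_add[OF L2_minus[OF divergence_L2] L2_scaleR[OF H1_per_L2], of w u lam] by simp

text \<open>Integration by parts turns the mixed term into \<open>2 * lam\<close> times the integral
  of \<open>\<nabla>u \<bullet> w\<close>. If \<open>w\<close> were \<open>\<nabla>u\<close>, this
  would be the gradient term of \<open>triple_norm\<close>; the deviation is penalised by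
  \<open>sigma2\<close>.\<close>

lemma L_op_square:
  fixes w :: "real ^ 'n \<Rightarrow> real ^ 'n"
  assumes w: "w \<in> W_per_vec" and u: "u \<in> H1_per"
  shows "(L2norm (L_op lam (w, u)))\<^sup>2 = (L2norm (divergence w))\<^sup>2 + 2 * lam * (\<integral>y. wgrad u y \<bullet> w y \<partial>cellM) + lam\<^sup>2 * (L2norm u)\<^sup>2"
proof -
  note d = divergence_L2[OF w] and uL = H1_per_L2[OF u]
  have "(L2norm (L_op lam (w, u)))\<^sup>2 = (\<integral>y. (divergence w y * divergence w y - (2 * lam) * (u y * divergence w y)) + lam\<^sup>2 * (u y * u y) \<partial>cellM)"
    unfolding L2norm_square L_op_def by (intro Bochner_Integration.integral_cong refl) (simp add: power2_eq_square algebra_simps)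
  also have "\<dots> = (\<integral>y. divergence w y * divergence w y \<partial>cellM) - (2 * lam) * (\<integral>y. u y * divergence w y \<partial>cellM) + lam\<^sup>2 * (\<integral>y. u y * u y \<partial>cellM)"
    using L2_mult_integrable[OF d d] L2_mult_integrable[OF uL d] L2_mult_integrable[OF uL uL] by simp
  finally show ?thesis
    by (simp add: L2norm_square_inner integral_times_divergence[OF u w])
qed


section \<open>Mixed problems with a strongly monotone operator\<close>

text \<open>\<open>B m\<close> represents the constraint functional of \<open>m\<close>. Its
  coercivity on \<open>Q\<close>, together with \<open>Q \<subseteq> S\<close>, takes the place of
  an inf-sup condition: the multiplier and the correction that moves an element of \<open>S\<close>
  into the kernel \<open>Z\<close> both solve problems posed on \<open>Q\<close>. For the
  correction, the adjoint \<open>C\<close> supplies the right-hand side.\<close>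

lemma mixed_problem_solution:
  fixes S Q :: "'h::{real_inner, complete_space} set" and T B C :: "'h \<Rightarrow> 'h"
  assumes S: "subspace S" "closed S" and Q: "subspace Q" "closed Q" "Q \<subseteq> S"
    and lip: "0 \<le> L" "\<And>x y k. x \<in> S \<Longrightarrow> y \<in> S \<Longrightarrow> k \<in> S \<Longrightarrow> \<bar>(T x - T y) \<bullet> k\<bar> \<le> L * norm (x - y) * norm k"
    and mono: "0 < c" "\<And>x y. x \<in> S \<Longrightarrow> y \<in> S \<Longrightarrow> c * (norm (x - y))\<^sup>2 \<le> (T x - T y) \<bullet> (x - y)"
    and B: "bounded_linear B" and adj: "\<And>m z. B m \<bullet> z = m \<bullet> C z"
    and sym: "\<And>m m'. m \<in> Q \<Longrightarrow> m' \<in> Q \<Longrightarrow> B m \<bullet> m' = B m' \<bullet> m"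
    and coercive: "0 < d" "\<And>m. m \<in> Q \<Longrightarrow> d * (norm m)\<^sup>2 \<le> B m \<bullet> m"
  shows "\<exists>m\<in>Q. \<exists>x\<in>S. (\<forall>z\<in>S. T x \<bullet> z + B m \<bullet> z = 0) \<and> (\<forall>m'\<in>Q. B m' \<bullet> x = 0)"
proof -
  interpret B: bounded_linear B by fact
  define Z where "Z = {z \<in> S. \<forall>m'\<in>Q. B m' \<bullet> z = 0}"
  have Zsub: "subspace Z"
    using S(1) by (auto simp: Z_def subspace_def inner_add_right)
  have "Z = S \<inter> (\<Inter>m'\<in>Q. {z. B m' \<bullet> z = 0})" by (auto simp: Z_def)
  moreover have "closed {z. B m' \<bullet> z = 0}" for m' by (intro closed_Collect_eq continuous_intros)
  ultimately have Zclosed: "closed Z" using S(2) by auto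
  have ZS: "Z \<subseteq> S" by (auto simp: Z_def)
  have "\<exists>x\<in>Z. \<forall>z\<in>Z. T x \<bullet> z = 0"
    by (rule strongly_monotone_variational_solution[OF Zsub Zclosed lip(1) _ mono(1)])
       (intro lip(2) mono(2) subsetD[OF ZS]; assumption)+
  then obtain x where x: "x \<in> Z" "\<And>z. z \<in> Z \<Longrightarrow> T x \<bullet> z = 0" by blast
  have solve: "\<exists>p\<in>Q. \<forall>m'\<in>Q. (B p + g) \<bullet> m' = 0" for g
  proof (rule strongly_monotone_variational_solution[OF Q(1,2), of "onorm B" "\<lambda>p. B p + g" d])
    show "\<bar>(B p + g - (B q + g)) \<bullet> k\<bar> \<le> onorm B * norm (p - q) * norm k" for p q k
    proof -
      have "\<bar>B (p - q) \<bullet> k\<bar> \<le> norm (B (p - q)) * norm k" by (rule Cauchy_Schwarz_ineq2)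
      also have "\<dots> \<le> onorm B * norm (p - q) * norm k" by (intro mult_right_mono onorm[OF B]) simp
      finally show ?thesis by (simp add: B.diff)
    qed
    show "d * (norm (p - q))\<^sup>2 \<le> (B p + g - (B q + g)) \<bullet> (p - q)" if "p \<in> Q" "q \<in> Q" for p q
      using coercive(2)[OF subspace_diff[OF Q(1) that]] by (simp add: B.diff)
  qed (fact onorm_pos_le[OF B] coercive)+
  obtain m where m: "m \<in> Q" "\<And>m'. m' \<in> Q \<Longrightarrow> (B m + T x) \<bullet> m' = 0" using solve by blast
  have "T x \<bullet> z + B m \<bullet> z = 0" if z: "z \<in> S" for z
  proof -
    obtain p where p: "p \<in> Q" "\<And>m'. m' \<in> Q \<Longrightarrow> (B p + (- C z)) \<bullet> m' = 0" using solve by blast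
    have "B m' \<bullet> (z - p) = 0" if "m' \<in> Q" for m'
      using p(2)[OF that] sym[OF p(1) that] adj[of m' z]
      by (simp add: inner_diff_left inner_diff_right inner_commute)
    then have zp: "z - p \<in> Z" using z p(1) Q(3) S(1) by (auto simp: Z_def intro: subspace_diff)
    have "T x \<bullet> z + B m \<bullet> z = T x \<bullet> (z - p) + B m \<bullet> (z - p) + (B m + T x) \<bullet> p"
      by (simp add: inner_diff_right inner_add_left)
    also have "\<dots> = 0" using x(2)[OF zp] zp m p(1) by (simp add: Z_def)
    finally show ?thesis .
  qed
  then show ?thesis using m(1) x(1) by (auto simp: Z_def)
qed

text \<open>On the difference of two solutions both multiplier terms vanish by the constraint, so
  monotonicity gives \<open>x = x'\<close>. Then \<open>m - m'\<close> is itself an admissible test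
  element, and coercivity gives \<open>m = m'\<close>.\<close>

lemma mixed_problem_unique:
  fixes S Q :: "'h::real_inner set" and T B :: "'h \<Rightarrow> 'h"
  assumes S: "subspace S" and Q: "subspace Q" "Q \<subseteq> S"
    and mono: "0 < c" "\<And>x y. x \<in> S \<Longrightarrow> y \<in> S \<Longrightarrow> c * (norm (x - y))\<^sup>2 \<le> (T x - T y) \<bullet> (x - y)"
    and B: "bounded_linear B"
    and coercive: "0 < d" "\<And>m. m \<in> Q \<Longrightarrow> d * (norm m)\<^sup>2 \<le> B m \<bullet> m"
    and m: "m \<in> Q" "x \<in> S" "\<And>z. z \<in> S \<Longrightarrow> T x \<bullet> z + B m \<bullet> z = 0" "\<And>m'. m' \<in> Q \<Longrightarrow> B m' \<bullet> x = 0"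
    and m': "m' \<in> Q" "x' \<in> S" "\<And>z. z \<in> S \<Longrightarrow> T x' \<bullet> z + B m' \<bullet> z = 0" "\<And>m''. m'' \<in> Q \<Longrightarrow> B m'' \<bullet> x' = 0"
  shows "m = m' \<and> x = x'"
proof -
  interpret B: bounded_linear B by fact
  have d: "x - x' \<in> S" using S m(2) m'(2) by (rule subspace_diff)
  have "c * (norm (x - x'))\<^sup>2 \<le> (T x - T x') \<bullet> (x - x')" by (rule mono(2)[OF m(2) m'(2)])
  also have "\<dots> = - (B m \<bullet> (x - x')) + B m' \<bullet> (x - x')"
    using m(3)[OF d] m'(3)[OF d] by (simp add: inner_diff_left)
  also have "\<dots> = 0"
    using m(4)[OF m(1)] m(4)[OF m'(1)] m'(4)[OF m(1)] m'(4)[OF m'(1)] by (simp add: inner_diff_right)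
  finally have xx: "x = x'" using mono(1) by (simp add: mult_le_0_iff)
  have mm: "m - m' \<in> Q" using Q(1) m(1) m'(1) by (rule subspace_diff)
  then have "B (m - m') \<bullet> (m - m') = 0"
    using m(3)[of "m - m'"] m'(3)[of "m - m'"] Q(2) xx by (simp add: B.diff inner_diff_left subset_iff)
  then have "m = m'" using coercive(2)[OF mm] coercive(1) by (simp add: mult_le_0_iff)
  with xx show ?thesis by simp
qed


section \<open>The renormalized operator under the Cordes condition\<close>

lemma inner_mat_1: "mat 1 \<bullet> (P :: real ^ 'n ^ 'n) = trace P"
proof -
  have "(mat 1 $ i) \<bullet> (P $ i) = P $ i $ i" for i
    by (simp add: mat_def inner_vec_def if_distrib[of "\<lambda>x. x * _"] cong: if_cong)
  then show ?thesis by (simp add: inner_vec_def[of "mat 1"] trace_def)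
qed

lemma Cauchy_Schwarz_3:
  fixes a a' :: "'a::real_inner" and b b' :: "'b::real_inner" and c c' :: "'c::real_inner"
  shows "\<bar>a \<bullet> a' + b \<bullet> b' + c \<bullet> c'\<bar>
    \<le> sqrt ((norm a)\<^sup>2 + (norm b)\<^sup>2 + (norm c)\<^sup>2) * sqrt ((norm a')\<^sup>2 + (norm b')\<^sup>2 + (norm c')\<^sup>2)"
  using Cauchy_Schwarz_ineq2[of "(a, b, c)" "(a', b', c')"]
  by (simp add: norm_eq_sqrt_inner add.assoc)

text \<open>Unlike \<open>real ^ 'n\<close>, these types leave the sort of \<open>'n\<close> to the locale below.\<close>

type_synonym 'n rvec = "(real, 'n) vec"
type_synonym 'n rmat = "((real, 'n) vec, 'n) vec"

locale Cordes_coefficients =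
  fixes A :: "real ^ 'n::{finite,comm_ring_1} \<Rightarrow> 'l::metric_space \<Rightarrow> real ^ 'n::{finite,comm_ring_1} ^ 'n::{finite,comm_ring_1}"
    and b :: "real ^ 'n::{finite,comm_ring_1} \<Rightarrow> 'l \<Rightarrow> real ^ 'n::{finite,comm_ring_1}"
    and c f :: "real ^ 'n::{finite,comm_ring_1} \<Rightarrow> 'l \<Rightarrow> real"
    and lam \<delta> :: real
  assumes dim: "CARD('n) \<in> {2, 3}"
    and Lambda_compact: "compact (UNIV :: 'l set)"
    and A_cont: "uniformly_continuous_on UNIV (\<lambda>(y, \<alpha>). A y \<alpha>)"
    and b_cont: "uniformly_continuous_on UNIV (\<lambda>(y, \<alpha>). b y \<alpha>)"
    and c_cont: "uniformly_continuous_on UNIV (\<lambda>(y, \<alpha>). c y \<alpha>)"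
    and f_cont: "uniformly_continuous_on UNIV (\<lambda>(y, \<alpha>). f y \<alpha>)"
    and c_pos: "\<And>y \<alpha>. 0 < c y \<alpha>"
    and lam_pos: "lam > 0"
    and delta: "0 < \<delta>" "\<delta> < 1"
    and Cordes: "\<And>y \<alpha>. (norm (A y \<alpha>))\<^sup>2 + (norm (b y \<alpha>))\<^sup>2 / (2 * lam) + (c y \<alpha>)\<^sup>2 / lam\<^sup>2
                   \<le> 1 / (real CARD('n) + \<delta>) * (trace (A y \<alpha>) + c y \<alpha> / lam)\<^sup>2"
begin

abbreviation "gam \<equiv> gamma_coeff lam A b c"

text \<open>Pointwise counterpart of \<open>triple_norm\<close>, with \<open>P\<close>,
  \<open>p\<close>, \<open>s\<close> in the places of \<open>Dw\<close>, \<open>\<nabla>u\<close>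
  and \<open>u\<close>.\<close>

definition nrm :: "'n rmat \<Rightarrow> 'n rvec \<Rightarrow> real \<Rightarrow> real" where
  "nrm P p s = sqrt ((norm P)\<^sup>2 + 2 * lam * (norm p)\<^sup>2 + lam\<^sup>2 * s\<^sup>2)"

definition affine :: "'n rvec \<Rightarrow> 'l \<Rightarrow> 'n rmat \<Rightarrow> 'n rvec \<Rightarrow> real \<Rightarrow> real" where
  "affine y \<alpha> P p s = gam y \<alpha> * (- (A y \<alpha> \<bullet> P) - b y \<alpha> \<bullet> p + c y \<alpha> * s - f y \<alpha>)"

definition Fpt :: "'n rvec \<Rightarrow> 'n rmat \<Rightarrow> 'n rvec \<Rightarrow> real \<Rightarrow> real" where
  "Fpt y P p s = (SUP \<alpha>. affine y \<alpha> P p s)"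

lemma F_gamma_eq: "F_gamma lam A b c f (w, u) y = Fpt y (Jac w y) (wgrad u y) (u y)"
  by (simp add: F_gamma_def Fpt_def affine_def)

definition dens :: "'n rvec \<Rightarrow> 'l \<Rightarrow> real" where
  "dens y \<alpha> = (norm (A y \<alpha>))\<^sup>2 + (norm (b y \<alpha>))\<^sup>2 / (2 * lam) + (c y \<alpha>)\<^sup>2 / lam\<^sup>2"

lemma dens_pos: "0 < dens y \<alpha>"
  unfolding dens_def using c_pos[of y \<alpha>] lam_pos by (intro add_nonneg_pos) auto

lemma gam_eq: "gam y \<alpha> = (trace (A y \<alpha>) + c y \<alpha> / lam) / dens y \<alpha>"
  unfolding gamma_coeff_def dens_def divide_inverse by (rule mult.commute)

text \<open>Cauchy-Schwarz in scaled variables, in which one factor is \<open>nrm P p s\<close>. The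
  other is the distance of the triple \<open>(mat 1, 0, 1)\<close> to the multiple \<open>g\<close>
  of the scaled coefficients. The factor \<open>gam\<close> is the \<open>g\<close> that minimises
  this distance; the minimal square is \<open>n + 1 - S\<^sup>2 / dens\<close>, and the Cordes
  condition bounds it by \<open>1 - \<delta>\<close>.\<close>

lemma Cordes_pointwise:
  "\<bar>gam y \<alpha> * (- (A y \<alpha> \<bullet> P) - b y \<alpha> \<bullet> p + c y \<alpha> * s) - (lam * s - trace P)\<bar> \<le> sqrt (1 - \<delta>) * nrm P p s"
proof -
  define g S where "g = gam y \<alpha>" and "S = trace (A y \<alpha>) + c y \<alpha> / lam"
  define X1 X2 X3 where "X1 = mat 1 - g *\<^sub>R A y \<alpha>" and "X2 = - (g / sqrt (2 * lam)) *\<^sub>R b y \<alpha>" and "X3 = g * c y \<alpha> / lam - 1"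
  have sl: "sqrt (2 * lam) > 0" "(sqrt (2 * lam))\<^sup>2 = 2 * lam" using lam_pos by auto
  have e: "g * (- (A y \<alpha> \<bullet> P) - b y \<alpha> \<bullet> p + c y \<alpha> * s) - (lam * s - trace P) = X1 \<bullet> P + X2 \<bullet> (sqrt (2 * lam) *\<^sub>R p) + X3 \<bullet> (lam * s)"
    using sl lam_pos by (simp add: X1_def X2_def X3_def inner_diff_left inner_mat_1 field_simps)
  have CS: "\<bar>X1 \<bullet> P + X2 \<bullet> (sqrt (2 * lam) *\<^sub>R p) + X3 \<bullet> (lam * s)\<bar>
      \<le> sqrt ((norm X1)\<^sup>2 + (norm X2)\<^sup>2 + (norm X3)\<^sup>2) * sqrt ((norm P)\<^sup>2 + (norm (sqrt (2 * lam) *\<^sub>R p))\<^sup>2 + (norm (lam * s))\<^sup>2)"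
    by (rule Cauchy_Schwarz_3)
  have nP: "sqrt ((norm P)\<^sup>2 + (norm (sqrt (2 * lam) *\<^sub>R p))\<^sup>2 + (norm (lam * s))\<^sup>2) = nrm P p s"
    using lam_pos by (simp add: nrm_def power_mult_distrib)
  have X: "(norm X1)\<^sup>2 + (norm X2)\<^sup>2 + (norm X3)\<^sup>2 \<le> 1 - \<delta>"
  proof -
    have tr1: "trace (mat 1 :: 'n rmat) = real CARD('n)" by (simp add: trace_def mat_def)
    have n1: "(norm X1)\<^sup>2 = real CARD('n) - 2 * g * trace (A y \<alpha>) + g\<^sup>2 * (norm (A y \<alpha>))\<^sup>2"
      unfolding X1_def power2_norm_eq_inner inner_diff_left inner_diff_right inner_scaleR_left inner_scaleR_right
        inner_commute[of "A y \<alpha>" "mat 1"] inner_mat_1 tr1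
      by (simp add: power2_eq_square algebra_simps)
    have n2: "(norm X2)\<^sup>2 = g\<^sup>2 * ((norm (b y \<alpha>))\<^sup>2 / (2 * lam))"
      using sl by (simp add: X2_def power_mult_distrib power_divide)
    have n3: "(norm X3)\<^sup>2 = g\<^sup>2 * ((c y \<alpha>)\<^sup>2 / lam\<^sup>2) - 2 * g * (c y \<alpha> / lam) + 1"
      by (simp add: X3_def power2_diff power_divide power_mult_distrib algebra_simps)
    have "(norm X1)\<^sup>2 + (norm X2)\<^sup>2 + (norm X3)\<^sup>2 = real CARD('n) + 1 - 2 * g * S + g\<^sup>2 * dens y \<alpha>"
      unfolding n1 n2 n3 S_def dens_def by (simp add: algebra_simps)
    also have "\<dots> = real CARD('n) + 1 - S\<^sup>2 / dens y \<alpha>"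
      using dens_pos[of y \<alpha>] by (simp add: g_def gam_eq S_def[symmetric] power2_eq_square field_simps)
    finally have eq: "(norm X1)\<^sup>2 + (norm X2)\<^sup>2 + (norm X3)\<^sup>2 = real CARD('n) + 1 - S\<^sup>2 / dens y \<alpha>" .
    have "real CARD('n) + \<delta> \<le> S\<^sup>2 / dens y \<alpha>"
      using Cordes[of y \<alpha>] dens_pos[of y \<alpha>] delta
      unfolding dens_def[symmetric] S_def[symmetric] by (simp add: field_simps)
    then show ?thesis unfolding eq by linarith
  qed
  have "0 \<le> nrm P p s" using lam_pos by (simp add: nrm_def)
  then have "sqrt ((norm X1)\<^sup>2 + (norm X2)\<^sup>2 + (norm X3)\<^sup>2) * nrm P p s \<le> sqrt (1 - \<delta>) * nrm P p s"
    using X by (intro mult_right_mono real_sqrt_le_mono)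
  then show ?thesis using CS unfolding nP e[unfolded g_def] by (rule order_trans[rotated])
qed

lemma continuous_coefficients:
  "continuous_on UNIV (\<lambda>z. A (fst z) (snd z))" "continuous_on UNIV (\<lambda>z. b (fst z) (snd z))"
  "continuous_on UNIV (\<lambda>z. c (fst z) (snd z))" "continuous_on UNIV (\<lambda>z. f (fst z) (snd z))"
  using A_cont b_cont c_cont f_cont
  by (auto dest!: uniformly_continuous_imp_continuous simp: case_prod_unfold)

lemma continuous_affine:
  "continuous_on UNIV (\<lambda>z. affine (fst z) (snd z) P p s)"
proof -
  have tr: "continuous_on UNIV (\<lambda>z. trace (A (fst z) (snd z)))"
    unfolding trace_def by (intro continuous_intros continuous_coefficients)
  have d: "continuous_on UNIV (\<lambda>z. dens (fst z) (snd z))"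
    unfolding dens_def using lam_pos by (intro continuous_intros continuous_coefficients) auto
  show ?thesis
    unfolding affine_def gam_eq using lam_pos dens_pos
    by (intro continuous_intros continuous_coefficients tr d) (auto simp: less_imp_neq[symmetric])
qed

lemma affine_bounded:
  "\<exists>B. \<forall>y\<in>cbox 0 1. \<forall>\<alpha>. \<bar>affine y \<alpha> 0 0 0\<bar> \<le> B"
proof -
  have "compact ((\<lambda>z. affine (fst z) (snd z) 0 0 0) ` (cbox 0 1 \<times> UNIV))"
    by (intro compact_continuous_image continuous_on_subset[OF continuous_affine] compact_Times compact_cbox Lambda_compact) auto
  then have "bounded ((\<lambda>z. affine (fst z) (snd z) 0 0 0) ` (cbox 0 1 \<times> UNIV))" by (rule compact_imp_bounded)
  then show ?thesis by (auto simp: bounded_iff image_iff)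
qed

lemma bdd_above_affine: "bdd_above (range (\<lambda>\<alpha>. affine y \<alpha> P p s))"
proof -
  have "continuous_on UNIV (\<lambda>\<alpha>. affine y \<alpha> P p s)"
    by (rule continuous_on_compose2[OF continuous_affine, of UNIV "\<lambda>\<alpha>. (y, \<alpha>)", simplified]) (intro continuous_intros)
  then have "compact (range (\<lambda>\<alpha>. affine y \<alpha> P p s))" using Lambda_compact by (rule compact_continuous_image)
  then show ?thesis by (intro bounded_imp_bdd_above compact_imp_bounded)
qed

lemma affine_diff:
  "affine y \<alpha> P p s - affine y \<alpha> P' p' s'
   = gam y \<alpha> * (- (A y \<alpha> \<bullet> (P - P')) - b y \<alpha> \<bullet> (p - p') + c y \<alpha> * (s - s'))"
  by (simp add: affine_def inner_diff_right algebra_simps)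

text \<open>The estimate for a single parameter has a shift \<open>?t\<close> and a bound
  \<open>?K\<close> that do not depend on the parameter, so it passes to the supremum.\<close>

lemma Fpt_Cordes:
  "\<bar>Fpt y P p s - Fpt y P' p' s' - (lam * (s - s') - trace (P - P'))\<bar> \<le> sqrt (1 - \<delta>) * nrm (P - P') (p - p') (s - s')"
proof -
  have le: "Fpt y P p s \<le> Fpt y P' p' s' + t + K"
    if "\<And>\<alpha>. \<bar>affine y \<alpha> P p s - affine y \<alpha> P' p' s' - t\<bar> \<le> K" for P p s P' p' s' t K
    unfolding Fpt_def
  proof (rule cSUP_least)
    fix \<alpha>
    have "affine y \<alpha> P' p' s' \<le> (SUP \<alpha>. affine y \<alpha> P' p' s')"
      by (rule cSUP_upper[OF UNIV_I bdd_above_affine])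
    then show "affine y \<alpha> P p s \<le> (SUP \<alpha>. affine y \<alpha> P' p' s') + t + K" using that[of \<alpha>] by linarith
  qed simp
  let ?t = "lam * (s - s') - trace (P - P')" and ?K = "sqrt (1 - \<delta>) * nrm (P - P') (p - p') (s - s')"
  have *: "\<bar>affine y \<alpha> P p s - affine y \<alpha> P' p' s' - ?t\<bar> \<le> ?K" for \<alpha>
    unfolding affine_diff by (rule Cordes_pointwise)
  have "\<bar>affine y \<alpha> P' p' s' - affine y \<alpha> P p s - (- ?t)\<bar> \<le> ?K" for \<alpha> using *[of \<alpha>] by linarith
  from le[of P p s P' p' s' ?t ?K, OF *] le[of P' p' s' P p s "- ?t" ?K, OF this] show ?thesis by linarith
qed

text \<open>The sublevel sets of a supremum of functions that are continuous in
  \<open>(y, P, p, s)\<close> are intersections of closed sets. So no countable family of parameters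
  has to be extracted.\<close>

lemma Fpt_measurable:
  assumes "P \<in> L2" "p \<in> L2" "s \<in> L2"
  shows "(\<lambda>y. Fpt y (P y) (p y) (s y)) \<in> borel_measurable cellM"
proof -
  let ?G = "\<lambda>z :: ('n rvec) \<times> ('n rmat) \<times> ('n rvec) \<times> real. Fpt (fst z) (fst (snd z)) (fst (snd (snd z))) (snd (snd (snd z)))"
  let ?g = "\<lambda>\<alpha> (z :: ('n rvec) \<times> ('n rmat) \<times> ('n rvec) \<times> real). affine (fst z) \<alpha> (fst (snd z)) (fst (snd (snd z))) (snd (snd (snd z)))"
  have cont: "continuous_on UNIV (?g \<alpha>)" for \<alpha>
  proof -
    have c1: "continuous_on UNIV (\<lambda>z :: ('n rvec) \<times> ('n rmat) \<times> ('n rvec) \<times> real. A (fst z) \<alpha>)"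
      "continuous_on UNIV (\<lambda>z :: ('n rvec) \<times> ('n rmat) \<times> ('n rvec) \<times> real. b (fst z) \<alpha>)"
      "continuous_on UNIV (\<lambda>z :: ('n rvec) \<times> ('n rmat) \<times> ('n rvec) \<times> real. c (fst z) \<alpha>)"
      "continuous_on UNIV (\<lambda>z :: ('n rvec) \<times> ('n rmat) \<times> ('n rvec) \<times> real. f (fst z) \<alpha>)"
      by (rule continuous_on_compose2[OF continuous_coefficients(1), of UNIV "\<lambda>z. (fst z, \<alpha>)", simplified]
            continuous_on_compose2[OF continuous_coefficients(2), of UNIV "\<lambda>z. (fst z, \<alpha>)", simplified]
            continuous_on_compose2[OF continuous_coefficients(3), of UNIV "\<lambda>z. (fst z, \<alpha>)", simplified]
            continuous_on_compose2[OF continuous_coefficients(4), of UNIV "\<lambda>z. (fst z, \<alpha>)", simplified];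
          intro continuous_intros)+
    show ?thesis
      unfolding affine_def gam_eq trace_def dens_def[abs_def]
      using lam_pos dens_pos[of _ \<alpha>, unfolded dens_def]
      by (intro continuous_intros c1) (auto simp: less_imp_neq[symmetric])
  qed
  have "?G \<in> borel_measurable borel"
  proof (rule borel_measurable_iff_le[THEN iffD2], rule allI)
    fix a
    have "{z \<in> space borel. ?G z \<le> a} = (\<Inter>\<alpha>. {z. ?g \<alpha> z \<le> a})"
      unfolding Fpt_def by (auto simp: cSUP_le_iff[OF _ bdd_above_affine])
    moreover have "closed (\<Inter>\<alpha>. {z. ?g \<alpha> z \<le> a})"
      by (intro closed_INT ballI closed_Collect_le cont continuous_intros)
    ultimately show "{z \<in> space borel. ?G z \<le> a} \<in> sets borel" by simp
  qed
  moreover have "(\<lambda>y. (y, P y, p y, s y)) \<in> borel_measurable cellM"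
    by (intro borel_measurable_Pair continuous_measurable_cellM[OF continuous_on_id] L2_measurable assms)
  ultimately have "(\<lambda>y. ?G (y, P y, p y, s y)) \<in> borel_measurable cellM" by (rule measurable_compose[rotated])
  then show ?thesis by simp
qed

end


section \<open>The mixed formulation in Hilbert space\<close>

text \<open>A pair \<open>(w, u)\<close> is represented by the tuple of the classes of \<open>w\<close>, \<open>Dw\<close>, \<open>u\<close> and \<open>\<nabla>u\<close>.\<close>

type_synonym 'n tuple = "('n, 'n rvec) l2 \<times> ('n, 'n rmat) l2 \<times> ('n, real) l2 \<times> ('n, 'n rvec) l2"

definition om :: "('n::finite) tuple \<Rightarrow> ('n, 'n rvec) l2" where "om h = fst h"
definition Om :: "('n::finite) tuple \<Rightarrow> ('n, 'n rmat) l2" where "Om h = fst (snd h)"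
definition up :: "('n::finite) tuple \<Rightarrow> ('n, real) l2" where "up h = fst (snd (snd h))"
definition gr :: "('n::finite) tuple \<Rightarrow> ('n, 'n rvec) l2" where "gr h = snd (snd (snd h))"

lemmas components = om_def Om_def up_def gr_def

lemma components_linear [simp]:
  "om (h + k) = om h + om k" "Om (h + k) = Om h + Om k" "up (h + k) = up h + up k" "gr (h + k) = gr h + gr k"
  "om (h - k) = om h - om k" "Om (h - k) = Om h - Om k" "up (h - k) = up h - up k" "gr (h - k) = gr h - gr k"
  "om (r *\<^sub>R h) = r *\<^sub>R om h" "Om (r *\<^sub>R h) = r *\<^sub>R Om h" "up (r *\<^sub>R h) = r *\<^sub>R up h" "gr (r *\<^sub>R h) = r *\<^sub>R gr h"
  "om 0 = 0" "Om 0 = 0" "up 0 = 0" "gr 0 = 0"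
  by (simp_all add: components)

lemma tuple_inner: "h \<bullet> k = om h \<bullet> om k + Om h \<bullet> Om k + up h \<bullet> up k + gr h \<bullet> gr k"
  by (simp add: components inner_prod_def)

lemma tuple_norm_square: "(norm h)\<^sup>2 = (norm (om h))\<^sup>2 + (norm (Om h))\<^sup>2 + (norm (up h))\<^sup>2 + (norm (gr h))\<^sup>2"
  by (simp only: power2_norm_eq_inner tuple_inner)

lemma trace_bounded_linear: "bounded_linear (trace :: real ^ 'n ^ 'n \<Rightarrow> real)"
  unfolding trace_def by (intro bounded_linear_sum bounded_linear_compose[OF bounded_linear_vec_nth bounded_linear_vec_nth])

lemma scaled_identity_bounded_linear: "bounded_linear (\<lambda>s. s *\<^sub>R (mat 1 :: real ^ 'n ^ 'n))"
  by (rule bounded_linear_scaleR_left)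

lemma l2_map_diff: "bounded_linear T \<Longrightarrow> l2_map T (h - k) = l2_map T h - l2_map T k"
  using linear_diff[OF bounded_linear.linear[OF bounded_linear_l2_map]] .

lemma inner_l2_map_trace: "l2_map (\<lambda>s. s *\<^sub>R mat 1) F \<bullet> P = F \<bullet> l2_map trace P"
proof -
  have "l2_map (\<lambda>s. s *\<^sub>R mat 1) (l2_of (rep_l2 F)) \<bullet> l2_of (rep_l2 P) = l2_of (rep_l2 F) \<bullet> l2_map trace (l2_of (rep_l2 P))"
    by (simp only: l2_map_l2_of[OF scaled_identity_bounded_linear rep_l2_mem] l2_map_l2_of[OF trace_bounded_linear rep_l2_mem]
        inner_l2_of[OF L2_bounded_linear[OF scaled_identity_bounded_linear rep_l2_mem] rep_l2_mem]
        inner_l2_of[OF rep_l2_mem L2_bounded_linear[OF trace_bounded_linear rep_l2_mem]]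
        inner_scaleR_left inner_mat_1 inner_real_def)
  then show ?thesis by simp
qed

lemma inner_transpose: "transpose (P :: real ^ 'n ^ 'm) \<bullet> R = P \<bullet> transpose R"
  unfolding inner_vec_def transpose_def by (simp, rule sum.swap)

lemma inner_l2_map_transpose:
  fixes P :: "('k::finite, real ^ 'n ^ 'm) l2"
  shows "l2_map transpose P \<bullet> R = P \<bullet> l2_map transpose R"
proof -
  have "l2_map transpose (l2_of (rep_l2 P)) \<bullet> l2_of (rep_l2 R) = l2_of (rep_l2 P) \<bullet> l2_map transpose (l2_of (rep_l2 R))"
    by (simp only: l2_map_l2_of[OF transpose_bounded_linear rep_l2_mem]
        inner_l2_of[OF L2_bounded_linear[OF transpose_bounded_linear rep_l2_mem] rep_l2_mem]
        inner_l2_of[OF rep_l2_mem L2_bounded_linear[OF transpose_bounded_linear rep_l2_mem]] inner_transpose)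
  then show ?thesis by simp
qed

lemma l2_map_transpose_transpose:
  fixes P :: "('k::finite, real ^ 'n ^ 'm) l2"
  shows "l2_map transpose (l2_map transpose P) = P"
proof -
  have "l2_map transpose (l2_map transpose (l2_of (rep_l2 P))) = l2_of (rep_l2 P)"
    by (simp only: l2_map_l2_of[OF transpose_bounded_linear rep_l2_mem]
        l2_map_l2_of[OF transpose_bounded_linear L2_bounded_linear[OF transpose_bounded_linear rep_l2_mem]] transpose_transpose)
  then show ?thesis by simp
qed

text \<open>The defect of the relation \<open>w = \<nabla>u\<close>.\<close>

definition qh :: "('n::finite) tuple \<Rightarrow> ('n, 'n rvec) l2" where "qh h = gr h - om h"
text \<open>Twice the antisymmetric part of the Jacobian, standing for the rotation in either
  dimension as in \<open>rot_dot_eq\<close>.\<close>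

definition rh :: "('n::finite) tuple \<Rightarrow> ('n, 'n rmat) l2" where "rh h = Om h - l2_map transpose (Om h)"

lemma qh_diff [simp]: "qh (h - k) = qh h - qh k"
  by (simp add: qh_def)

lemma rh_diff [simp]: "rh (h - k) = rh h - rh k"
  by (simp add: rh_def l2_map_diff[OF transpose_bounded_linear])

text \<open>An antisymmetric matrix is orthogonal to the symmetric ones, so only the antisymmetric
  part of \<open>Om k\<close> counts, and that is half of \<open>rh k\<close>.\<close>

lemma inner_rh: "rh h \<bullet> Om k = (1/2) * (rh h \<bullet> rh k)"
proof -
  have "l2_map transpose (Om h) \<bullet> l2_map transpose (Om k) = Om h \<bullet> Om k"
    by (simp add: inner_l2_map_transpose l2_map_transpose_transpose)
  then show ?thesis
    by (simp add: rh_def inner_diff_left inner_diff_right inner_l2_map_transpose)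
qed

text \<open>The element of the tuple space that represents the form \<open>b\<close> with multiplier
  \<open>h\<close>. \<open>CH\<close> is the adjoint map.\<close>

definition BH :: "('n::finite) tuple \<Rightarrow> 'n tuple" where "BH h = (- gr h, 0, 0, gr h)"
definition CH :: "('n::finite) tuple \<Rightarrow> 'n tuple" where "CH h = (0, 0, 0, qh h)"

lemma inner_BH: "BH m \<bullet> z = gr m \<bullet> qh z"
  by (simp add: BH_def tuple_inner qh_def inner_diff_right) (simp add: components)

lemma inner_CH: "m \<bullet> CH z = gr m \<bullet> qh z"
  by (simp add: CH_def tuple_inner) (simp add: components)

lemma bounded_linear_BH: "bounded_linear (BH :: ('n::finite) tuple \<Rightarrow> _)"
proof -
  have "BH = (\<lambda>h :: 'n tuple. (- snd (snd (snd h)), 0, 0, snd (snd (snd h))))"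
    by (simp add: BH_def[abs_def] gr_def)
  moreover have "bounded_linear (\<lambda>h :: 'n tuple. (- snd (snd (snd h)), 0, 0, snd (snd (snd h))) :: 'n tuple)"
    by (intro bounded_linear_Pair bounded_linear_minus bounded_linear_zero
        bounded_linear_compose[OF bounded_linear_snd] bounded_linear_snd)
  ultimately show ?thesis by simp
qed

context Cordes_coefficients
begin

lemma L2norm_nrm:
  assumes "P \<in> L2" "p \<in> L2" "s \<in> L2"
  shows "(\<lambda>y. nrm (P y) (p y) (s y)) \<in> L2"
    "L2norm (\<lambda>y. nrm (P y) (p y) (s y)) = sqrt ((L2norm P)\<^sup>2 + 2 * lam * (L2norm p)\<^sup>2 + lam\<^sup>2 * (L2norm s)\<^sup>2)"
proof -
  have sq: "(nrm Q q r)\<^sup>2 = (norm Q)\<^sup>2 + 2 * lam * (norm q)\<^sup>2 + lam\<^sup>2 * (norm r)\<^sup>2" for Q q r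
    unfolding nrm_def using lam_pos by (subst real_sqrt_pow2) auto
  have int: "integrable cellM (\<lambda>y. (norm (P y))\<^sup>2 + 2 * lam * (norm (p y))\<^sup>2 + lam\<^sup>2 * (norm (s y))\<^sup>2)"
    using assms[THEN L2_norm_integrable] by (intro Bochner_Integration.integrable_add integrable_mult_right)
  have meas: "(\<lambda>y. nrm (P y) (p y) (s y)) \<in> borel_measurable cellM"
    unfolding nrm_def using assms[THEN L2_measurable] by measurable
  show "(\<lambda>y. nrm (P y) (p y) (s y)) \<in> L2"
    by (rule L2_bound[OF int meas]) (simp add: sq)
  have "(\<integral>y. (norm (nrm (P y) (p y) (s y)))\<^sup>2 \<partial>cellM) = (L2norm P)\<^sup>2 + 2 * lam * (L2norm p)\<^sup>2 + lam\<^sup>2 * (L2norm s)\<^sup>2"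
    unfolding L2norm_square using assms[THEN L2_norm_integrable] by (simp add: sq)
  then show "L2norm (\<lambda>y. nrm (P y) (p y) (s y)) = sqrt ((L2norm P)\<^sup>2 + 2 * lam * (L2norm p)\<^sup>2 + lam\<^sup>2 * (L2norm s)\<^sup>2)"
    by (simp add: L2norm_def[of "\<lambda>y. nrm (P y) (p y) (s y)"])
qed

lemma Fpt_L2_Cordes:
  assumes L: "P \<in> L2" "p \<in> L2" "s \<in> L2" "P' \<in> L2" "p' \<in> L2" "s' \<in> L2"
  defines "E \<equiv> \<lambda>y. Fpt y (P y) (p y) (s y) - Fpt y (P' y) (p' y) (s' y) - (lam * (s y - s' y) - trace (P y - P' y))"
  shows "E \<in> L2"
    "L2norm E \<le> sqrt (1 - \<delta>) * sqrt ((L2norm (\<lambda>y. P y - P' y))\<^sup>2 + 2 * lam * (L2norm (\<lambda>y. p y - p' y))\<^sup>2 + lam\<^sup>2 * (L2norm (\<lambda>y. s y - s' y))\<^sup>2)"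
proof -
  have d: "(\<lambda>y. P y - P' y) \<in> L2" "(\<lambda>y. p y - p' y) \<in> L2" "(\<lambda>y. s y - s' y) \<in> L2"
    using L by (auto intro: L2_diff)
  let ?N = "\<lambda>y. sqrt (1 - \<delta>) *\<^sub>R nrm (P y - P' y) (p y - p' y) (s y - s' y)"
  have N: "?N \<in> L2" by (rule L2_scaleR[OF L2norm_nrm(1)[OF d]])
  have m: "E \<in> borel_measurable cellM"
    unfolding E_def
    using Fpt_measurable[OF L(1-3)] Fpt_measurable[OF L(4-6)] L2_measurable[OF d(3)]
      L2_measurable[OF L2_bounded_linear[OF trace_bounded_linear d(1)]]
    by measurable
  have le: "norm (E y) \<le> norm (?N y)" for y
    using Fpt_Cordes[of y "P y" "p y" "s y" "P' y" "p' y" "s' y"] abs_ge_self[of "sqrt (1 - \<delta>) * nrm (P y - P' y) (p y - p' y) (s y - s' y)"]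
    by (simp add: E_def)
  show EL: "E \<in> L2"
    by (rule L2_bound[OF L2_norm_integrable[OF N] m]) (intro AE_I2 power_mono le norm_ge_zero)
  have "L2norm E \<le> L2norm ?N" by (rule L2norm_mono[OF EL N]) (intro AE_I2 le)
  also have "\<dots> = sqrt (1 - \<delta>) * L2norm (\<lambda>y. nrm (P y - P' y) (p y - p' y) (s y - s' y))"
    using delta by (subst L2norm_scaleR[OF L2norm_nrm(1)[OF d]]) simp
  finally show "L2norm E \<le> sqrt (1 - \<delta>) * sqrt ((L2norm (\<lambda>y. P y - P' y))\<^sup>2 + 2 * lam * (L2norm (\<lambda>y. p y - p' y))\<^sup>2 + lam\<^sup>2 * (L2norm (\<lambda>y. s y - s' y))\<^sup>2)"
    by (simp only: L2norm_nrm(2)[OF d])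
qed

text \<open>The value at zero arguments is bounded by compactness, and the Cordes estimate puts the
  difference to it into L2.\<close>

lemma Fpt_L2:
  assumes L: "P \<in> L2" "p \<in> L2" "s \<in> L2"
  shows "(\<lambda>y. Fpt y (P y) (p y) (s y)) \<in> L2"
proof -
  obtain B where B: "\<And>y \<alpha>. y \<in> cbox 0 1 \<Longrightarrow> \<bar>affine y \<alpha> 0 0 0\<bar> \<le> B" using affine_bounded by blast
  have F0: "(\<lambda>y. Fpt y 0 0 0) \<in> L2"
  proof (rule bounded_L2)
    show "(\<lambda>y. Fpt y 0 0 0) \<in> borel_measurable cellM"
      by (rule Fpt_measurable[of "\<lambda>y. 0" "\<lambda>y. 0" "\<lambda>y. 0"]) auto
    fix y :: "'n rvec" assume "y \<in> cell"
    then have "y \<in> cbox 0 1" using box_subset_cbox by blast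
    then have "\<bar>affine y \<alpha> 0 0 0\<bar> \<le> B" for \<alpha> using B by blast
    then have a: "- B \<le> affine y \<alpha> 0 0 0" "affine y \<alpha> 0 0 0 \<le> B" for \<alpha> by (auto simp: abs_le_iff minus_le_iff)
    have "Fpt y 0 0 0 \<le> B" unfolding Fpt_def by (rule cSUP_least) (auto intro: a)
    \<comment> \<open>A supremum is at least its value at any one parameter;
      \<open>undefined\<close> is an arbitrary one.\<close>
    moreover have "- B \<le> Fpt y 0 0 0" unfolding Fpt_def by (rule cSUP_upper2[where x = undefined, OF bdd_above_affine UNIV_I a(1)])
    ultimately show "norm (Fpt y 0 0 0) \<le> B" by simp
  qed
  have E: "(\<lambda>y. Fpt y (P y) (p y) (s y) - Fpt y 0 0 0 - (lam * (s y - 0) - trace (P y - 0))) \<in> L2"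
    by (rule Fpt_L2_Cordes(1)[OF L L2_zero L2_zero L2_zero])
  have L': "(\<lambda>y. lam * (s y - 0) - trace (P y - 0)) \<in> L2"
    using L2_diff[OF L2_scaleR[OF L(3), of lam] L2_bounded_linear[OF trace_bounded_linear L(1)]] by simp
  show ?thesis using L2_add[OF L2_add[OF E L'] F0] by simp
qed

definition FH :: "'n tuple \<Rightarrow> ('n, real) l2" where
  "FH h = l2_of (\<lambda>y. Fpt y (rep_l2 (Om h) y) (rep_l2 (gr h) y) (rep_l2 (up h) y))"

definition Lh :: "'n tuple \<Rightarrow> ('n, real) l2" where
  "Lh h = lam *\<^sub>R up h - l2_map trace (Om h)"

definition Nh :: "'n tuple \<Rightarrow> real" where
  "Nh h = sqrt ((norm (Om h))\<^sup>2 + 2 * lam * (norm (gr h))\<^sup>2 + lam\<^sup>2 * (norm (up h))\<^sup>2)"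

lemma Lh_diff [simp]: "Lh (h - k) = Lh h - Lh k"
  by (simp add: Lh_def l2_map_diff[OF trace_bounded_linear] algebra_simps)

lemma FH_l2_of:
  assumes L: "P \<in> L2" "p \<in> L2" "s \<in> L2"
  shows "FH (w, l2_of P, l2_of s, l2_of p) = l2_of (\<lambda>y. Fpt y (P y) (p y) (s y))"
proof -
  have "AE y in cellM. Fpt y (rep_l2 (l2_of P) y) (rep_l2 (l2_of p) y) (rep_l2 (l2_of s) y) = Fpt y (P y) (p y) (s y)"
    using rep_l2_of[OF L(1)] rep_l2_of[OF L(2)] rep_l2_of[OF L(3)] by eventually_elim simp
  then show ?thesis
    unfolding FH_def components fst_conv snd_conv
    using l2_of_eq_iff[OF Fpt_L2[OF rep_l2_mem rep_l2_mem rep_l2_mem] Fpt_L2[OF L]] by blast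
qed

lemma FH_Cordes: "norm (FH h - FH k - Lh (h - k)) \<le> sqrt (1 - \<delta>) * Nh (h - k)"
proof -
  let ?P = "rep_l2 (Om h)" and ?p = "rep_l2 (gr h)" and ?s = "rep_l2 (up h)"
  let ?P' = "rep_l2 (Om k)" and ?p' = "rep_l2 (gr k)" and ?s' = "rep_l2 (up k)"
  note r = rep_l2_mem
  have s: "l2_of (\<lambda>y. lam * (?s y - ?s' y)) = lam *\<^sub>R (up h - up k)"
    using l2_of_scaleR[OF L2_diff[OF r r], of lam "up h" "up k"] by (simp add: l2_of_diff r)
  have t: "l2_of (\<lambda>y. trace (?P y - ?P' y)) = l2_map trace (Om h - Om k)"
    by (subst l2_map_l2_of[OF trace_bounded_linear L2_diff[OF r r], symmetric]) (simp add: l2_of_diff r)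
  have sL: "(\<lambda>y. lam * (?s y - ?s' y)) \<in> L2" using L2_scaleR[OF L2_diff[OF r r], of lam "up h" "up k"] by simp
  have tL: "(\<lambda>y. trace (?P y - ?P' y)) \<in> L2" by (rule L2_bounded_linear[OF trace_bounded_linear L2_diff[OF r r]])
  note F = Fpt_L2[OF r r r]
  have "FH h - FH k - Lh (h - k) = l2_of (\<lambda>y. Fpt y (?P y) (?p y) (?s y) - Fpt y (?P' y) (?p' y) (?s' y) - (lam * (?s y - ?s' y) - trace (?P y - ?P' y)))"
    unfolding l2_of_diff[OF L2_diff[OF F F] L2_diff[OF sL tL]] l2_of_diff[OF F F] l2_of_diff[OF sL tL] s t
    by (simp add: FH_def Lh_def)
  then have "norm (FH h - FH k - Lh (h - k)) = L2norm (\<lambda>y. Fpt y (?P y) (?p y) (?s y) - Fpt y (?P' y) (?p' y) (?s' y) - (lam * (?s y - ?s' y) - trace (?P y - ?P' y)))"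
    by (simp only: norm_l2_of[OF Fpt_L2_Cordes(1)[OF r r r r r r]])
  also have "\<dots> \<le> sqrt (1 - \<delta>) * sqrt ((L2norm (\<lambda>y. ?P y - ?P' y))\<^sup>2 + 2 * lam * (L2norm (\<lambda>y. ?p y - ?p' y))\<^sup>2 + lam\<^sup>2 * (L2norm (\<lambda>y. ?s y - ?s' y))\<^sup>2)"
    by (rule Fpt_L2_Cordes(2)[OF r r r r r r])
  also have "\<dots> = sqrt (1 - \<delta>) * Nh (h - k)"
    by (simp add: Nh_def norm_l2_of[symmetric] L2_diff r l2_of_diff)
  finally show ?thesis .
qed

definition ah :: "'n tuple \<Rightarrow> 'n tuple \<Rightarrow> real" where
  "ah h k = FH h \<bullet> Lh k + sigma1 \<delta> * (rh h \<bullet> Om k) + sigma2 lam \<delta> * (qh h \<bullet> qh k)"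

text \<open>The element that represents the functional \<open>ah h\<close>: each term is moved to
  the component against which it is tested, with multiplication by \<open>mat 1\<close> as the
  adjoint of the trace.\<close>

definition TH :: "'n tuple \<Rightarrow> 'n tuple" where
  "TH h = (- (sigma2 lam \<delta> *\<^sub>R qh h), sigma1 \<delta> *\<^sub>R rh h - l2_map (\<lambda>s. s *\<^sub>R mat 1) (FH h), lam *\<^sub>R FH h, sigma2 lam \<delta> *\<^sub>R qh h)"

lemma inner_TH: "TH h \<bullet> k = ah h k"
  unfolding tuple_inner ah_def
  by (simp add: TH_def components Lh_def[unfolded components] inner_diff_left inner_diff_right inner_l2_map_trace qh_def[of k, unfolded components] algebra_simps)

text \<open>Most tuples do not come from a pair of functions. The estimates use three facts about
  those that do: the identity for divergence and rotation, the expansion of the square of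
  \<open>L\<close>, and Poincare's inequality.\<close>

definition compatible :: "'n tuple \<Rightarrow> bool" where
  "compatible h \<longleftrightarrow>
     rh h \<bullet> Om h + (norm (l2_map trace (Om h)))\<^sup>2 = (norm (Om h))\<^sup>2 \<and>
     (norm (Lh h))\<^sup>2 = (norm (l2_map trace (Om h)))\<^sup>2 + 2 * lam * (gr h \<bullet> om h) + lam\<^sup>2 * (norm (up h))\<^sup>2 \<and>
     (norm (om h))\<^sup>2 \<le> real CARD('n) / 16 * (norm (Om h))\<^sup>2"

lemma compatibleD:
  assumes "compatible h"
  shows "rh h \<bullet> Om h + (norm (l2_map trace (Om h)))\<^sup>2 = (norm (Om h))\<^sup>2"
    "(norm (Lh h))\<^sup>2 = (norm (l2_map trace (Om h)))\<^sup>2 + 2 * lam * (gr h \<bullet> om h) + lam\<^sup>2 * (norm (up h))\<^sup>2"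
    "(norm (om h))\<^sup>2 \<le> real CARD('n) / 16 * (norm (Om h))\<^sup>2"
  using assms by (auto simp: compatible_def)

lemma Nh_square: "(Nh h)\<^sup>2 = (norm (Om h))\<^sup>2 + 2 * lam * (norm (gr h))\<^sup>2 + lam\<^sup>2 * (norm (up h))\<^sup>2"
  unfolding Nh_def using lam_pos by (subst real_sqrt_pow2) auto

lemma Nh_nonneg [simp]: "0 \<le> Nh h"
  unfolding Nh_def using lam_pos by simp

lemma kappa: "0 < sqrt (1 - \<delta>)" "sqrt (1 - \<delta>) < 1"
  using delta by auto

text \<open>With \<open>t = 1 - sqrt (1 - \<delta>)\<close> the quadratic form in \<open>\<parallel>\<nabla>u\<parallel>\<close> and \<open>\<parallel>\<nabla>u - w\<parallel>\<close> left over after absorbing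
  the Cordes defect is nonnegative because \<open>(1 + t)\<^sup>2 / (2 (1 + 2 t\<^sup>2)) \<le> 3/4\<close>, with equality for \<open>t = 1/2\<close>.\<close>

lemma monotonicity_Young:
  fixes x y t :: real
  assumes t: "0 < t" "t < 1"
  shows "(1 + t) * (x * y) \<le> (3/4) * t * (2 * x\<^sup>2) + (t / 2 + 1 / (4 * t)) * y\<^sup>2"
proof -
  have "0 \<le> (3 * t * x - (1 + t) * y)\<^sup>2 + (1/2) * (2 * t - 1)\<^sup>2 * y\<^sup>2" by simp
  also have "\<dots> = 6 * t * ((3/4) * t * (2 * x\<^sup>2) + (t / 2 + 1 / (4 * t)) * y\<^sup>2 - (1 + t) * (x * y))"
    using t by (simp add: power2_eq_square field_simps)
  finally show ?thesis using t by (simp add: zero_le_mult_iff)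
qed

text \<open>Replacing \<open>F\<close> by \<open>L\<close> costs
  \<open>\<kappa> * Nh d * norm (Lh d)\<close>, which is split evenly. The remaining share
  \<open>1 - \<kappa> / 2\<close> of the square of \<open>Lh d\<close> lacks the rotation, and
  \<open>sigma1\<close>, being this very number, restores it. What is left over is the mixed term of
  \<open>\<nabla>u\<close> and the defect \<open>qh d\<close>.\<close>

lemma strong_monotonicity:
  assumes "compatible (x - y)"
  shows "C_M \<delta> * (Nh (x - y))\<^sup>2 \<le> ah x (x - y) - ah y (x - y)"
proof -
  define d where "d = x - y"
  define \<kappa> where "\<kappa> = sqrt (1 - \<delta>)"
  define R where "R = rh d \<bullet> Om d"
  define q where "q = norm (qh d)"
  have k: "0 < \<kappa>" "\<kappa> < 1" using kappa by (auto simp: \<kappa>_def)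
  have c1: "R + (norm (l2_map trace (Om d)))\<^sup>2 = (norm (Om d))\<^sup>2"
    and c2: "(norm (Lh d))\<^sup>2 = (norm (l2_map trace (Om d)))\<^sup>2 + 2 * lam * (gr d \<bullet> om d) + lam\<^sup>2 * (norm (up d))\<^sup>2"
    using assms by (auto simp: compatible_def d_def R_def)
  have goom: "gr d \<bullet> om d = (norm (gr d))\<^sup>2 - gr d \<bullet> qh d"
    by (simp add: qh_def inner_diff_right power2_norm_eq_inner)
  have Lsq: "(norm (Lh d))\<^sup>2 = (Nh d)\<^sup>2 - R - 2 * lam * (gr d \<bullet> qh d)"
    unfolding c2 goom Nh_square using c1 by (simp add: algebra_simps)
  have "ah x d - ah y d = (FH x - FH y - Lh d) \<bullet> Lh d + (norm (Lh d))\<^sup>2 + sigma1 \<delta> * R + sigma2 lam \<delta> * q\<^sup>2"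
    unfolding ah_def R_def q_def d_def power2_norm_eq_inner
    by (simp add: inner_diff_left algebra_simps del: inner_rh)
  moreover have "\<bar>(FH x - FH y - Lh d) \<bullet> Lh d\<bar> \<le> (\<kappa> * Nh d) * norm (Lh d)"
    unfolding d_def \<kappa>_def by (rule order_trans[OF Cauchy_Schwarz_ineq2 mult_right_mono[OF FH_Cordes norm_ge_zero]])
  moreover have "(\<kappa> * Nh d) * norm (Lh d) \<le> \<kappa> / 2 * ((Nh d)\<^sup>2 + (norm (Lh d))\<^sup>2)"
  proof -
    have "\<kappa> / 2 * (2 * Nh d * norm (Lh d)) \<le> \<kappa> / 2 * ((Nh d)\<^sup>2 + (norm (Lh d))\<^sup>2)"
      using sum_squares_bound[of "Nh d" "norm (Lh d)"] k by (intro mult_left_mono) auto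
    then show ?thesis by (simp add: mult_ac)
  qed
  ultimately have "ah x d - ah y d \<ge> (1 - \<kappa> / 2) * (norm (Lh d))\<^sup>2 - \<kappa> / 2 * (Nh d)\<^sup>2 + sigma1 \<delta> * R + sigma2 lam \<delta> * q\<^sup>2"
    by (simp add: algebra_simps)
  also have "(1 - \<kappa> / 2) * (norm (Lh d))\<^sup>2 - \<kappa> / 2 * (Nh d)\<^sup>2 + sigma1 \<delta> * R + sigma2 lam \<delta> * q\<^sup>2
      = (1 - \<kappa>) * (Nh d)\<^sup>2 - (2 - \<kappa>) * lam * (gr d \<bullet> qh d) + sigma2 lam \<delta> * q\<^sup>2"
    unfolding Lsq by (simp add: sigma1_def \<kappa>_def algebra_simps)
  finally have 1: "(1 - \<kappa>) * (Nh d)\<^sup>2 - (2 - \<kappa>) * lam * (gr d \<bullet> qh d) + sigma2 lam \<delta> * q\<^sup>2 \<le> ah x d - ah y d" .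
  have "gr d \<bullet> qh d \<le> norm (gr d) * q" unfolding q_def by (rule norm_cauchy_schwarz)
  then have "(2 - \<kappa>) * lam * (gr d \<bullet> qh d) \<le> (2 - \<kappa>) * lam * (norm (gr d) * q)"
    using k lam_pos by (intro mult_left_mono) auto
  also have "\<dots> = lam * ((1 + (1 - \<kappa>)) * (norm (gr d) * q))" by (simp add: algebra_simps)
  also have "\<dots> \<le> lam * ((3/4) * (1 - \<kappa>) * (2 * (norm (gr d))\<^sup>2) + ((1 - \<kappa>) / 2 + 1 / (4 * (1 - \<kappa>))) * q\<^sup>2)"
    using k lam_pos by (intro mult_left_mono monotonicity_Young) auto
  also have "\<dots> = (3/4) * (1 - \<kappa>) * (2 * lam * (norm (gr d))\<^sup>2) + sigma2 lam \<delta> * q\<^sup>2"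
    by (simp add: sigma2_def sigma2_tilde_def \<kappa>_def algebra_simps)
  also have "\<dots> \<le> (3/4) * (1 - \<kappa>) * (Nh d)\<^sup>2 + sigma2 lam \<delta> * q\<^sup>2"
    using k unfolding Nh_square by (intro add_right_mono mult_left_mono) auto
  finally have "(2 - \<kappa>) * lam * (gr d \<bullet> qh d) \<le> (3/4) * ((1 - \<kappa>) * (Nh d)\<^sup>2) + sigma2 lam \<delta> * q\<^sup>2"
    by (simp only: mult.assoc)
  \<comment> \<open>Three quarters of \<open>(1 - \<kappa>) * (Nh d)\<^sup>2\<close> have paid for
    the mixed term; the remaining quarter is \<open>C_M\<close>.\<close>
  with 1 have "(1/4) * ((1 - \<kappa>) * (Nh d)\<^sup>2) \<le> ah x d - ah y d" by linarith
  then show ?thesis by (simp add: C_M_def d_def \<kappa>_def)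
qed

text \<open>Passes from the Poincare constant proved above to the one that occurs in
  \<open>C_L\<close>, \<open>C_b\<close> and \<open>c_b\<close>.\<close>

lemma n16_le: "real CARD('n) / 16 \<le> real CARD('n) / pi\<^sup>2"
proof -
  have "pi\<^sup>2 \<le> 4\<^sup>2" using pi_less_4 pi_gt_zero by (intro power_mono) auto
  then show ?thesis by (intro divide_left_mono) auto
qed

lemma C_b_square: "(C_b CARD('n) lam)\<^sup>2 = 1 / (2 * lam) + real CARD('n) / pi\<^sup>2" "0 < C_b CARD('n) lam"
proof -
  have p: "0 < 1 / 2 + real CARD('n) / pi\<^sup>2 * lam" using lam_pos by (intro add_pos_nonneg) auto
  have "C_b CARD('n) lam = sqrt (1 / 2 + real CARD('n) / pi\<^sup>2 * lam) / sqrt lam"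
    unfolding C_b_def using p lam_pos by (simp add: powr_minus_divide powr_half_sqrt)
  moreover have "((1 / 2 + real CARD('n) / pi\<^sup>2 * lam)) / lam = 1 / (2 * lam) + real CARD('n) / pi\<^sup>2"
    using lam_pos by (simp add: field_simps)
  ultimately show "(C_b CARD('n) lam)\<^sup>2 = 1 / (2 * lam) + real CARD('n) / pi\<^sup>2" "0 < C_b CARD('n) lam"
    using p lam_pos by (simp_all add: power_divide)
qed

lemma c_b_square: "(c_b CARD('n) lam)\<^sup>2 * (2 * lam + real CARD('n) / pi\<^sup>2 * lam\<^sup>2) = 1" "0 < c_b CARD('n) lam"
proof -
  have p: "0 < 2 + real CARD('n) / pi\<^sup>2 * lam" using lam_pos by (intro add_pos_nonneg) auto
  have c: "c_b CARD('n) lam = 1 / (sqrt (2 + real CARD('n) / pi\<^sup>2 * lam) * sqrt lam)"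
    unfolding c_b_def using p lam_pos by (simp add: powr_minus_divide powr_half_sqrt)
  have e: "2 * lam + real CARD('n) / pi\<^sup>2 * lam\<^sup>2 = (2 + real CARD('n) / pi\<^sup>2 * lam) * lam"
    by (simp add: power2_eq_square algebra_simps)
  show "(c_b CARD('n) lam)\<^sup>2 * (2 * lam + real CARD('n) / pi\<^sup>2 * lam\<^sup>2) = 1"
    unfolding c e using p lam_pos by (simp add: power_divide power_mult_distrib)
  show "0 < c_b CARD('n) lam" unfolding c using p lam_pos by simp
qed

lemma norm_qh_le:
  assumes "compatible h"
  shows "norm (qh h) \<le> C_b CARD('n) lam * Nh h"
proof (rule power2_le_imp_le)
  define X Y where "X = norm (gr h)" and "Y = norm (om h)"
  have Y: "Y\<^sup>2 \<le> real CARD('n) / pi\<^sup>2 * (norm (Om h))\<^sup>2"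
  proof -
    have "Y\<^sup>2 \<le> real CARD('n) / 16 * (norm (Om h))\<^sup>2" using assms by (simp add: compatible_def Y_def)
    also have "\<dots> \<le> real CARD('n) / pi\<^sup>2 * (norm (Om h))\<^sup>2" by (rule mult_right_mono[OF n16_le]) simp
    finally show ?thesis .
  qed
  define v where "v = real CARD('n) / pi\<^sup>2"
  have v: "0 < v" by (simp add: v_def)
  have "norm (qh h) \<le> X + Y" unfolding qh_def X_def Y_def by (rule norm_triangle_ineq4)
  then have "(norm (qh h))\<^sup>2 \<le> (X + Y)\<^sup>2" by (intro power_mono) auto
  \<comment> \<open>Cauchy-Schwarz with weights, chosen so that the second factor is bounded by the
    square of \<open>Nh\<close>.\<close>
  also have "\<dots> \<le> (1 / (2 * lam) + v) * (2 * lam * X\<^sup>2 + Y\<^sup>2 / v)"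
  proof -
    have "0 \<le> (2 * lam * v * X - Y)\<^sup>2 / (2 * lam * v)" using v lam_pos by simp
    also have "\<dots> = (1 / (2 * lam) + v) * (2 * lam * X\<^sup>2 + Y\<^sup>2 / v) - (X + Y)\<^sup>2"
      using v lam_pos by (simp add: power2_eq_square field_simps)
    finally show ?thesis by simp
  qed
  also have "\<dots> \<le> (1 / (2 * lam) + v) * (Nh h)\<^sup>2"
  proof (rule mult_left_mono)
    have "Y\<^sup>2 / v \<le> (norm (Om h))\<^sup>2" using Y v by (simp add: v_def[symmetric] divide_le_eq mult.commute)
    moreover have "0 \<le> lam\<^sup>2 * (norm (up h))\<^sup>2" by simp
    ultimately show "2 * lam * X\<^sup>2 + Y\<^sup>2 / v \<le> (Nh h)\<^sup>2" unfolding Nh_square X_def by linarith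
  qed (use v lam_pos in simp)
  finally show "(norm (qh h))\<^sup>2 \<le> (C_b CARD('n) lam * Nh h)\<^sup>2"
    by (simp add: power_mult_distrib C_b_square v_def)
qed (use C_b_square(2) in simp)

text \<open>Pointwise, the trace is bounded by \<open>sqrt n\<close> times the Frobenius norm. In L2
  the identity for divergence and rotation improves this factor to 1, so the result does not depend
  on the dimension.\<close>

lemma norm_Lh_le:
  assumes "compatible h"
  shows "norm (Lh h) \<le> sqrt 2 * Nh h"
proof (rule power2_le_imp_le)
  have "0 \<le> rh h \<bullet> Om h" unfolding inner_rh by simp
  then have tr: "(norm (l2_map trace (Om h)))\<^sup>2 \<le> (norm (Om h))\<^sup>2" using compatibleD(1)[OF assms] by linarith
  have "norm (Lh h) \<le> norm (lam *\<^sub>R up h) + norm (l2_map trace (Om h))"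
    unfolding Lh_def by (rule norm_triangle_ineq4)
  then have "(norm (Lh h))\<^sup>2 \<le> (norm (lam *\<^sub>R up h) + norm (l2_map trace (Om h)))\<^sup>2" by (intro power_mono) auto
  also have "\<dots> \<le> 2 * ((norm (lam *\<^sub>R up h))\<^sup>2 + (norm (l2_map trace (Om h)))\<^sup>2)"
    using sum_squares_bound[of "norm (lam *\<^sub>R up h)" "norm (l2_map trace (Om h))"] by (simp add: power2_sum)
  also have "\<dots> \<le> 2 * (Nh h)\<^sup>2"
  proof -
    have pos: "0 \<le> 2 * lam * (norm (gr h))\<^sup>2" using lam_pos by simp
    have eq: "(norm (lam *\<^sub>R up h))\<^sup>2 = lam\<^sup>2 * (norm (up h))\<^sup>2" by (simp add: power_mult_distrib)
    have "2 * (U + T) \<le> 2 * (P + G + U)" if "T \<le> P" "0 \<le> G" for T P G U :: real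
      using that by simp
    from this[OF tr pos] show ?thesis unfolding Nh_square eq .
  qed
  finally show "(norm (Lh h))\<^sup>2 \<le> (sqrt 2 * Nh h)\<^sup>2" by (simp add: power_mult_distrib)
qed simp

text \<open>By the identity for divergence and rotation, half the square of \<open>rh h\<close> is
  at most the square of \<open>Om h\<close>, which is half of what the pointwise estimate
  gives.\<close>

lemma inner_rh_le:
  assumes "compatible h" "compatible k"
  shows "\<bar>rh h \<bullet> Om k\<bar> \<le> Nh h * Nh k"
proof -
  have *: "(1/2) * (norm (rh h))\<^sup>2 \<le> (Nh h)\<^sup>2" if "compatible h" for h
  proof -
    have "(1/2) * (norm (rh h))\<^sup>2 \<le> (norm (Om h))\<^sup>2"
      using compatibleD(1)[OF that] zero_le_power2[of "norm (l2_map trace (Om h))"]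
      unfolding inner_rh power2_norm_eq_inner[of "rh h"] by linarith
    also have "\<dots> \<le> (Nh h)\<^sup>2" unfolding Nh_square using lam_pos by simp
    finally show ?thesis .
  qed
  have n: "norm (rh h) / sqrt 2 \<le> Nh h" if "compatible h" for h
    by (rule power2_le_imp_le) (use *[OF that] in \<open>simp_all add: power_divide\<close>)
  have "\<bar>rh h \<bullet> Om k\<bar> \<le> (1/2) * (norm (rh h) * norm (rh k))"
    unfolding inner_rh abs_mult using Cauchy_Schwarz_ineq2[of "rh h" "rh k"] by simp
  also have "\<dots> = (norm (rh h) / sqrt 2) * (norm (rh k) / sqrt 2)" by simp
  also have "\<dots> \<le> Nh h * Nh k" by (intro mult_mono n assms) auto
  finally show ?thesis .
qed

lemma sigma_nonneg: "0 \<le> sigma1 \<delta>" "0 \<le> sigma2_tilde \<delta>" "0 \<le> sigma2 lam \<delta>"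
proof -
  show "0 \<le> sigma1 \<delta>" unfolding sigma1_def using kappa by linarith
  show "0 \<le> sigma2_tilde \<delta>"
    using kappa unfolding sigma2_tilde_def by (intro add_nonneg_nonneg divide_nonneg_nonneg mult_nonneg_nonneg) auto
  then show "0 \<le> sigma2 lam \<delta>" using lam_pos by (simp add: sigma2_def)
qed

text \<open>The difference of two values of \<open>F\<close> is the Cordes defect plus
  \<open>L\<close>, with constants \<open>sqrt (1 - \<delta>)\<close> and \<open>sqrt 2\<close>.
  Paired with \<open>Lh z\<close>, these produce the first two terms of \<open>C_L\<close>; the
  penalty term produces the last through the square of \<open>C_b\<close>.\<close>

lemma lipschitz_continuity:
  assumes d: "compatible (x - y)" and z: "compatible z"
  shows "\<bar>ah x z - ah y z\<bar> \<le> C_L CARD('n) lam \<delta> * Nh (x - y) * Nh z"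
proof -
  define d where "d = x - y"
  note cd = assms(1)[folded d_def]
  have "ah x z - ah y z = (FH x - FH y) \<bullet> Lh z + sigma1 \<delta> * (rh d \<bullet> Om z) + sigma2 lam \<delta> * (qh d \<bullet> qh z)"
    unfolding ah_def d_def by (simp add: inner_diff_left algebra_simps)
  moreover have "\<bar>(FH x - FH y) \<bullet> Lh z\<bar> \<le> ((sqrt 2 + sqrt (1 - \<delta>)) * Nh d) * (sqrt 2 * Nh z)"
  proof -
    have "norm (FH x - FH y) \<le> norm (FH x - FH y - Lh d) + norm (Lh d)"
      using norm_triangle_ineq[of "FH x - FH y - Lh d" "Lh d"] by simp
    also have "\<dots> \<le> sqrt (1 - \<delta>) * Nh d + sqrt 2 * Nh d"
      unfolding d_def by (intro add_mono FH_Cordes norm_Lh_le d)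
    finally have "norm (FH x - FH y) \<le> (sqrt 2 + sqrt (1 - \<delta>)) * Nh d" by (simp add: algebra_simps)
    then show ?thesis
      using norm_Lh_le[OF z]
      by (intro order_trans[OF Cauchy_Schwarz_ineq2] mult_mono) (auto intro: order_trans[OF norm_ge_zero])
  qed
  moreover have "\<bar>sigma1 \<delta> * (rh d \<bullet> Om z)\<bar> \<le> sigma1 \<delta> * (Nh d * Nh z)"
    unfolding abs_mult using sigma_nonneg inner_rh_le[OF cd z] by (simp add: mult_left_mono)
  moreover have "\<bar>sigma2 lam \<delta> * (qh d \<bullet> qh z)\<bar> \<le> sigma2_tilde \<delta> * (1 / 2 + real CARD('n) / pi\<^sup>2 * lam) * (Nh d * Nh z)"
  proof -
    have "\<bar>qh d \<bullet> qh z\<bar> \<le> (C_b CARD('n) lam * Nh d) * (C_b CARD('n) lam * Nh z)"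
      by (intro order_trans[OF Cauchy_Schwarz_ineq2] mult_mono norm_qh_le cd z) (use C_b_square(2) in auto)
    also have "\<dots> = (1 / (2 * lam) + real CARD('n) / pi\<^sup>2) * (Nh d * Nh z)"
      unfolding C_b_square(1)[symmetric] by (simp add: power2_eq_square mult_ac)
    finally have "sigma2 lam \<delta> * \<bar>qh d \<bullet> qh z\<bar> \<le> sigma2 lam \<delta> * ((1 / (2 * lam) + real CARD('n) / pi\<^sup>2) * (Nh d * Nh z))"
      using sigma_nonneg by (intro mult_left_mono)
    also have "\<dots> = sigma2_tilde \<delta> * (1 / 2 + real CARD('n) / pi\<^sup>2 * lam) * (Nh d * Nh z)"
    proof -
      have e: "lam * (1 / (2 * lam) + real CARD('n) / pi\<^sup>2) = 1 / 2 + real CARD('n) / pi\<^sup>2 * lam"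
        using lam_pos by (simp add: field_simps)
      then show ?thesis unfolding sigma2_def unfolding e[symmetric] by (simp only: mult_ac)
    qed
    finally show ?thesis using sigma_nonneg by (simp add: abs_mult)
  qed
  ultimately have "\<bar>ah x z - ah y z\<bar> \<le> ((sqrt 2 + sqrt (1 - \<delta>)) * Nh d) * (sqrt 2 * Nh z) + sigma1 \<delta> * (Nh d * Nh z)
      + sigma2_tilde \<delta> * (1 / 2 + real CARD('n) / pi\<^sup>2 * lam) * (Nh d * Nh z)"
    by linarith
  also have "\<dots> = ((sqrt 2 + sqrt (1 - \<delta>)) * sqrt 2 + sigma1 \<delta> + sigma2_tilde \<delta> * (1 / 2 + real CARD('n) / pi\<^sup>2 * lam)) * Nh d * Nh z"
    by (simp only: distrib_right distrib_left mult_ac)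
  also have "(sqrt 2 + sqrt (1 - \<delta>)) * sqrt 2 = 2 + sqrt 2 * sqrt (1 - \<delta>)"
    unfolding distrib_right by (simp add: mult.commute[of "sqrt (1 - \<delta>)"])
  finally show ?thesis by (simp add: C_L_def d_def)
qed

end


section \<open>Closed subspaces of the Sobolev spaces\<close>

text \<open>Turns sets of functions into subsets of a Hilbert space whose norm matches
  \<open>H1norm\<close>, so that closedness in the Sobolev space becomes topological
  closedness.\<close>

definition graph :: "(real ^ 'n \<Rightarrow> real) set \<Rightarrow> (('n::finite, real) l2 \<times> ('n, real ^ 'n) l2) set" where
  "graph S = (\<lambda>v. (l2_of v, l2_of (wgrad v))) ` S"

definition graph_vec :: "(real ^ 'n \<Rightarrow> real ^ 'n) set \<Rightarrow> (('n::finite, real ^ 'n) l2 \<times> ('n, real ^ 'n ^ 'n) l2) set" where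
  "graph_vec S = (\<lambda>w. (l2_of w, l2_of (Jac w))) ` S"

lemma graph_H1_per: "graph (H1_per :: (real ^ 'n \<Rightarrow> real) set) = closure smooth_graph"
proof
  show "graph (H1_per :: (real ^ 'n \<Rightarrow> real) set) \<subseteq> closure smooth_graph"
    using H1_per_closure_graph by (auto simp: graph_def)
  show "closure smooth_graph \<subseteq> graph (H1_per :: (real ^ 'n \<Rightarrow> real) set)"
  proof
    fix p :: "('n, real) l2 \<times> ('n, real ^ 'n) l2" assume p: "p \<in> closure smooth_graph"
    let ?v = "rep_l2 (fst p)" and ?g = "rep_l2 (snd p)"
    have "(l2_of ?v, l2_of ?g) \<in> closure smooth_graph" using p by simp
    note c = closure_graph_H1_per[OF this rep_l2_mem rep_l2_mem]
    have "l2_of (wgrad ?v) = l2_of ?g"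
      using l2_of_eq_iff[OF H1_per_wgrad_L2[OF c(1)] rep_l2_mem] wgrad_AE[OF rep_l2_mem c(2)] by blast
    then have "p = (l2_of ?v, l2_of (wgrad ?v))" by (simp add: prod_eq_iff)
    then show "p \<in> graph H1_per" using c(1) unfolding graph_def by blast
  qed
qed

lemma mean_eq_inner: "v \<in> L2 \<Longrightarrow> (\<integral>y. v y \<partial>cellM) = l2_of v \<bullet> l2_of (\<lambda>y. 1)"
  by (simp add: inner_l2_of)

lemma closed_graph_W_per: "closed (graph (W_per :: (real ^ 'n \<Rightarrow> real) set))"
proof -
  have "graph (W_per :: (real ^ 'n \<Rightarrow> real) set) = closure smooth_graph \<inter> {p. fst p \<bullet> l2_of (\<lambda>y. 1) = 0}"
    unfolding graph_H1_per[symmetric] by (auto simp: graph_def W_per_def mean_eq_inner H1_per_L2)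
  moreover have "closed {p :: ('n, real) l2 \<times> ('n, real ^ 'n) l2. fst p \<bullet> l2_of (\<lambda>y. 1) = 0}"
    by (intro closed_Collect_eq continuous_intros)
  ultimately show ?thesis by (simp add: closed_Int)
qed

lemma graph_norm_eq_H1norm:
  assumes "v \<in> H1_per" "v' \<in> H1_per"
  shows "norm ((l2_of v, l2_of (wgrad v)) - (l2_of v', l2_of (wgrad v'))) = H1norm (\<lambda>y. v y - v' y)"
proof -
  note d = H1_per_diff[OF assms]
  have "l2_of (wgrad (\<lambda>y. v y - v' y)) = l2_of (\<lambda>y. wgrad v y - wgrad v' y)"
    using l2_of_eq_iff[OF H1_per_wgrad_L2[OF d(1)] L2_diff[OF assms[THEN H1_per_wgrad_L2]]] d(2) by blast
  then have "(l2_of v, l2_of (wgrad v)) - (l2_of v', l2_of (wgrad v')) = (l2_of (\<lambda>y. v y - v' y), l2_of (wgrad (\<lambda>y. v y - v' y)))"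
    using assms by (simp add: l2_of_diff H1_per_L2 H1_per_wgrad_L2)
  then show ?thesis
    by (simp add: norm_prod_def norm_l2_of H1_per_L2 H1_per_wgrad_L2 d(1) H1norm_def)
qed

lemma graph_vec_norm_eq_H1norm_vec:
  assumes "w \<in> W_per_vec" "w' \<in> W_per_vec"
  shows "norm ((l2_of w, l2_of (Jac w)) - (l2_of w', l2_of (Jac w'))) = H1norm_vec (\<lambda>y. w y - w' y)"
proof -
  note d = W_per_vec_diff[OF assms]
  have "l2_of (Jac (\<lambda>y. w y - w' y)) = l2_of (\<lambda>y. Jac w y - Jac w' y)"
    using l2_of_eq_iff[OF Jac_L2[OF d(1)] L2_diff[OF assms[THEN Jac_L2]]] d(2) by blast
  then have "(l2_of w, l2_of (Jac w)) - (l2_of w', l2_of (Jac w')) = (l2_of (\<lambda>y. w y - w' y), l2_of (Jac (\<lambda>y. w y - w' y)))"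
    using assms by (simp add: l2_of_diff W_per_vec_L2 Jac_L2)
  then have "(norm ((l2_of w, l2_of (Jac w)) - (l2_of w', l2_of (Jac w'))))\<^sup>2 = (H1norm_vec (\<lambda>y. w y - w' y))\<^sup>2"
    by (simp add: norm_prod_def norm_l2_of W_per_vec_L2 Jac_L2 d(1) H1norm_vec_square)
  moreover have "0 \<le> H1norm_vec (\<lambda>y. w y - w' y)" by (simp add: H1norm_vec_def sum_nonneg)
  ultimately show ?thesis by (intro power2_eq_imp_eq[OF _ norm_ge_zero])
qed

lemma closed_linear_subspaceD:
  assumes "closed_linear_subspace N V S"
  shows "S \<subseteq> V" "(\<lambda>y. 0) \<in> S" "v \<in> S \<Longrightarrow> v' \<in> S \<Longrightarrow> (\<lambda>y. v y + v' y) \<in> S" "v \<in> S \<Longrightarrow> (\<lambda>y. t *\<^sub>R v y) \<in> S"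
    "\<forall>s v. (\<forall>k::nat. s k \<in> S) \<longrightarrow> v \<in> V \<longrightarrow> (\<lambda>k. N (\<lambda>y. s k y - v y)) \<longlonglongrightarrow> 0 \<longrightarrow> v \<in> S"
  using assms by (simp_all add: closed_linear_subspace_def)

lemma closed_linear_subspace_limit:
  assumes "closed_linear_subspace N V S" "\<And>k::nat. s k \<in> S" "v \<in> V" "(\<lambda>k. N (\<lambda>y. s k y - v y)) \<longlonglongrightarrow> 0"
  shows "v \<in> S"
  using spec[OF spec[OF closed_linear_subspaceD(5)[OF assms(1)], of s], of v] assms(2-4) by simp

lemma closed_graph:
  assumes S: "closed_linear_subspace H1norm V S" and V: "V \<subseteq> H1_per" "closed (graph V)"
  shows "closed (graph S)"
  unfolding closed_sequential_limits
proof (intro allI impI, elim conjE)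
  fix p l assume p: "\<forall>k. p k \<in> graph S" "p \<longlonglongrightarrow> l"
  note SV = closed_linear_subspaceD(1)[OF S]
  have "\<forall>k. \<exists>v. v \<in> S \<and> p k = (l2_of v, l2_of (wgrad v))" using p(1) by (auto simp: graph_def)
  then obtain v where v: "\<And>k. v k \<in> S" "\<And>k. p k = (l2_of (v k), l2_of (wgrad (v k)))" by metis
  have "\<forall>k. p k \<in> graph V" using p(1) SV by (auto simp: graph_def)
  then have "l \<in> graph V" using V(2) p(2) unfolding closed_sequential_limits by blast
  then obtain u where u: "u \<in> V" "l = (l2_of u, l2_of (wgrad u))" by (auto simp: graph_def)
  have "(\<lambda>k. norm (p k - l)) \<longlonglongrightarrow> 0" using p(2) by (simp add: LIM_zero tendsto_norm_zero)
  moreover have "norm (p k - l) = H1norm (\<lambda>y. v k y - u y)" for k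
    unfolding v(2) u(2) using v(1)[of k] u(1) SV V(1) by (intro graph_norm_eq_H1norm) auto
  ultimately have "u \<in> S" using closed_linear_subspace_limit[OF S v(1) u(1)] by simp
  then show "l \<in> graph S" using u(2) by (simp add: graph_def)
qed

text \<open>A constant sequence at distance zero converges to \<open>v'\<close>, so closedness
  absorbs the functions that agree with \<open>v\<close> almost everywhere.\<close>

lemma closed_linear_subspace_saturated:
  assumes S: "closed_linear_subspace H1norm V S" and V: "V \<subseteq> H1_per"
    and v: "v \<in> S" "v' \<in> V" "(l2_of v, l2_of (wgrad v)) = (l2_of v', l2_of (wgrad v'))"
  shows "v' \<in> S"
proof (rule closed_linear_subspace_limit[OF S])
  have "H1norm (\<lambda>y. v y - v' y) = norm ((l2_of v, l2_of (wgrad v)) - (l2_of v', l2_of (wgrad v')))"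
    using v closed_linear_subspaceD(1)[OF S] V by (intro graph_norm_eq_H1norm[symmetric]) auto
  then have "H1norm (\<lambda>y. v y - v' y) = 0" unfolding v(3) by simp
  then show "(\<lambda>k. H1norm (\<lambda>y. v y - v' y)) \<longlonglongrightarrow> 0" by simp
qed (use v in auto)

text \<open>A class in both graphs may be realised by different functions. By saturation of
  \<open>U\<close>, the representative from \<open>M\<close> lies in \<open>U\<close> as
  well.\<close>

lemma graph_Int:
  assumes U: "closed_linear_subspace H1norm H1_per U" and M: "closed_linear_subspace H1norm W_per M"
  shows "graph (U \<inter> M) = graph U \<inter> graph M"
proof
  show "graph U \<inter> graph M \<subseteq> graph (U \<inter> M)"
  proof
    fix p assume "p \<in> graph U \<inter> graph M"
    then obtain u m where u: "u \<in> U" "p = (l2_of u, l2_of (wgrad u))" and m: "m \<in> M" "p = (l2_of m, l2_of (wgrad m))"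
      by (auto simp: graph_def)
    have "m \<in> H1_per" using m(1) closed_linear_subspaceD(1)[OF M] W_per_H1_per by blast
    then have "m \<in> U" using closed_linear_subspace_saturated[OF U subset_refl u(1)] u(2) m(2) by simp
    then show "p \<in> graph (U \<inter> M)" using m by (auto simp: graph_def)
  qed
qed (auto simp: graph_def)

text \<open>Membership can be tested row by row, and taking a row is continuous on classes. Thus the
  graph is an intersection of preimages of the closed scalar graph.\<close>

lemma closed_graph_vec_W_per_vec: "closed (graph_vec (W_per_vec :: (real ^ 'n \<Rightarrow> real ^ 'n) set))"
proof -
  let ?row = "\<lambda>i :: 'n. l2_map (\<lambda>A :: real ^ 'n ^ 'n. A $ i)"
  have lin: "bounded_linear (\<lambda>A :: real ^ 'n ^ 'n. A $ i)" for i by (rule bounded_linear_vec_nth)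
  have "graph_vec (W_per_vec :: (real ^ 'n \<Rightarrow> real ^ 'n) set) = (\<Inter>i. {p. (nth_l2 i (fst p), ?row i (snd p)) \<in> graph W_per})"
  proof (intro equalityI subsetI)
    fix p :: "('n, real ^ 'n) l2 \<times> ('n, real ^ 'n ^ 'n) l2" assume "p \<in> graph_vec W_per_vec"
    then obtain w where w: "w \<in> W_per_vec" "p = (l2_of w, l2_of (Jac w))" by (auto simp: graph_vec_def)
    have "(nth_l2 i (fst p), ?row i (snd p)) = (l2_of (\<lambda>y. w y $ i), l2_of (wgrad (\<lambda>y. w y $ i)))" for i
      by (simp add: w l2_map_l2_of lin bounded_linear_vec_nth W_per_vec_L2 Jac_L2)
    then show "p \<in> (\<Inter>i. {p. (nth_l2 i (fst p), ?row i (snd p)) \<in> graph W_per})"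
      using W_per_vecD[OF w(1)] by (auto simp: graph_def)
  next
    fix p :: "('n, real ^ 'n) l2 \<times> ('n, real ^ 'n ^ 'n) l2"
    assume p: "p \<in> (\<Inter>i. {p. (nth_l2 i (fst p), ?row i (snd p)) \<in> graph W_per})"
    let ?w = "rep_l2 (fst p)" and ?K = "rep_l2 (snd p)"
    note wi = L2_nth[OF rep_l2_mem, of "fst p"] and Ki = L2_bounded_linear[OF lin rep_l2_mem, of "snd p"]
    have comp: "(\<lambda>y. ?w y $ i) \<in> W_per \<and> (AE y in cellM. wgrad (\<lambda>y. ?w y $ i) y = ?K y $ i)" for i
    proof -
      have "(nth_l2 i (l2_of ?w), ?row i (l2_of ?K)) \<in> graph W_per" using p by simp
      then have g: "(l2_of (\<lambda>y. ?w y $ i), l2_of (\<lambda>y. ?K y $ i)) \<in> graph W_per"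
        by (simp only: l2_map_l2_of[OF bounded_linear_vec_nth rep_l2_mem] l2_map_l2_of[OF lin rep_l2_mem])
      then have "(l2_of (\<lambda>y. ?w y $ i), l2_of (\<lambda>y. ?K y $ i)) \<in> closure smooth_graph"
        unfolding graph_H1_per[symmetric] by (auto simp: graph_def W_per_def)
      note c = closure_graph_H1_per[OF this wi Ki]
      obtain v where v: "v \<in> W_per" "l2_of (\<lambda>y. ?w y $ i) = l2_of v" using g by (auto simp: graph_def)
      have "(\<integral>y. ?w y $ i \<partial>cellM) = (\<integral>y. v y \<partial>cellM)"
        using v by (simp add: mean_eq_inner wi H1_per_L2 W_per_H1_per)
      then show ?thesis using c(1) v(1) wgrad_AE[OF wi c(2)] by (simp add: W_per_def)
    qed
    then have w: "?w \<in> W_per_vec" by (simp add: W_per_vec_def)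
    have "AE y in cellM. \<forall>i. wgrad (\<lambda>y. ?w y $ i) y = ?K y $ i" using comp by (simp add: AE_all_countable)
    then have "AE y in cellM. Jac ?w y = ?K y" by eventually_elim (simp add: vec_eq_iff[of "Jac _ _"])
    then have "l2_of (Jac ?w) = l2_of ?K" using l2_of_eq_iff[OF Jac_L2[OF w] rep_l2_mem] by blast
    then have "p = (l2_of ?w, l2_of (Jac ?w))" by (simp add: prod_eq_iff)
    then show "p \<in> graph_vec W_per_vec" using w unfolding graph_vec_def image_def by blast
  qed
  moreover have "closed {p. (nth_l2 i (fst p), ?row i (snd p)) \<in> graph W_per}" for i
  proof -
    have "continuous_on UNIV (\<lambda>p. (nth_l2 i (fst p), ?row i (snd p)))"
      by (intro continuous_intros continuous_on_l2_map lin bounded_linear_vec_nth)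
    from closed_vimage[OF closed_graph_W_per this] show ?thesis by (simp add: vimage_def)
  qed
  ultimately show ?thesis by (simp add: closed_INT)
qed

lemma closed_graph_vec:
  assumes S: "closed_linear_subspace H1norm_vec W_per_vec S"
  shows "closed (graph_vec S)"
  unfolding closed_sequential_limits
proof (intro allI impI, elim conjE)
  fix p l assume p: "\<forall>k. p k \<in> graph_vec S" "p \<longlonglongrightarrow> l"
  note SV = closed_linear_subspaceD(1)[OF S]
  have "\<forall>k. \<exists>v. v \<in> S \<and> p k = (l2_of v, l2_of (Jac v))" using p(1) by (auto simp: graph_vec_def)
  then obtain v where v: "\<And>k. v k \<in> S" "\<And>k. p k = (l2_of (v k), l2_of (Jac (v k)))" by metis
  have "\<forall>k. p k \<in> graph_vec W_per_vec" using p(1) SV by (auto simp: graph_vec_def)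
  then have "l \<in> graph_vec W_per_vec"
    using closed_graph_vec_W_per_vec p(2) unfolding closed_sequential_limits by blast
  then obtain u where u: "u \<in> W_per_vec" "l = (l2_of u, l2_of (Jac u))" by (auto simp: graph_vec_def)
  have "(\<lambda>k. norm (p k - l)) \<longlonglongrightarrow> 0" using p(2) by (simp add: LIM_zero tendsto_norm_zero)
  moreover have "norm (p k - l) = H1norm_vec (\<lambda>y. v k y - u y)" for k
    unfolding v(2) u(2) using v(1)[of k] u(1) SV by (intro graph_vec_norm_eq_H1norm_vec) auto
  ultimately have "u \<in> S" using closed_linear_subspace_limit[OF S v(1) u(1)] by simp
  then show "l \<in> graph_vec S" using u(2) by (simp add: graph_vec_def)
qed


section \<open>Embedding of the mixed formulation\<close>

definition emb :: "(real ^ 'n \<Rightarrow> real ^ 'n) \<Rightarrow> (real ^ 'n \<Rightarrow> real) \<Rightarrow> ('n::finite) tuple" where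
  "emb w u = (l2_of w, l2_of (Jac w), l2_of u, l2_of (wgrad u))"

lemma emb_components [simp]:
  "om (emb w u) = l2_of w" "Om (emb w u) = l2_of (Jac w)" "up (emb w u) = l2_of u" "gr (emb w u) = l2_of (wgrad u)"
  by (simp_all add: emb_def components)

lemma emb_diff:
  assumes "w \<in> W_per_vec" "w' \<in> W_per_vec" "u \<in> H1_per" "u' \<in> H1_per"
  shows "emb (\<lambda>y. w y - w' y) (\<lambda>y. u y - u' y) = emb w u - emb w' u'"
proof -
  note d = W_per_vec_diff[OF assms(1,2)] and e = H1_per_diff[OF assms(3,4)]
  have "l2_of (Jac (\<lambda>y. w y - w' y)) = l2_of (\<lambda>y. Jac w y - Jac w' y)"
    using l2_of_eq_iff[OF Jac_L2[OF d(1)] L2_diff[OF assms(1,2)[THEN Jac_L2]]] d(2) by blast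
  moreover have "l2_of (wgrad (\<lambda>y. u y - u' y)) = l2_of (\<lambda>y. wgrad u y - wgrad u' y)"
    using l2_of_eq_iff[OF H1_per_wgrad_L2[OF e(1)] L2_diff[OF assms(3,4)[THEN H1_per_wgrad_L2]]] e(2) by blast
  ultimately show ?thesis
    using assms by (simp add: emb_def l2_of_diff H1_per_L2 H1_per_wgrad_L2 Jac_L2 W_per_vec_L2)
qed

lemma W_per_vec_scale:
  assumes "w \<in> W_per_vec"
  shows "(\<lambda>y. t *\<^sub>R w y) \<in> W_per_vec" "AE y in cellM. Jac (\<lambda>y. t *\<^sub>R w y) y = t *\<^sub>R Jac w y"
proof -
  show "(\<lambda>y. t *\<^sub>R w y) \<in> W_per_vec"
    using H1_per_scale(1)[OF W_per_vec_H1_per[OF assms]] W_per_vecD[OF assms] by (simp add: W_per_vec_def W_per_def)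
  have "AE y in cellM. \<forall>i. wgrad (\<lambda>y. t * w y $ i) y = t *\<^sub>R wgrad (\<lambda>y. w y $ i) y"
    using H1_per_scale(2)[OF W_per_vec_H1_per[OF assms]] by (simp add: AE_all_countable)
  then show "AE y in cellM. Jac (\<lambda>y. t *\<^sub>R w y) y = t *\<^sub>R Jac w y"
    by eventually_elim (simp add: vec_eq_iff[of "Jac _ _"])
qed

lemma emb_scale:
  assumes "w \<in> W_per_vec" "u \<in> H1_per"
  shows "emb (\<lambda>y. t *\<^sub>R w y) (\<lambda>y. t *\<^sub>R u y) = t *\<^sub>R emb w u"
proof -
  note d = W_per_vec_scale[OF assms(1), of t] and e = H1_per_scale[OF assms(2), of t]
  have "l2_of (Jac (\<lambda>y. t *\<^sub>R w y)) = l2_of (\<lambda>y. t *\<^sub>R Jac w y)"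
    using l2_of_eq_iff[OF Jac_L2[OF d(1)] L2_scaleR[OF Jac_L2[OF assms(1)]]] d(2) by blast
  moreover have "l2_of (wgrad (\<lambda>y. t *\<^sub>R u y)) = l2_of (\<lambda>y. t *\<^sub>R wgrad u y)"
    using l2_of_eq_iff[OF H1_per_wgrad_L2[OF e(1)] L2_scaleR[OF H1_per_wgrad_L2[OF assms(2)]]] e(2) by simp
  ultimately show ?thesis
    using assms l2_of_scaleR[OF H1_per_L2[OF assms(2)], of t]
    by (simp add: emb_def l2_of_scaleR H1_per_L2 H1_per_wgrad_L2 Jac_L2 W_per_vec_L2)
qed

lemma emb_eq_iff:
  assumes "w \<in> W_per_vec" "w' \<in> W_per_vec" "u \<in> H1_per" "u' \<in> H1_per" "emb w u = emb w' u'"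
  shows "AE y in cellM. w y = w' y" "AE y in cellM. u y = u' y"
  using assms l2_of_eq_iff[OF W_per_vec_L2 W_per_vec_L2, of w w'] l2_of_eq_iff[OF H1_per_L2 H1_per_L2, of u u']
  by (auto simp: emb_def)

lemma zero_W_per_vec: "(\<lambda>y. 0) \<in> W_per_vec"
  by (simp add: W_per_vec_def W_per_def H1_per_0)

lemma emb_zero: "emb (\<lambda>y. 0 :: real ^ 'n) (\<lambda>y. 0) = 0"
  using emb_diff[OF zero_W_per_vec zero_W_per_vec H1_per_0 H1_per_0] by simp

lemma Om_emb_zero: "Om (emb (\<lambda>y. 0 :: real ^ 'n) m) = 0" "om (emb (\<lambda>y. 0 :: real ^ 'n) m) = 0"
  using arg_cong[OF emb_zero, of Om] by (simp_all add: l2_of_zero)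

definition emb_set :: "(real ^ 'n \<Rightarrow> real ^ 'n) set \<Rightarrow> (real ^ 'n \<Rightarrow> real) set \<Rightarrow> ('n::finite) tuple set" where
  "emb_set W U = {emb w u |w u. w \<in> W \<and> u \<in> U}"

lemma subspace_emb_set:
  fixes W :: "(real ^ 'n \<Rightarrow> real ^ 'n) set"
  assumes sub: "W \<subseteq> W_per_vec" "U \<subseteq> H1_per"
    and W: "(\<lambda>y. 0) \<in> W" "\<And>v v'. v \<in> W \<Longrightarrow> v' \<in> W \<Longrightarrow> (\<lambda>y. v y + v' y) \<in> W" "\<And>t v. v \<in> W \<Longrightarrow> (\<lambda>y. t *\<^sub>R v y) \<in> W"
    and U: "(\<lambda>y. 0) \<in> U" "\<And>v v'. v \<in> U \<Longrightarrow> v' \<in> U \<Longrightarrow> (\<lambda>y. v y + v' y) \<in> U" "\<And>t v. v \<in> U \<Longrightarrow> (\<lambda>y. t *\<^sub>R v y) \<in> U"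
  shows "subspace (emb_set W U)"
proof (rule subspaceI)
  show "0 \<in> emb_set W U" unfolding emb_set_def using W(1) U(1) emb_zero[symmetric] by blast
next
  fix c x assume "x \<in> emb_set W U"
  then obtain w u where x: "w \<in> W" "u \<in> U" "x = emb w u" by (auto simp: emb_set_def)
  then have "c *\<^sub>R x = emb (\<lambda>y. c *\<^sub>R w y) (\<lambda>y. c *\<^sub>R u y)"
    unfolding x(3) using sub by (intro emb_scale[symmetric]) auto
  then show "c *\<^sub>R x \<in> emb_set W U" using W(3) U(3) x unfolding emb_set_def by blast
next
  fix x x' assume "x \<in> emb_set W U" "x' \<in> emb_set W U"
  then obtain w u w' u' where x: "w \<in> W" "u \<in> U" "x = emb w u" and x': "w' \<in> W" "u' \<in> U" "x' = emb w' u'"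
    by (auto simp: emb_set_def)
  let ?w = "\<lambda>y. (-1) *\<^sub>R w' y" and ?u = "\<lambda>y. (-1) *\<^sub>R u' y"
  have mem: "w \<in> W_per_vec" "u \<in> H1_per" using x sub by auto
  note mem' = subsetD[OF sub(1) W(3)[OF x'(1), of "-1"]] subsetD[OF sub(2) U(3)[OF x'(2), of "-1"]]
  have "x + x' = x - (-1) *\<^sub>R x'" by simp
  also have "\<dots> = emb w u - emb ?w ?u" using x x' sub by (subst emb_scale) auto
  also have "\<dots> = emb (\<lambda>y. w y - ?w y) (\<lambda>y. u y - ?u y)" using mem mem' by (intro emb_diff[symmetric])
  also have "\<dots> = emb (\<lambda>y. w y + w' y) (\<lambda>y. u y + u' y)" by simp
  finally show "x + x' \<in> emb_set W U" using W(2)[OF x(1) x'(1)] U(2)[OF x(2) x'(2)] unfolding emb_set_def by blast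
qed

lemma closed_emb_set:
  fixes W :: "(real ^ 'n \<Rightarrow> real ^ 'n) set"
  assumes "closed (graph_vec W)" "closed (graph U)"
  shows "closed (emb_set W U)"
proof -
  have "emb_set W U = {h. (om h, Om h) \<in> graph_vec W} \<inter> {h. (up h, gr h) \<in> graph U}"
    by (auto simp: emb_set_def emb_def graph_def graph_vec_def components prod_eq_iff image_iff)
  moreover have "closed {h :: 'n tuple. (om h, Om h) \<in> graph_vec W}"
  proof -
    have "continuous_on UNIV (\<lambda>h :: 'n tuple. (om h, Om h))" unfolding components by (intro continuous_intros)
    from closed_vimage[OF assms(1) this] show ?thesis by (simp add: vimage_def)
  qed
  moreover have "closed {h :: 'n tuple. (up h, gr h) \<in> graph U}"
  proof -
    have "continuous_on UNIV (\<lambda>h :: 'n tuple. (up h, gr h))" unfolding components by (intro continuous_intros)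
    from closed_vimage[OF assms(2) this] show ?thesis by (simp add: vimage_def)
  qed
  ultimately show ?thesis by (simp add: closed_Int)
qed

context Cordes_coefficients
begin

lemma triple_norm_emb:
  assumes "w \<in> W_per_vec" "u \<in> H1_per"
  shows "triple_norm lam (w, u) = Nh (emb w u)"
  using assms by (simp add: triple_norm_def Nh_def norm_l2_of H1_per_L2 H1_per_wgrad_L2 Jac_L2)

lemma l2_map_trace_Jac:
  fixes w :: "'n rvec \<Rightarrow> 'n rvec"
  assumes "w \<in> W_per_vec"
  shows "l2_map trace (l2_of (Jac w)) = l2_of (divergence w)"
proof -
  have "trace (Jac w y) = divergence w y" for y by (simp add: trace_def divergence_def)
  then show ?thesis using l2_map_l2_of[OF trace_bounded_linear Jac_L2[OF assms]] by simp
qed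

lemma Lh_emb:
  assumes "w \<in> W_per_vec" "u \<in> H1_per"
  shows "Lh (emb w u) = l2_of (L_op lam (w, u))"
proof -
  have "l2_of (L_op lam (w, u)) = l2_of (\<lambda>y. lam *\<^sub>R u y - divergence w y)"
    by (simp add: L_op_def)
  also have "\<dots> = lam *\<^sub>R l2_of u - l2_of (divergence w)"
    using assms by (simp only: l2_of_diff[OF L2_scaleR[OF H1_per_L2] divergence_L2] l2_of_scaleR[OF H1_per_L2])
  finally show ?thesis using assms by (simp add: Lh_def l2_map_trace_Jac)
qed

lemma inner_rh_emb:
  fixes w w' :: "'n rvec \<Rightarrow> 'n rvec"
  assumes "w \<in> W_per_vec" "w' \<in> W_per_vec"
  shows "rh (emb w u) \<bullet> Om (emb w' u') = (\<integral>y. rot_dot w w' y \<partial>cellM)"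
proof -
  have "rh (emb w u) = l2_of (\<lambda>y. Jac w y - transpose (Jac w y))"
    using assms by (simp add: rh_def l2_map_l2_of transpose_bounded_linear Jac_L2 l2_of_diff L2_transpose)
  then have "rh (emb w u) \<bullet> Om (emb w' u') = (\<integral>y. (Jac w y - transpose (Jac w y)) \<bullet> Jac w' y \<partial>cellM)"
    using assms by (simp add: inner_l2_of L2_diff Jac_L2 L2_transpose)
  also have "\<dots> = (\<integral>y. rot_dot w w' y \<partial>cellM)"
    by (intro Bochner_Integration.integral_cong refl)
       (simp only: rot_dot_eq[OF dim] inner_diff_left inner_diff_right inner_transpose)
  finally show ?thesis .
qed

lemma compatible_emb:
  assumes w: "w \<in> W_per_vec" and u: "u \<in> H1_per"
  shows "compatible (emb w u)"
  unfolding compatible_def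
proof (intro conjI)
  show "rh (emb w u) \<bullet> Om (emb w u) + (norm (l2_map trace (Om (emb w u))))\<^sup>2 = (norm (Om (emb w u)))\<^sup>2"
    unfolding inner_rh_emb[OF w w] using div_rot_identity[OF dim w]
    by (simp add: l2_map_trace_Jac w norm_l2_of divergence_L2 Jac_L2)
  show "(norm (Lh (emb w u)))\<^sup>2 = (norm (l2_map trace (Om (emb w u))))\<^sup>2 + 2 * lam * (gr (emb w u) \<bullet> om (emb w u)) + lam\<^sup>2 * (norm (up (emb w u)))\<^sup>2"
    using L_op_square[OF w u, of lam]
    by (simp add: Lh_emb w u l2_map_trace_Jac norm_l2_of L_op_L2 divergence_L2 H1_per_L2 inner_l2_of H1_per_wgrad_L2 W_per_vec_L2)
  show "(norm (om (emb w u)))\<^sup>2 \<le> real CARD('n) / 16 * (norm (Om (emb w u)))\<^sup>2"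
    using Poincare_W_per_vec[OF w] by (simp add: norm_l2_of W_per_vec_L2 Jac_L2 w)
qed

lemma FH_emb:
  assumes w: "w \<in> W_per_vec" and u: "u \<in> H1_per"
  shows "F_gamma lam A b c f (w, u) \<in> L2" "FH (emb w u) = l2_of (F_gamma lam A b c f (w, u))"
proof -
  have eq: "F_gamma lam A b c f (w, u) = (\<lambda>y. Fpt y (Jac w y) (wgrad u y) (u y))"
    by (simp add: fun_eq_iff F_gamma_eq)
  show "F_gamma lam A b c f (w, u) \<in> L2"
    unfolding eq by (intro Fpt_L2 Jac_L2 H1_per_wgrad_L2 H1_per_L2 w u)
  show "FH (emb w u) = l2_of (F_gamma lam A b c f (w, u))"
    unfolding eq emb_def by (intro FH_l2_of Jac_L2 H1_per_wgrad_L2 H1_per_L2 w u)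
qed

lemma qh_emb:
  assumes "w \<in> W_per_vec" "u \<in> H1_per"
  shows "(\<lambda>y. wgrad u y - w y) \<in> L2" "qh (emb w u) = l2_of (\<lambda>y. wgrad u y - w y)"
  using assms by (auto simp: qh_def l2_of_diff H1_per_wgrad_L2 W_per_vec_L2 intro: L2_diff)

lemma form_a_emb:
  assumes "w \<in> W_per_vec" "u \<in> H1_per" "w' \<in> W_per_vec" "u' \<in> H1_per"
  shows "form_a lam \<delta> A b c f (w, u) (w', u') = ah (emb w u) (emb w' u')"
  unfolding ah_def inner_rh_emb[OF assms(1,3)] FH_emb(2)[OF assms(1,2)] Lh_emb[OF assms(3,4)]
    qh_emb(2)[OF assms(1,2)] qh_emb(2)[OF assms(3,4)]
  by (simp add: form_a_def inner_l2_of FH_emb qh_emb L_op_L2 assms)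

lemma form_b_emb:
  assumes "m \<in> H1_per" "w \<in> W_per_vec" "u \<in> H1_per"
  shows "form_b m (w, u) = gr (emb (\<lambda>y. 0) m) \<bullet> qh (emb w u)"
  using assms by (simp add: form_b_def qh_emb inner_l2_of H1_per_wgrad_L2)

end


section \<open>Well-posedness and quasi-optimality in Hilbert space\<close>

context Cordes_coefficients
begin

definition norm_equiv :: real where
  "norm_equiv = 1 + real CARD('n) / 16 + 1 / lam\<^sup>2 + 1 / (2 * lam)"

lemma norm_equiv_pos: "0 < norm_equiv"
  unfolding norm_equiv_def using lam_pos by (intro add_pos_nonneg) auto

text \<open>\<open>Nh\<close> does not see the component \<open>om\<close>; Poincare's inequality
  recovers it from \<open>Om\<close>.\<close>

lemma norm_le_Nh:
  assumes "compatible h"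
  shows "(norm h)\<^sup>2 \<le> norm_equiv * (Nh h)\<^sup>2"
proof -
  have nonneg: "0 \<le> 2 * lam * (norm (gr h))\<^sup>2" "0 \<le> lam\<^sup>2 * (norm (up h))\<^sup>2" "0 \<le> (norm (Om h))\<^sup>2"
    using lam_pos by auto
  have O: "(norm (Om h))\<^sup>2 \<le> (Nh h)\<^sup>2" and u: "lam\<^sup>2 * (norm (up h))\<^sup>2 \<le> (Nh h)\<^sup>2"
    and g: "2 * lam * (norm (gr h))\<^sup>2 \<le> (Nh h)\<^sup>2"
    unfolding Nh_square using nonneg by linarith+
  have o: "(norm (om h))\<^sup>2 \<le> real CARD('n) / 16 * (Nh h)\<^sup>2"
    by (rule order_trans[OF compatibleD(3)[OF assms] mult_left_mono[OF O]]) simp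
  have u': "(norm (up h))\<^sup>2 \<le> 1 / lam\<^sup>2 * (Nh h)\<^sup>2" using u lam_pos by (simp add: pos_le_divide_eq mult.commute)
  have g': "(norm (gr h))\<^sup>2 \<le> 1 / (2 * lam) * (Nh h)\<^sup>2" using g lam_pos by (simp add: pos_le_divide_eq mult_ac)
  show ?thesis
    unfolding tuple_norm_square norm_equiv_def distrib_right using O o u' g' by linarith
qed

lemma Nh_le_norm: "(Nh h)\<^sup>2 \<le> (1 + 2 * lam + lam\<^sup>2) * (norm h)\<^sup>2"
proof -
  have le: "(norm (Om h))\<^sup>2 \<le> (norm h)\<^sup>2" "(norm (gr h))\<^sup>2 \<le> (norm h)\<^sup>2" "(norm (up h))\<^sup>2 \<le> (norm h)\<^sup>2"
    unfolding tuple_norm_square by auto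
  have "2 * lam * (norm (gr h))\<^sup>2 \<le> 2 * lam * (norm h)\<^sup>2" "lam\<^sup>2 * (norm (up h))\<^sup>2 \<le> lam\<^sup>2 * (norm h)\<^sup>2"
    using le lam_pos by (auto intro!: mult_left_mono simp del: norm_scaleR)
  then show ?thesis unfolding Nh_square distrib_right using le(1) by linarith
qed

lemma Nh_eq_norm: "Nh h = norm (Om h, sqrt (2 * lam) *\<^sub>R gr h, lam *\<^sub>R up h)"
  using lam_pos by (simp add: Nh_def norm_prod_def power_mult_distrib)

lemma Nh_triangle: "Nh (h + k) \<le> Nh h + Nh k"
  using norm_triangle_ineq[of "(Om h, sqrt (2 * lam) *\<^sub>R gr h, lam *\<^sub>R up h)" "(Om k, sqrt (2 * lam) *\<^sub>R gr k, lam *\<^sub>R up k)"]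
  by (simp add: Nh_eq_norm scaleR_add_right)

lemma Nh_minus_commute: "Nh (h - k) = Nh (k - h)"
  unfolding Nh_def by (simp add: norm_minus_commute)

text \<open>What the abstract argument requires of the embedded discrete spaces. A multiplier
  \<open>m\<close> enters as the pair \<open>(0, m)\<close>, which is why its first two components
  vanish and why \<open>Q \<subseteq> S\<close> is meaningful; the final bound is Poincare's
  inequality for \<open>m\<close>.\<close>

definition mixed_spaces :: "'n tuple set \<Rightarrow> 'n tuple set \<Rightarrow> bool" where
  "mixed_spaces S Q \<longleftrightarrow> subspace S \<and> closed S \<and> subspace Q \<and> closed Q \<and> Q \<subseteq> S \<and> (\<forall>h\<in>S. compatible h) \<and>
     (\<forall>m\<in>Q. om m = 0 \<and> Om m = 0 \<and> (norm (up m))\<^sup>2 \<le> real CARD('n) / 16 * (norm (gr m))\<^sup>2)"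

lemma mixed_spacesD:
  assumes "mixed_spaces S Q"
  shows "subspace S" "closed S" "subspace Q" "closed Q" "Q \<subseteq> S" "h \<in> S \<Longrightarrow> compatible h"
    "m \<in> Q \<Longrightarrow> qh m = gr m" "m \<in> Q \<Longrightarrow> Om m = 0" "m \<in> Q \<Longrightarrow> om m = 0"
    "m \<in> Q \<Longrightarrow> (norm (up m))\<^sup>2 \<le> real CARD('n) / 16 * (norm (gr m))\<^sup>2"
  using assms by (auto simp: mixed_spaces_def qh_def)

lemma TH_lipschitz:
  assumes "mixed_spaces S Q" "x \<in> S" "y \<in> S" "k \<in> S"
  shows "\<bar>(TH x - TH y) \<bullet> k\<bar> \<le> C_L CARD('n) lam \<delta> * (1 + 2 * lam + lam\<^sup>2) * norm (x - y) * norm k"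
proof -
  let ?K = "1 + 2 * lam + lam\<^sup>2"
  have K: "0 \<le> ?K" using lam_pos by simp
  have N: "Nh h \<le> sqrt ?K * norm h" for h
    by (rule power2_le_imp_le) (use Nh_le_norm[of h] K in \<open>simp_all add: power_mult_distrib\<close>)
  have CL: "0 \<le> C_L CARD('n) lam \<delta>"
    unfolding C_L_def using sigma_nonneg kappa lam_pos by (intro add_nonneg_nonneg mult_nonneg_nonneg) auto
  have "\<bar>(TH x - TH y) \<bullet> k\<bar> \<le> C_L CARD('n) lam \<delta> * (Nh (x - y) * Nh k)"
    using lipschitz_continuity[of x y k] mixed_spacesD(6)[OF assms(1)] subspace_diff[OF mixed_spacesD(1)[OF assms(1)]] assms
    by (simp add: inner_diff_left inner_TH mult.assoc)
  also have "\<dots> \<le> C_L CARD('n) lam \<delta> * ((sqrt ?K * norm (x - y)) * (sqrt ?K * norm k))"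
    using K by (intro mult_left_mono mult_mono N CL) auto
  also have "\<dots> = C_L CARD('n) lam \<delta> * (sqrt ?K * sqrt ?K) * norm (x - y) * norm k" by (simp only: mult_ac)
  also have "sqrt ?K * sqrt ?K = ?K" using K by simp
  finally show ?thesis .
qed

lemma TH_strongly_monotone:
  assumes "mixed_spaces S Q" "x \<in> S" "y \<in> S"
  shows "C_M \<delta> / norm_equiv * (norm (x - y))\<^sup>2 \<le> (TH x - TH y) \<bullet> (x - y)"
proof -
  have c: "compatible (x - y)"
    using mixed_spacesD(6)[OF assms(1)] subspace_diff[OF mixed_spacesD(1)[OF assms(1)]] assms by blast
  have CM: "0 \<le> C_M \<delta>" unfolding C_M_def using kappa by simp
  have "C_M \<delta> / norm_equiv * (norm (x - y))\<^sup>2 \<le> C_M \<delta> / norm_equiv * (norm_equiv * (Nh (x - y))\<^sup>2)"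
    using norm_le_Nh[OF c] CM norm_equiv_pos by (intro mult_left_mono) auto
  also have "\<dots> = C_M \<delta> * (Nh (x - y))\<^sup>2" using norm_equiv_pos by simp
  also have "\<dots> \<le> (TH x - TH y) \<bullet> (x - y)"
    using strong_monotonicity[OF c] by (simp add: inner_diff_left inner_TH)
  finally show ?thesis .
qed

lemma C_M_pos: "0 < C_M \<delta>"
  unfolding C_M_def using kappa by simp

lemma C_L_ge_2: "2 \<le> C_L CARD('n) lam \<delta>"
proof -
  have "0 \<le> sqrt 2 * sqrt (1 - \<delta>)" using kappa by simp
  moreover have "0 \<le> sigma2_tilde \<delta> * (1 / 2 + real CARD('n) / pi\<^sup>2 * lam)"
    using sigma_nonneg lam_pos by (intro mult_nonneg_nonneg add_nonneg_nonneg) auto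
  ultimately show ?thesis unfolding C_L_def using sigma_nonneg(1) by linarith
qed

lemma BH_coercive:
  assumes "mixed_spaces S Q" "m \<in> Q"
  shows "1 / (1 + real CARD('n) / 16) * (norm m)\<^sup>2 \<le> BH m \<bullet> m"
proof -
  have "(norm m)\<^sup>2 \<le> (1 + real CARD('n) / 16) * (norm (gr m))\<^sup>2"
    unfolding tuple_norm_square using mixed_spacesD(8,9,10)[OF assms(1), OF assms(2)] by (simp add: distrib_right)
  moreover have "BH m \<bullet> m = (norm (gr m))\<^sup>2"
    using mixed_spacesD(7)[OF assms(1), OF assms(2)] by (simp add: inner_BH power2_norm_eq_inner)
  moreover have "0 < 1 + real CARD('n) / 16" by (intro add_pos_nonneg) auto
  ultimately show ?thesis by (simp add: pos_divide_le_eq mult.commute)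
qed

lemma tuple_mixed_problem_solution:
  assumes SQ: "mixed_spaces S Q"
  shows "\<exists>m\<in>Q. \<exists>x\<in>S. (\<forall>z\<in>S. ah x z + gr m \<bullet> qh z = 0) \<and> (\<forall>m'\<in>Q. gr m' \<bullet> qh x = 0)"
proof -
  note D = mixed_spacesD[OF SQ]
  have "\<exists>m\<in>Q. \<exists>x\<in>S. (\<forall>z\<in>S. TH x \<bullet> z + BH m \<bullet> z = 0) \<and> (\<forall>m'\<in>Q. BH m' \<bullet> x = 0)"
  proof (rule mixed_problem_solution[OF D(1-5) _ TH_lipschitz[OF SQ] _ TH_strongly_monotone[OF SQ] bounded_linear_BH _ _ _ BH_coercive[OF SQ]])
    show "0 \<le> C_L CARD('n) lam \<delta> * (1 + 2 * lam + lam\<^sup>2)"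
      using C_L_ge_2 lam_pos by (intro mult_nonneg_nonneg) auto
    show "0 < C_M \<delta> / norm_equiv" using C_M_pos norm_equiv_pos by simp
    show "BH m \<bullet> z = m \<bullet> CH z" for m z by (simp add: inner_BH inner_CH)
    show "BH m \<bullet> m' = BH m' \<bullet> m" if "m \<in> Q" "m' \<in> Q" for m m'
      unfolding inner_BH D(7)[OF that(1)] D(7)[OF that(2)] by (rule inner_commute)
    show "0 < 1 / (1 + real CARD('n) / 16)" by (simp add: add_pos_nonneg)
  qed
  then show ?thesis by (simp add: inner_TH inner_BH)
qed

lemma tuple_mixed_problem_unique:
  assumes SQ: "mixed_spaces S Q"
    and m: "m \<in> Q" "x \<in> S" "\<And>z. z \<in> S \<Longrightarrow> ah x z + gr m \<bullet> qh z = 0" "\<And>m'. m' \<in> Q \<Longrightarrow> gr m' \<bullet> qh x = 0"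
    and m': "m' \<in> Q" "x' \<in> S" "\<And>z. z \<in> S \<Longrightarrow> ah x' z + gr m' \<bullet> qh z = 0" "\<And>m''. m'' \<in> Q \<Longrightarrow> gr m'' \<bullet> qh x' = 0"
  shows "m = m' \<and> x = x'"
proof (rule mixed_problem_unique[OF mixed_spacesD(1,3,5)[OF SQ] _ TH_strongly_monotone[OF SQ] bounded_linear_BH _ BH_coercive[OF SQ]])
  show "0 < C_M \<delta> / norm_equiv" using C_M_pos norm_equiv_pos by simp
  show "0 < 1 / (1 + real CARD('n) / 16)" by (simp add: add_pos_nonneg)
qed (use m m' in \<open>simp_all add: inner_TH inner_BH\<close>)

text \<open>Adding a suitable multiplier \<open>(0, p)\<close> to \<open>x'\<close> restores the discrete constraint at the cost of the
  factor \<open>1 + C\<^sub>b / c\<^sub>b\<close>; after that, the argument is that of Cea's lemma.\<close>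

lemma quasi_optimality:
  assumes SQ: "mixed_spaces S Q"
    and x: "\<And>y. y \<in> S \<Longrightarrow> compatible (x - y)" "\<And>z. z \<in> S \<Longrightarrow> ah x z = 0" "\<And>m'. m' \<in> Q \<Longrightarrow> gr m' \<bullet> qh x = 0"
    and m: "m \<in> Q" "xh \<in> S" "\<And>z. z \<in> S \<Longrightarrow> ah xh z + gr m \<bullet> qh z = 0" "\<And>m'. m' \<in> Q \<Longrightarrow> gr m' \<bullet> qh xh = 0"
    and x': "x' \<in> S"
  shows "Nh (x - xh) \<le> C_e CARD('n) lam \<delta> * Nh (x - x')"
proof -
  note D = mixed_spacesD[OF SQ]
  let ?Cb = "C_b CARD('n) lam" and ?cb = "c_b CARD('n) lam" and ?CL = "C_L CARD('n) lam \<delta>"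
  have "\<exists>p\<in>Q. \<forall>m'\<in>Q. (BH p - CH (x - x')) \<bullet> m' = 0"
  proof (rule strongly_monotone_variational_solution[OF D(3,4) onorm_pos_le[OF bounded_linear_BH[where 'n = 'n]]])
    fix p q k :: "'n tuple"
    have "BH p - CH (x - x') - (BH q - CH (x - x')) = BH (p - q)"
      using linear_diff[OF bounded_linear.linear[OF bounded_linear_BH], of p q] by simp
    note eq = this
    show "\<bar>(BH p - CH (x - x') - (BH q - CH (x - x'))) \<bullet> k\<bar> \<le> onorm (BH :: 'n tuple \<Rightarrow> _) * norm (p - q) * norm k"
    proof -
      have "norm (BH (p - q)) * norm k \<le> onorm (BH :: 'n tuple \<Rightarrow> _) * norm (p - q) * norm k"
        by (intro mult_right_mono onorm[OF bounded_linear_BH]) simp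
      then show ?thesis unfolding eq by (rule order_trans[OF Cauchy_Schwarz_ineq2])
    qed
    show "1 / (1 + real CARD('n) / 16) * (norm (p - q))\<^sup>2 \<le> (BH p - CH (x - x') - (BH q - CH (x - x'))) \<bullet> (p - q)"
      if "p \<in> Q" "q \<in> Q"
      unfolding eq by (rule BH_coercive[OF SQ subspace_diff[OF D(3) that]])
  qed (simp add: add_pos_nonneg)
  then obtain p where p: "p \<in> Q" "\<And>m'. m' \<in> Q \<Longrightarrow> gr p \<bullet> gr m' = gr m' \<bullet> qh (x - x')"
    using D(7) by (auto simp: inner_diff_left inner_BH inner_commute[of "CH _"] inner_CH)
  define z where "z = x' + p"
  have zS: "z \<in> S" unfolding z_def using x' p(1) D(5) by (intro subspace_add[OF D(1)]) auto
  have constraint: "gr m' \<bullet> qh z = 0" if "m' \<in> Q" for m'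
  proof -
    have "gr m' \<bullet> qh z = gr m' \<bullet> qh x' + gr m' \<bullet> gr p"
      using D(9)[OF p(1)] by (simp add: z_def qh_def inner_diff_right inner_add_right)
    also have "\<dots> = gr m' \<bullet> qh x" using p(2)[OF that] by (simp add: inner_commute[of "gr p"] inner_diff_right)
    finally show ?thesis using x(3)[OF that] by simp
  qed
  have "norm (gr p) * norm (gr p) \<le> norm (gr p) * norm (qh (x - x'))"
    using p(2)[OF p(1)] norm_cauchy_schwarz[of "gr p" "qh (x - x')"]
    by (simp add: power2_norm_eq_inner[symmetric] power2_eq_square)
  then have "norm (gr p) \<le> norm (qh (x - x'))" by (cases "norm (gr p) = 0") (auto simp: mult_le_cancel_left)
  also have "\<dots> \<le> ?Cb * Nh (x - x')" by (rule norm_qh_le[OF x(1)[OF x']])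
  finally have grp: "norm (gr p) \<le> ?Cb * Nh (x - x')" .
  \<comment> \<open>For a multiplier only the value and the gradient enter \<open>Nh\<close>, and
    Poincare's inequality bounds the value by the gradient. This is where \<open>c_b\<close> comes
    from.\<close>
  have "?cb * Nh p \<le> norm (gr p)"
  proof (rule power2_le_imp_le)
    have "(norm (up p))\<^sup>2 \<le> real CARD('n) / pi\<^sup>2 * (norm (gr p))\<^sup>2"
      by (rule order_trans[OF D(10)[OF p(1)] mult_right_mono[OF n16_le]]) simp
    then have "lam\<^sup>2 * (norm (up p))\<^sup>2 \<le> lam\<^sup>2 * (real CARD('n) / pi\<^sup>2 * (norm (gr p))\<^sup>2)" by (intro mult_left_mono) auto
    then have "(Nh p)\<^sup>2 \<le> (2 * lam + real CARD('n) / pi\<^sup>2 * lam\<^sup>2) * (norm (gr p))\<^sup>2"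
      unfolding Nh_square using D(8)[OF p(1)] by (simp add: algebra_simps)
    then have "?cb\<^sup>2 * (Nh p)\<^sup>2 \<le> ?cb\<^sup>2 * ((2 * lam + real CARD('n) / pi\<^sup>2 * lam\<^sup>2) * (norm (gr p))\<^sup>2)"
      by (intro mult_left_mono) auto
    also have "\<dots> = (norm (gr p))\<^sup>2" using c_b_square(1) by (simp only: mult.assoc[symmetric] mult_1)
    finally show "(?cb * Nh p)\<^sup>2 \<le> (norm (gr p))\<^sup>2" by (simp add: power_mult_distrib)
  qed simp
  then have "Nh p \<le> norm (gr p) / ?cb" using c_b_square(2) by (simp add: pos_le_divide_eq mult.commute)
  also have "\<dots> \<le> ?Cb * Nh (x - x') / ?cb" using grp c_b_square(2) by (intro divide_right_mono) auto
  finally have Np: "Nh p \<le> ?Cb / ?cb * Nh (x - x')" by simp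
  have "x - z = (x - x') + (0 - p)" by (simp add: z_def)
  then have "Nh (x - z) \<le> Nh (x - x') + Nh (0 - p)" using Nh_triangle by metis
  also have "\<dots> \<le> (1 + ?Cb / ?cb) * Nh (x - x')" using Np Nh_minus_commute[of 0 p] by (simp add: distrib_right)
  finally have xz: "Nh (x - z) \<le> (1 + ?Cb / ?cb) * Nh (x - x')" .
  define d where "d = xh - z"
  have dS: "d \<in> S" unfolding d_def by (rule subspace_diff[OF D(1) m(2) zS])
  have "C_M \<delta> * (Nh d)\<^sup>2 \<le> ah xh d - ah z d"
    unfolding d_def by (rule strong_monotonicity) (use dS D(6) in \<open>simp add: d_def\<close>)
  also have "\<dots> = ah x d - ah z d"
  proof -
    \<comment> \<open>Both \<open>xh\<close> and \<open>z\<close> satisfy the discrete constraint,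
      so the discrete multiplier drops out when tested with their difference.\<close>
    have "gr m \<bullet> qh d = 0" using m(4)[OF m(1)] constraint[OF m(1)] by (simp add: d_def inner_diff_right)
    then show ?thesis using m(3)[OF dS] x(2)[OF dS] by simp
  qed
  also have "\<dots> \<le> ?CL * Nh (x - z) * Nh d"
    using lipschitz_continuity[OF x(1)[OF zS] D(6)[OF dS]] by linarith
  finally have "C_M \<delta> * Nh d * Nh d \<le> ?CL * Nh (x - z) * Nh d" by (simp add: power2_eq_square mult.assoc)
  then have "C_M \<delta> * Nh d \<le> ?CL * Nh (x - z)"
    using C_L_ge_2 by (cases "Nh d = 0") (auto simp: mult_le_cancel_right less_le)
  then have Nd: "Nh d \<le> ?CL / C_M \<delta> * Nh (x - z)" using C_M_pos by (simp add: pos_le_divide_eq mult.commute)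
  \<comment> \<open>This merges the two terms of the triangle inequality into one, which is the
    origin of the factor 2 in \<open>C_e\<close>.\<close>
  have ratio: "1 \<le> ?CL / C_M \<delta>"
  proof -
    have "1 / 4 * (1 - \<kappa>) \<le> 1" if "0 < \<kappa>" for \<kappa> :: real using that by simp
    from this[OF kappa(1)] have "C_M \<delta> \<le> 1" unfolding C_M_def .
    then show ?thesis using C_M_pos C_L_ge_2 by (simp add: pos_le_divide_eq)
  qed
  have "x - xh = (x - z) + (z - xh)" by simp
  then have "Nh (x - xh) \<le> Nh (x - z) + Nh (z - xh)" using Nh_triangle by metis
  also have "Nh (z - xh) = Nh d" by (simp add: d_def Nh_minus_commute)
  also have "Nh (x - z) + Nh d \<le> 1 * Nh (x - z) + ?CL / C_M \<delta> * Nh (x - z)" using Nd by simp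
  also have "\<dots> \<le> ?CL / C_M \<delta> * Nh (x - z) + ?CL / C_M \<delta> * Nh (x - z)"
    by (intro add_right_mono mult_right_mono ratio) simp
  also have "\<dots> = 2 * (?CL / C_M \<delta>) * Nh (x - z)" by simp
  also have "\<dots> \<le> 2 * (?CL / C_M \<delta>) * ((1 + ?Cb / ?cb) * Nh (x - x'))"
    using ratio by (intro mult_left_mono xz) auto
  also have "\<dots> = C_e CARD('n) lam \<delta> * Nh (x - x')" by (simp only: C_e_def mult.assoc)
  finally show ?thesis .
qed


section \<open>The continuous problem\<close>

text \<open>With the pair \<open>(\<nabla>\<phi>, \<phi>)\<close> as test function the rotation and
  penalty terms disappear, and the positive eigenvalue in front of the wave can be divided out. The
  factor 1 in \<open>\<phi>\<close> matches the form \<open>c * wave k \<theta>\<close> of the rules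
  for waves.\<close>

lemma emb_wave:
  fixes k :: "'n rvec" and \<theta> :: real
  assumes k: "\<forall>i. k $ i \<in> \<int>"
  defines "\<phi> \<equiv> (\<lambda>y. 1 * wave k \<theta> y)"
  shows "grad \<phi> \<in> W_per_vec" "\<phi> \<in> H1_per" "qh (emb (grad \<phi>) \<phi>) = 0" "rh (emb (grad \<phi>) \<phi>) = 0"
    "Lh (emb (grad \<phi>) \<phi>) = (lam + 4 * pi\<^sup>2 * (k \<bullet> k)) *\<^sub>R l2_of (wave k \<theta>)"
proof -
  have per: "smooth \<phi>" "Y_periodic \<phi>" unfolding \<phi>_def by (rule smooth_scaled_wave, rule wave_periodic[OF k])
  show \<phi>H: "\<phi> \<in> H1_per" by (rule smooth_H1_per(1)[OF per])
  have pd: "smooth (partial_deriv i \<phi>)" "Y_periodic (partial_deriv i \<phi>)" for i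
    using per smooth_partial_deriv partial_deriv_periodic by blast+
  have mean: "(\<integral>y. partial_deriv i \<phi> y \<partial>cellM) = 0" for i
    using periodic_integration_by_parts[OF smooth_C1[OF smooth_const[of 1]] _ smooth_C1[OF per(1)] per(2), of i]
    by (simp add: Y_periodic_def partial_deriv_const)
  show gW: "grad \<phi> \<in> W_per_vec"
    using smooth_H1_per(1)[OF pd] mean by (simp add: W_per_vec_def W_per_def)
  have second: "partial_deriv j (partial_deriv i \<phi>) y = - (4 * pi\<^sup>2) * (k $ i * k $ j) * wave k \<theta> y" for i j y
  proof -
    have "wave k (\<theta> + pi / 2 + pi / 2) y = - wave k \<theta> y"
      by (simp add: wave_def cos_add sin_add)
    then show ?thesis
      unfolding \<phi>_def partial_deriv_wave by (simp add: power2_eq_square)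
  qed
  define H where "H y = (\<chi> i j. - (4 * pi\<^sup>2) * (k $ i * k $ j) * wave k \<theta> y)" for y :: "'n rvec"
  have "AE y in cellM. \<forall>i. wgrad (partial_deriv i \<phi>) y = grad (partial_deriv i \<phi>) y"
    using smooth_H1_per(2)[OF pd] by (simp add: AE_all_countable)
  then have JH: "AE y in cellM. Jac (grad \<phi>) y = H y"
    by eventually_elim (simp add: vec_eq_iff second H_def)
  have HL2: "H \<in> L2"
    by (rule L2_AE_cong[OF Jac_L2[OF gW] _ JH])
       (auto simp: H_def wave_def intro!: continuous_measurable_cellM continuous_intros)
  have Om: "Om (emb (grad \<phi>) \<phi>) = l2_of H"
    using l2_of_eq_iff[OF Jac_L2[OF gW] HL2] JH by simp
  have gr: "gr (emb (grad \<phi>) \<phi>) = l2_of (grad \<phi>)"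
    using l2_of_eq_iff[OF H1_per_wgrad_L2[OF \<phi>H] smooth_periodic_L2(2)[OF per(1)]] smooth_H1_per(2)[OF per] by simp
  show "qh (emb (grad \<phi>) \<phi>) = 0" unfolding qh_def gr by simp
  have "transpose (H y) = H y" for y by (simp add: H_def transpose_def vec_eq_iff mult.commute)
  then show "rh (emb (grad \<phi>) \<phi>) = 0"
    unfolding rh_def Om by (simp add: l2_map_l2_of[OF transpose_bounded_linear HL2])
  have tr: "trace (H y) = (- (4 * pi\<^sup>2 * (k \<bullet> k))) *\<^sub>R wave k \<theta> y" for y
    by (simp add: trace_def H_def inner_vec_def sum_distrib_left sum_distrib_right sum_negf)
  have wL: "wave k \<theta> \<in> L2" using wave_L2[of 1 k \<theta>] by simp
  have "l2_map trace (l2_of H) = (- (4 * pi\<^sup>2 * (k \<bullet> k))) *\<^sub>R l2_of (wave k \<theta>)"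
    unfolding l2_map_l2_of[OF trace_bounded_linear HL2] tr by (rule l2_of_scaleR[OF wL])
  then show "Lh (emb (grad \<phi>) \<phi>) = (lam + 4 * pi\<^sup>2 * (k \<bullet> k)) *\<^sub>R l2_of (wave k \<theta>)"
    unfolding Lh_def Om by (simp add: \<phi>_def scaleR_add_left)
qed

text \<open>Testing with \<open>(\<nabla>\<phi>, \<phi>)\<close> for trigonometric \<open>\<phi>\<close> gives \<open>F = 0\<close>; testing with the solution itself then gives
  \<open>rot w = 0\<close> and \<open>w = \<nabla>u\<close>, so that the multiplier plays no role.\<close>

lemma continuous_solution:
  assumes M: "M \<subseteq> W_per"
    and sol: "mixed_solution lam \<delta> A b c f M (W_per_vec \<times> H1_per) m (w, u)"
  shows "ah (emb w u) z = 0"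
proof -
  have w: "w \<in> W_per_vec" and u: "u \<in> H1_per" and mM: "m \<in> M" using sol by (auto simp: mixed_solution_def)
  have mH: "m \<in> H1_per" using mM M W_per_H1_per by blast
  let ?x = "emb w u"
  have eq: "ah ?x (emb w' u') + gr (emb (\<lambda>y. 0) m) \<bullet> qh (emb w' u') = 0" if "w' \<in> W_per_vec" "u' \<in> H1_per" for w' u'
  proof -
    have "form_a lam \<delta> A b c f (w, u) (w', u') + form_b m (w', u') = 0"
      using sol that unfolding mixed_solution_def by blast
    then show ?thesis by (simp only: form_a_emb[OF w u that] form_b_emb[OF mH that])
  qed
  have constraint: "gr (emb (\<lambda>y. 0) m) \<bullet> qh ?x = 0"
  proof -
    have "form_b m (w, u) = 0" using sol mM unfolding mixed_solution_def by blast
    then show ?thesis by (simp only: form_b_emb[OF mH w u])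
  qed
  have "AE y in cellM. F_gamma lam A b c f (w, u) y = 0"
  proof (rule trigonometric_system_total[OF FH_emb(1)[OF w u]])
    fix k :: "'n rvec" and \<theta> :: real assume k: "\<forall>i. k $ i \<in> \<int>"
    note e = emb_wave[OF k, of \<theta>]
    let ?z = "emb (grad (\<lambda>y. 1 * wave k \<theta> y)) (\<lambda>y. 1 * wave k \<theta> y)"
    have "ah ?x ?z = 0" using eq[OF e(1,2)] unfolding e(3) by simp
    moreover have "ah ?x ?z = (lam + 4 * pi\<^sup>2 * (k \<bullet> k)) * (FH ?x \<bullet> l2_of (wave k \<theta>))"
      unfolding ah_def inner_rh e(3,4,5) by simp
    moreover have "0 < lam + 4 * pi\<^sup>2 * (k \<bullet> k)" using lam_pos by (intro add_pos_nonneg) auto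
    ultimately have "FH ?x \<bullet> l2_of (wave k \<theta>) = 0" by simp
    then show "(\<integral>y. F_gamma lam A b c f (w, u) y * wave k \<theta> y \<partial>cellM) = 0"
      using FH_emb[OF w u] wave_L2[of 1 k \<theta>] by (simp add: inner_l2_of)
  qed
  then have F0: "FH ?x = 0"
    using FH_emb[OF w u] l2_of_eq_iff[OF FH_emb(1)[OF w u] L2_zero] by (simp add: l2_of_zero)
  have s1: "0 < sigma1 \<delta>" unfolding sigma1_def using kappa by linarith
  have s2: "0 < sigma2 lam \<delta>"
    unfolding sigma2_def sigma2_tilde_def using kappa lam_pos by (intro mult_pos_pos add_pos_nonneg) auto
  have "sigma1 \<delta> * (rh ?x \<bullet> Om ?x) + sigma2 lam \<delta> * (qh ?x \<bullet> qh ?x) = 0"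
    using eq[OF w u] constraint F0 by (simp add: ah_def)
  moreover have "0 \<le> sigma1 \<delta> * (rh ?x \<bullet> Om ?x)" "0 \<le> sigma2 lam \<delta> * (qh ?x \<bullet> qh ?x)"
  proof -
    have "0 \<le> rh ?x \<bullet> Om ?x" unfolding inner_rh by simp
    then show "0 \<le> sigma1 \<delta> * (rh ?x \<bullet> Om ?x)" using s1 by (intro mult_nonneg_nonneg) auto
    show "0 \<le> sigma2 lam \<delta> * (qh ?x \<bullet> qh ?x)" using s2 by simp
  qed
  ultimately have "sigma1 \<delta> * (rh ?x \<bullet> Om ?x) = 0" "sigma2 lam \<delta> * (qh ?x \<bullet> qh ?x) = 0" by linarith+
  then have "rh ?x \<bullet> rh ?x = 0" "qh ?x \<bullet> qh ?x = 0"
    using s1 s2 inner_rh[of ?x ?x] by (auto simp del: emb_components inner_eq_zero_iff)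
  then have "rh ?x = 0" "qh ?x = 0" by auto
  then show ?thesis by (simp add: ah_def F0)
qed

text \<open>Formulated for arbitrary \<open>W\<close>, \<open>U\<close> and \<open>M\<close>, so
  that it serves the discrete as well as the continuous problem.\<close>

lemma mixed_solution_emb:
  assumes W: "W \<subseteq> W_per_vec" and U: "U \<subseteq> H1_per" and M: "M \<subseteq> H1_per"
    and sol: "mixed_solution lam \<delta> A b c f M (W \<times> U) m (w, u)"
  shows "m \<in> M" "w \<in> W" "u \<in> U"
    "z \<in> emb_set W U \<Longrightarrow> ah (emb w u) z + gr (emb (\<lambda>y. 0) m) \<bullet> qh z = 0"
    "m' \<in> emb_set {\<lambda>y. 0} M \<Longrightarrow> gr m' \<bullet> qh (emb w u) = 0"
proof -
  show mem: "m \<in> M" "w \<in> W" "u \<in> U" using sol by (auto simp: mixed_solution_def)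
  show "ah (emb w u) z + gr (emb (\<lambda>y. 0) m) \<bullet> qh z = 0" if z': "z \<in> emb_set W U"
  proof -
    obtain w' u' where z: "w' \<in> W" "u' \<in> U" "z = emb w' u'" using z' by (auto simp: emb_set_def)
    have "w \<in> W_per_vec" "u \<in> H1_per" "w' \<in> W_per_vec" "u' \<in> H1_per" "m \<in> H1_per" using mem z W U M by auto
    then have "form_a lam \<delta> A b c f (w, u) (w', u') = ah (emb w u) z" "form_b m (w', u') = gr (emb (\<lambda>y. 0) m) \<bullet> qh z"
      unfolding z(3) by (simp_all only: form_a_emb form_b_emb)
    then show ?thesis using sol z unfolding mixed_solution_def by force
  qed
  show "gr m' \<bullet> qh (emb w u) = 0" if m': "m' \<in> emb_set {\<lambda>y. 0} M"
  proof -
    obtain n where n: "n \<in> M" "m' = emb (\<lambda>y. 0) n" using m' by (auto simp: emb_set_def)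
    have "form_b n (w, u) = gr m' \<bullet> qh (emb w u)"
      unfolding n(2) using mem n W U M by (intro form_b_emb) auto
    then show ?thesis using sol n unfolding mixed_solution_def by force
  qed
qed

lemma mixed_solution_embI:
  assumes W: "W \<subseteq> W_per_vec" and U: "U \<subseteq> H1_per" and M: "M \<subseteq> H1_per"
    and mem: "m \<in> M" "w \<in> W" "u \<in> U"
    and eq: "\<And>z. z \<in> emb_set W U \<Longrightarrow> ah (emb w u) z + gr (emb (\<lambda>y. 0) m) \<bullet> qh z = 0"
      "\<And>m'. m' \<in> emb_set {\<lambda>y. 0} M \<Longrightarrow> gr m' \<bullet> qh (emb w u) = 0"
  shows "mixed_solution lam \<delta> A b c f M (W \<times> U) m (w, u)"
  unfolding mixed_solution_def
proof (intro conjI ballI)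
  fix x' assume "x' \<in> W \<times> U"
  then obtain w' u' where x': "x' = (w', u')" "w' \<in> W" "u' \<in> U" by auto
  have "w \<in> W_per_vec" "u \<in> H1_per" "w' \<in> W_per_vec" "u' \<in> H1_per" "m \<in> H1_per" using mem x' W U M by auto
  then have "form_a lam \<delta> A b c f (w, u) x' + form_b m x' = ah (emb w u) (emb w' u') + gr (emb (\<lambda>y. 0) m) \<bullet> qh (emb w' u')"
    unfolding x'(1) by (simp only: form_a_emb form_b_emb)
  also have "\<dots> = 0" using x' by (intro eq(1)) (auto simp: emb_set_def)
  finally show "form_a lam \<delta> A b c f (w, u) x' + form_b m x' = 0" .
next
  fix n assume n: "n \<in> M"
  have "form_b n (w, u) = gr (emb (\<lambda>y. 0) n) \<bullet> qh (emb w u)" using mem n W U M by (intro form_b_emb) auto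
  also have "\<dots> = 0" using n by (intro eq(2)) (auto simp: emb_set_def)
  finally show "form_b n (w, u) = 0" .
qed (use mem in auto)

lemma mixed_spaces_emb:
  assumes M: "closed_linear_subspace H1norm W_per M"
    and Wh: "closed_linear_subspace H1norm_vec W_per_vec Wh"
    and Uh: "closed_linear_subspace H1norm H1_per Uh"
    and Mh: "closed_linear_subspace H1norm (Uh \<inter> M) Mh"
  shows "mixed_spaces (emb_set Wh Uh) (emb_set {\<lambda>y. 0} Mh)"
proof -
  note W = closed_linear_subspaceD[OF Wh] and U = closed_linear_subspaceD[OF Uh] and Mm = closed_linear_subspaceD[OF Mh]
  have MW: "M \<subseteq> W_per" by (rule closed_linear_subspaceD(1)[OF M])
  have MhW: "Mh \<subseteq> W_per" and MhU: "Mh \<subseteq> Uh" and MhH: "Mh \<subseteq> H1_per" using Mm(1) MW W_per_H1_per by blast+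
  have cU: "closed (graph Uh)" by (rule closed_graph[OF Uh]) (simp_all add: graph_H1_per)
  have cM: "closed (graph M)" by (rule closed_graph[OF M _ closed_graph_W_per]) (use W_per_H1_per in blast)
  \<comment> \<open>\<open>Mh\<close> is closed relative to \<open>Uh \<inter> M\<close> only, so
    the graph of this intersection has to be closed first.\<close>
  have cUM: "closed (graph (Uh \<inter> M))" unfolding graph_Int[OF Uh M] by (intro closed_Int cU cM)
  have cMh: "closed (graph Mh)" by (rule closed_graph[OF Mh _ cUM]) (use U(1) in blast)
  show ?thesis
    unfolding mixed_spaces_def
  proof (intro conjI ballI)
    show "subspace (emb_set Wh Uh)" by (rule subspace_emb_set) (use W U in blast)+
    show "closed (emb_set Wh Uh)" by (intro closed_emb_set closed_graph_vec[OF Wh] cU)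
    show "subspace (emb_set {\<lambda>y. 0} Mh)"
      by (rule subspace_emb_set) (use Mm MhH zero_W_per_vec in auto)
    show "closed (emb_set {\<lambda>y. 0} Mh)"
      by (intro closed_emb_set cMh) (simp add: graph_vec_def)
    show "emb_set {\<lambda>y. 0} Mh \<subseteq> emb_set Wh Uh" using W(2) MhU by (auto simp: emb_set_def)
    show "compatible h" if "h \<in> emb_set Wh Uh" for h
      using that W(1) U(1) compatible_emb by (auto simp: emb_set_def)
    fix h assume "h \<in> emb_set {\<lambda>y. 0} Mh"
    then obtain n where n: "n \<in> Mh" "h = emb (\<lambda>y. 0) n" by (auto simp: emb_set_def)
    show "om h = 0" "Om h = 0" unfolding n(2) by (rule Om_emb_zero)+
    have nW: "n \<in> W_per" using n(1) MhW by blast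
    show "(norm (up h))\<^sup>2 \<le> real CARD('n) / 16 * (norm (gr h))\<^sup>2"
      using Poincare_W_per[OF nW] W_per_H1_per[OF nW] by (simp add: n(2) norm_l2_of H1_per_L2 H1_per_wgrad_L2)
  qed
qed

lemma C_e_pos: "0 < C_e CARD('n) lam \<delta>"
  unfolding C_e_def using C_M_pos C_L_ge_2 C_b_square(2) c_b_square(2)
  by (intro mult_pos_pos divide_pos_pos add_pos_nonneg divide_nonneg_nonneg) auto

end

theorem theorem2p3:
  fixes A :: "real ^ 'n::{finite,comm_ring_1} \<Rightarrow> 'l::metric_space \<Rightarrow> real ^ 'n::{finite,comm_ring_1} ^ 'n::{finite,comm_ring_1}"
    and b :: "real ^ 'n::{finite,comm_ring_1} \<Rightarrow> 'l \<Rightarrow> real ^ 'n::{finite,comm_ring_1}"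
    and c f :: "real ^ 'n::{finite,comm_ring_1} \<Rightarrow> 'l \<Rightarrow> real"
    and lam \<delta> \<zeta>\<^sub>1 \<zeta>\<^sub>2 :: real
    and M Mh Uh :: "(real ^ 'n::{finite,comm_ring_1} \<Rightarrow> real) set"
    and Wh :: "(real ^ 'n::{finite,comm_ring_1} \<Rightarrow> real ^ 'n::{finite,comm_ring_1}) set"
  assumes dim: "CARD('n) \<in> {2, 3}"
    and Lambda_compact: "compact (UNIV :: 'l set)"
    and A_sym: "\<And>y \<alpha>. transpose (A y \<alpha>) = A y \<alpha>"
    and A_per: "\<And>\<alpha>. Y_periodic (\<lambda>y. A y \<alpha>)"
    and b_per: "\<And>\<alpha>. Y_periodic (\<lambda>y. b y \<alpha>)"
    and c_per: "\<And>\<alpha>. Y_periodic (\<lambda>y. c y \<alpha>)"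
    and f_per: "\<And>\<alpha>. Y_periodic (\<lambda>y. f y \<alpha>)"
    and A_cont: "uniformly_continuous_on UNIV (\<lambda>(y, \<alpha>). A y \<alpha>)"
    and b_cont: "uniformly_continuous_on UNIV (\<lambda>(y, \<alpha>). b y \<alpha>)"
    and c_cont: "uniformly_continuous_on UNIV (\<lambda>(y, \<alpha>). c y \<alpha>)"
    and f_cont: "uniformly_continuous_on UNIV (\<lambda>(y, \<alpha>). f y \<alpha>)"
    and c_pos: "\<exists>c\<^sub>0>0. \<forall>y \<alpha>. c\<^sub>0 \<le> c y \<alpha>"
    and zeta_pos: "\<zeta>\<^sub>1 > 0" "\<zeta>\<^sub>2 > 0"
    and elliptic: "\<And>y \<alpha> \<xi>. \<zeta>\<^sub>1 * (norm \<xi>)\<^sup>2 \<le> (A y \<alpha> *v \<xi>) \<bullet> \<xi>"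
                  "\<And>y \<alpha> \<xi>. (A y \<alpha> *v \<xi>) \<bullet> \<xi> \<le> \<zeta>\<^sub>2 * (norm \<xi>)\<^sup>2"
    and lam_pos: "lam > 0"
    and delta: "0 < \<delta>" "\<delta> < 1"
    and Cordes: "\<And>y \<alpha>. (norm (A y \<alpha>))\<^sup>2 + (norm (b y \<alpha>))\<^sup>2 / (2 * lam) + (c y \<alpha>)\<^sup>2 / lam\<^sup>2
                   \<le> 1 / (real CARD('n) + \<delta>) * (trace (A y \<alpha>) + c y \<alpha> / lam)\<^sup>2"
    and M: "closed_linear_subspace H1norm W_per M"
    and Wh: "closed_linear_subspace H1norm_vec W_per_vec Wh"
    and Uh: "closed_linear_subspace H1norm H1_per Uh"
    and Mh: "closed_linear_subspace H1norm (Uh \<inter> M) Mh"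
  shows "(\<exists>mh wh uh. mixed_solution lam \<delta> A b c f Mh (Wh \<times> Uh) mh (wh, uh) \<and>
           (\<forall>mh' wh' uh'. mixed_solution lam \<delta> A b c f Mh (Wh \<times> Uh) mh' (wh', uh') \<longrightarrow>
              (AE y in cellM. mh' y = mh y \<and> wh' y = wh y \<and> uh' y = uh y))) \<and>
         (\<forall>m w u mh wh uh.
           mixed_solution lam \<delta> A b c f M (W_per_vec \<times> H1_per) m (w, u) \<longrightarrow>
           mixed_solution lam \<delta> A b c f Mh (Wh \<times> Uh) mh (wh, uh) \<longrightarrow>
           triple_norm lam ((\<lambda>y. w y - wh y), (\<lambda>y. u y - uh y)) \<le>
             C_e CARD('n) lam \<delta> *
             (INF (wh', uh') \<in> Wh \<times> Uh. triple_norm lam ((\<lambda>y. w y - wh' y), (\<lambda>y. u y - uh' y))))"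
proof -
  obtain c\<^sub>0 where "c\<^sub>0 > 0" "\<And>y \<alpha>. c\<^sub>0 \<le> c y \<alpha>" using c_pos by blast
  then have c_gt: "0 < c y \<alpha>" for y \<alpha> by (meson less_le_trans)
  interpret Cordes_coefficients A b c f lam \<delta>
    by unfold_locales (fact dim Lambda_compact A_cont b_cont c_cont f_cont c_gt lam_pos delta Cordes)+
  let ?S = "emb_set Wh Uh" and ?Q = "emb_set {\<lambda>y. 0} Mh"
  have SQ: "mixed_spaces ?S ?Q" by (rule mixed_spaces_emb[OF M Wh Uh Mh])
  note MW = closed_linear_subspaceD(1)[OF M]
  have sub: "Wh \<subseteq> W_per_vec" "Uh \<subseteq> H1_per" "Mh \<subseteq> H1_per"
    using closed_linear_subspaceD(1)[OF Wh] closed_linear_subspaceD(1)[OF Uh] closed_linear_subspaceD(1)[OF Mh] by auto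
  note sol = mixed_solution_emb[OF sub]
  obtain p x where px: "p \<in> ?Q" "x \<in> ?S" "\<And>z. z \<in> ?S \<Longrightarrow> ah x z + gr p \<bullet> qh z = 0" "\<And>m'. m' \<in> ?Q \<Longrightarrow> gr m' \<bullet> qh x = 0"
    using tuple_mixed_problem_solution[OF SQ] by blast
  obtain mh where mh: "mh \<in> Mh" "p = emb (\<lambda>y. 0) mh" using px(1) by (auto simp: emb_set_def)
  obtain wh uh where x: "wh \<in> Wh" "uh \<in> Uh" "x = emb wh uh" using px(2) by (auto simp: emb_set_def)
  have ex: "mixed_solution lam \<delta> A b c f Mh (Wh \<times> Uh) mh (wh, uh)"
    by (rule mixed_solution_embI[OF sub mh(1) x(1,2)]) (use px mh x in auto)
  have uniq: "AE y in cellM. mh' y = mh y \<and> wh' y = wh y \<and> uh' y = uh y"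
    if s: "mixed_solution lam \<delta> A b c f Mh (Wh \<times> Uh) mh' (wh', uh')" for mh' wh' uh'
  proof -
    note s' = sol[OF s]
    have "emb (\<lambda>y. 0) mh' = p \<and> emb wh' uh' = x"
      by (rule tuple_mixed_problem_unique[OF SQ _ _ s'(4,5) px])
         (use s'(1,2,3) in \<open>auto simp: emb_set_def\<close>)
    then have e: "emb (\<lambda>y. 0) mh' = emb (\<lambda>y. 0) mh" "emb wh' uh' = emb wh uh" using mh x by auto
    have mem: "mh' \<in> H1_per" "mh \<in> H1_per" "wh' \<in> W_per_vec" "wh \<in> W_per_vec" "uh' \<in> H1_per" "uh \<in> H1_per"
      using s'(1,2,3) mh(1) x(1,2) sub by auto
    have "AE y in cellM. mh' y = mh y" by (rule emb_eq_iff(2)[OF zero_W_per_vec zero_W_per_vec mem(1,2) e(1)])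
    moreover have "AE y in cellM. wh' y = wh y" "AE y in cellM. uh' y = uh y"
      using emb_eq_iff[OF mem(3-6) e(2)] by auto
    ultimately show ?thesis by eventually_elim simp
  qed
  have bound: "triple_norm lam ((\<lambda>y. w y - wh y), (\<lambda>y. u y - uh y)) \<le>
      C_e CARD('n) lam \<delta> * (INF (wh', uh') \<in> Wh \<times> Uh. triple_norm lam ((\<lambda>y. w y - wh' y), (\<lambda>y. u y - uh' y)))"
    if c: "mixed_solution lam \<delta> A b c f M (W_per_vec \<times> H1_per) m (w, u)"
      and d: "mixed_solution lam \<delta> A b c f Mh (Wh \<times> Uh) mh (wh, uh)" for m w u mh wh uh
  proof -
    note d' = sol[OF d]
    have w: "w \<in> W_per_vec" and u: "u \<in> H1_per" using c by (auto simp: mixed_solution_def)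
    have tn: "triple_norm lam ((\<lambda>y. w y - wh' y), (\<lambda>y. u y - uh' y)) = Nh (emb w u - emb wh' uh')"
      and comp: "compatible (emb w u - emb wh' uh')" if "wh' \<in> Wh" "uh' \<in> Uh" for wh' uh'
    proof -
      have mem: "wh' \<in> W_per_vec" "uh' \<in> H1_per" using that sub by auto
      show "triple_norm lam ((\<lambda>y. w y - wh' y), (\<lambda>y. u y - uh' y)) = Nh (emb w u - emb wh' uh')"
        unfolding emb_diff[OF w mem(1) u mem(2), symmetric]
        by (rule triple_norm_emb[OF W_per_vec_diff(1)[OF w mem(1)] H1_per_diff(1)[OF u mem(2)]])
      show "compatible (emb w u - emb wh' uh')"
        unfolding emb_diff[OF w mem(1) u mem(2), symmetric]
        by (rule compatible_emb[OF W_per_vec_diff(1)[OF w mem(1)] H1_per_diff(1)[OF u mem(2)]])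
    qed
    \<comment> \<open>The discrete multipliers belong to \<open>M\<close>, so the continuous
      solution satisfies the discrete constraint too.\<close>
    have constraint: "gr m' \<bullet> qh (emb w u) = 0" if "m' \<in> ?Q" for m'
    proof -
      have "m' \<in> emb_set {\<lambda>y. 0} M" using that closed_linear_subspaceD(1)[OF Mh] by (auto simp: emb_set_def)
      then show ?thesis
        by (rule mixed_solution_emb(5)[OF subset_refl subset_refl _ c, rotated]) (use MW W_per_H1_per in blast)
    qed
    have le: "Nh (emb w u - emb wh uh) \<le> C_e CARD('n) lam \<delta> * Nh (emb w u - emb wh' uh')"
      if "wh' \<in> Wh" "uh' \<in> Uh" for wh' uh'
    proof (rule quasi_optimality[OF SQ _ continuous_solution[OF MW c] constraint _ _ d'(4,5)])
      show "compatible (emb w u - y)" if "y \<in> ?S" for y using that comp by (auto simp: emb_set_def)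
    qed (use d'(1,2,3) that in \<open>auto simp: emb_set_def\<close>)
    \<comment> \<open>Division by the positive \<open>C_e\<close> turns the bounds for the
      individual pairs into a lower bound of the infimum.\<close>
    have "Nh (emb w u - emb wh uh) / C_e CARD('n) lam \<delta>
        \<le> (INF (wh', uh') \<in> Wh \<times> Uh. triple_norm lam ((\<lambda>y. w y - wh' y), (\<lambda>y. u y - uh' y)))"
    proof (rule cINF_greatest)
      show "Wh \<times> Uh \<noteq> {}" using d'(2,3) by auto
      fix q assume "q \<in> Wh \<times> Uh"
      then obtain wh' uh' where q: "q = (wh', uh')" "wh' \<in> Wh" "uh' \<in> Uh" by auto
      then show "Nh (emb w u - emb wh uh) / C_e CARD('n) lam \<delta>
          \<le> (case q of (wh', uh') \<Rightarrow> triple_norm lam ((\<lambda>y. w y - wh' y), (\<lambda>y. u y - uh' y)))"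
        using le[OF q(2,3)] C_e_pos by (simp add: tn pos_divide_le_eq mult.commute)
    qed
    then show ?thesis
      using C_e_pos by (simp add: tn[OF d'(2,3)] pos_divide_le_eq mult.commute)
  qed
  show ?thesis using ex uniq bound by blast
qed

end
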